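(* Let $G$ and $G'$ be finite nilpotent groups. Then $G$ and $G'$ have identical character tables if and only if the centers $\mathrm{Z}(\mathbb{Z}G)$ and $\mathrm{Z}(\mathbb{Z}G')$ of their integral group rings are isomorphic as rings.
   Context: Two finite groups $G$ and $G'$ have identical character tables if there are a bijection $\chi\mapsto\chi'$ between their sets of irreducible complex characters and a bijection $C\mapsto C'$ between their sets of conjugacy classes such that $\chi(g)=\chi'(g')$ for all irreducible characters $\chi$ of $G$, all conjugacy classes $C$ of $G$, and all $g\in C$, $g'\in C'$. *)

theory Defs
  imports "HOL-Algebra.Algebra" "Jordan_Normal_Form.VS_Connect"
begin

section \<open>Complex characters of groups\<close>

definition mat_trace :: "'a::comm_monoid_add mat \<Rightarrow> 'a" where
  "mat_trace A = (\<Sum>i<dim_row A. A $$ (i, i))"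

definition GL :: "nat \<Rightarrow> complex mat monoid" where
  "GL n = units_of (ring_mat TYPE(complex) n ())"

definition complex_rep :: "('a, 'c) monoid_scheme \<Rightarrow> nat \<Rightarrow> ('a \<Rightarrow> complex mat) \<Rightarrow> bool" where
  "complex_rep G n \<rho> \<longleftrightarrow> \<rho> \<in> hom G (GL n)"

definition irreducible_rep :: "('a, 'c) monoid_scheme \<Rightarrow> nat \<Rightarrow> ('a \<Rightarrow> complex mat) \<Rightarrow> bool" where
  "irreducible_rep G n \<rho> \<longleftrightarrow> complex_rep G n \<rho> \<and> n > 0 \<and>
     (\<forall>W. VectorSpace.subspace class_ring W (module_vec TYPE(complex) n) \<longrightarrow>
          (\<forall>g\<in>carrier G. \<forall>w\<in>W. \<rho> g *\<^sub>v w \<in> W) \<longrightarrow>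
          W = {0\<^sub>v n} \<or> W = carrier_vec n)"

text \<open>Characters are restricted to the carrier, so that two characters are equal as
  HOL functions iff they agree on the group.\<close>

definition rep_character :: "('a, 'c) monoid_scheme \<Rightarrow> ('a \<Rightarrow> complex mat) \<Rightarrow> 'a \<Rightarrow> complex" where
  "rep_character G \<rho> = (\<lambda>g\<in>carrier G. mat_trace (\<rho> g))"

definition irr_characters :: "('a, 'c) monoid_scheme \<Rightarrow> ('a \<Rightarrow> complex) set" where
  "irr_characters G = {rep_character G \<rho> | n \<rho>. irreducible_rep G n \<rho>}"

definition conjugacy_classes :: "('a, 'c) monoid_scheme \<Rightarrow> 'a set set" where
  "conjugacy_classes G =
     orbits G (carrier G) (\<lambda>g. \<lambda>h\<in>carrier G. g \<otimes>\<^bsub>G\<^esub> h \<otimes>\<^bsub>G\<^esub> inv\<^bsub>G\<^esub> g)"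

definition identical_character_tables ::
  "('a, 'c) monoid_scheme \<Rightarrow> ('b, 'd) monoid_scheme \<Rightarrow> bool" where
  "identical_character_tables G G' \<longleftrightarrow>
     (\<exists>\<Phi> \<Psi>. bij_betw \<Phi> (irr_characters G) (irr_characters G') \<and>
            bij_betw \<Psi> (conjugacy_classes G) (conjugacy_classes G') \<and>
            (\<forall>\<chi>\<in>irr_characters G. \<forall>C\<in>conjugacy_classes G. \<forall>g\<in>C. \<forall>g'\<in>\<Psi> C. \<chi> g = \<Phi> \<chi> g'))"


section \<open>Nilpotent groups\<close>

primrec lower_central :: "('a, 'c) monoid_scheme \<Rightarrow> nat \<Rightarrow> 'a set" where
  "lower_central G 0 = carrier G"
| "lower_central G (Suc n) = generate G
     {x \<otimes>\<^bsub>G\<^esub> y \<otimes>\<^bsub>G\<^esub> inv\<^bsub>G\<^esub> x \<otimes>\<^bsub>G\<^esub> inv\<^bsub>G\<^esub> y | x y. x \<in> lower_central G n \<and> y \<in> carrier G}"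

definition nilpotent_group :: "('a, 'c) monoid_scheme \<Rightarrow> bool" where
  "nilpotent_group G \<longleftrightarrow> group G \<and> (\<exists>n. lower_central G n = {\<one>\<^bsub>G\<^esub>})"


section \<open>Integral group rings and centres\<close>

text \<open>The formal sum of the terms \<open>f x \<cdot> x\<close> is encoded by its coefficient function
  \<open>f\<close>, which has finite support and vanishes outside the carrier. The product is convolution.\<close>

definition integral_group_ring :: "('a, 'c) monoid_scheme \<Rightarrow> ('a \<Rightarrow> int) ring" where
  "integral_group_ring G =
     \<lparr> carrier = {f. finite {x. f x \<noteq> 0} \<and> {x. f x \<noteq> 0} \<subseteq> carrier G},
       Group.monoid.mult = (\<lambda>f g x. \<Sum>(y, z)\<in>{(y, z). f y \<noteq> 0 \<and> g z \<noteq> 0 \<and> y \<otimes>\<^bsub>G\<^esub> z = x}. f y * g z),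
       one = (\<lambda>x. if x = \<one>\<^bsub>G\<^esub> then 1 else 0),
       ring.zero = (\<lambda>x. 0),
       ring.add = (\<lambda>f g x. f x + g x) \<rparr>"

lemma integral_group_ring_mult:
  assumes "finite S" "{x. f x \<noteq> 0} \<subseteq> S" "finite T" "{x. g x \<noteq> 0} \<subseteq> T"
  shows "(f \<otimes>\<^bsub>integral_group_ring G\<^esub> g) x =
    (\<Sum>y\<in>S. \<Sum>z\<in>T. if y \<otimes>\<^bsub>G\<^esub> z = x then f y * g z else 0)"
proof -
  have "(\<Sum>y\<in>S. \<Sum>z\<in>T. if y \<otimes>\<^bsub>G\<^esub> z = x then f y * g z else 0) =
    (\<Sum>(y, z)\<in>S \<times> T. if y \<otimes>\<^bsub>G\<^esub> z = x then f y * g z else 0)"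
    by (simp add: sum.cartesian_product)
  also have "\<dots> = (\<Sum>(y, z)\<in>{(y, z). f y \<noteq> 0 \<and> g z \<noteq> 0 \<and> y \<otimes>\<^bsub>G\<^esub> z = x}. f y * g z)"
  proof (rule sum.mono_neutral_cong_right)
    show "finite (S \<times> T)" using assms by simp
    show "{(y, z). f y \<noteq> 0 \<and> g z \<noteq> 0 \<and> y \<otimes>\<^bsub>G\<^esub> z = x} \<subseteq> S \<times> T"
      using assms(2,4) by blast
  qed auto
  finally show ?thesis by (simp add: integral_group_ring_def)
qed

lemma integral_group_ring_mult_closed:
  assumes "group G" "f \<in> carrier (integral_group_ring G)" "g \<in> carrier (integral_group_ring G)"
  shows "f \<otimes>\<^bsub>integral_group_ring G\<^esub> g \<in> carrier (integral_group_ring G)"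
    and "{x. (f \<otimes>\<^bsub>integral_group_ring G\<^esub> g) x \<noteq> 0}
      \<subseteq> (\<lambda>(y, z). y \<otimes>\<^bsub>G\<^esub> z) ` ({x. f x \<noteq> 0} \<times> {x. g x \<noteq> 0})" (is "?A \<subseteq> ?B")
proof -
  interpret group G by fact
  show sub: "?A \<subseteq> ?B"
  proof
    fix x assume "x \<in> ?A"
    hence "(\<Sum>(y, z)\<in>{(y, z). f y \<noteq> 0 \<and> g z \<noteq> 0 \<and> y \<otimes>\<^bsub>G\<^esub> z = x}. f y * g z) \<noteq> 0"
      by (simp add: integral_group_ring_def)
    then obtain p where "p \<in> {(y, z). f y \<noteq> 0 \<and> g z \<noteq> 0 \<and> y \<otimes>\<^bsub>G\<^esub> z = x}"
      by (meson sum.not_neutral_contains_not_neutral)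
    thus "x \<in> ?B" by force
  qed
  have fin: "finite ?B" "?B \<subseteq> carrier G"
    using assms(2,3) by (auto simp: integral_group_ring_def)
  show "f \<otimes>\<^bsub>integral_group_ring G\<^esub> g \<in> carrier (integral_group_ring G)"
    using finite_subset[OF sub fin(1)] subset_trans[OF sub fin(2)]
    by (simp add: integral_group_ring_def)
qed

lemma integral_group_ring_assoc:
  fixes G (structure)
  assumes G: "group G"
    and f: "f \<in> carrier (integral_group_ring G)"
    and g: "g \<in> carrier (integral_group_ring G)"
    and h: "h \<in> carrier (integral_group_ring G)"
  shows "(f \<otimes>\<^bsub>integral_group_ring G\<^esub> g) \<otimes>\<^bsub>integral_group_ring G\<^esub> h =
    f \<otimes>\<^bsub>integral_group_ring G\<^esub> (g \<otimes>\<^bsub>integral_group_ring G\<^esub> h)"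
proof
  fix x
  interpret group G by fact
  let ?R = "integral_group_ring G"
  define S T U where "S = {x. f x \<noteq> 0}" and "T = {x. g x \<noteq> 0}" and "U = {x. h x \<noteq> 0}"
  have fin: "finite S" "finite T" "finite U"
    and car: "S \<subseteq> carrier G" "T \<subseteq> carrier G" "U \<subseteq> carrier G"
    using f g h by (auto simp: integral_group_ring_def S_def T_def U_def)
  define P Q where "P = (\<lambda>(y, z). y \<otimes>\<^bsub>G\<^esub> z) ` (S \<times> T)" and "Q = (\<lambda>(y, z). y \<otimes>\<^bsub>G\<^esub> z) ` (T \<times> U)"
  have PQ: "finite P" "finite Q" using fin by (auto simp: P_def Q_def)
  have inP: "y \<otimes> z \<in> P" if "y \<in> S" "z \<in> T" for y z using that by (force simp: P_def)
  have inQ: "y \<otimes> z \<in> Q" if "y \<in> T" "z \<in> U" for y z using that by (force simp: Q_def)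
  have fg: "(f \<otimes>\<^bsub>?R\<^esub> g) u = (\<Sum>y\<in>S. \<Sum>z\<in>T. if y \<otimes> z = u then f y * g z else 0)" for u
    using fin by (intro integral_group_ring_mult) (auto simp: S_def T_def)
  have gh: "(g \<otimes>\<^bsub>?R\<^esub> h) u = (\<Sum>z\<in>T. \<Sum>w\<in>U. if z \<otimes> w = u then g z * h w else 0)" for u
    using fin by (intro integral_group_ring_mult) (auto simp: T_def U_def)
  have "((f \<otimes>\<^bsub>?R\<^esub> g) \<otimes>\<^bsub>?R\<^esub> h) x =
      (\<Sum>u\<in>P. \<Sum>w\<in>U. if u \<otimes> w = x then (f \<otimes>\<^bsub>?R\<^esub> g) u * h w else 0)"
    using integral_group_ring_mult_closed(2)[OF G f g] fin PQ
    by (intro integral_group_ring_mult) (auto simp: S_def T_def U_def P_def)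
  also have "\<dots> = (\<Sum>u\<in>P. \<Sum>w\<in>U. \<Sum>y\<in>S. \<Sum>z\<in>T.
      if y \<otimes> z = u then if u \<otimes> w = x then f y * g z * h w else 0 else 0)"
    unfolding fg by (intro sum.cong refl) (auto simp: sum_distrib_right intro!: sum.cong)
  also have "\<dots> = (\<Sum>w\<in>U. \<Sum>y\<in>S. \<Sum>z\<in>T. \<Sum>u\<in>P.
      if y \<otimes> z = u then if u \<otimes> w = x then f y * g z * h w else 0 else 0)"
    by (simp add: sum.swap[of _ _ P])
  also have "\<dots> = (\<Sum>w\<in>U. \<Sum>y\<in>S. \<Sum>z\<in>T. if y \<otimes> z \<otimes> w = x then f y * g z * h w else 0)"
    using PQ inP by (intro sum.cong refl) (simp add: sum.delta')
  also have "\<dots> = (\<Sum>y\<in>S. \<Sum>z\<in>T. \<Sum>w\<in>U. if y \<otimes> z \<otimes> w = x then f y * g z * h w else 0)"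
    by (simp add: sum.swap[of _ _ U])
  also have "\<dots> = (\<Sum>y\<in>S. \<Sum>z\<in>T. \<Sum>w\<in>U. if y \<otimes> (z \<otimes> w) = x then f y * g z * h w else 0)"
    using car by (intro sum.cong refl) (simp add: m_assoc subset_eq)
  also have "\<dots> = (\<Sum>y\<in>S. \<Sum>z\<in>T. \<Sum>w\<in>U. \<Sum>v\<in>Q.
      if z \<otimes> w = v then if y \<otimes> v = x then f y * g z * h w else 0 else 0)"
    using PQ inQ by (intro sum.cong refl) (simp add: sum.delta')
  also have "\<dots> = (\<Sum>y\<in>S. \<Sum>v\<in>Q. \<Sum>z\<in>T. \<Sum>w\<in>U.
      if z \<otimes> w = v then if y \<otimes> v = x then f y * g z * h w else 0 else 0)"
    by (simp add: sum.swap[of _ Q])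
  also have "\<dots> = (\<Sum>y\<in>S. \<Sum>v\<in>Q. if y \<otimes> v = x then f y * (g \<otimes>\<^bsub>?R\<^esub> h) v else 0)"
    unfolding gh by (intro sum.cong refl) (auto simp: sum_distrib_left mult.assoc intro!: sum.cong)
  also have "\<dots> = (f \<otimes>\<^bsub>?R\<^esub> (g \<otimes>\<^bsub>?R\<^esub> h)) x"
    using integral_group_ring_mult_closed(2)[OF G g h] fin PQ
    by (intro integral_group_ring_mult[symmetric]) (auto simp: S_def T_def U_def Q_def)
  finally show "((f \<otimes>\<^bsub>?R\<^esub> g) \<otimes>\<^bsub>?R\<^esub> h) x = (f \<otimes>\<^bsub>?R\<^esub> (g \<otimes>\<^bsub>?R\<^esub> h)) x" .
qed

lemma ring_integral_group_ring:
  fixes G (structure)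
  assumes G: "group G"
  shows "ring (integral_group_ring G)"
proof -
  interpret group G by fact
  let ?R = "integral_group_ring G"
  have simps: "f \<oplus>\<^bsub>?R\<^esub> g = (\<lambda>x. f x + g x)" "\<zero>\<^bsub>?R\<^esub> = (\<lambda>x. 0)"
    "\<one>\<^bsub>?R\<^esub> = (\<lambda>x. if x = \<one>\<^bsub>G\<^esub> then 1 else 0)"
    "f \<in> carrier ?R \<longleftrightarrow> finite {x. f x \<noteq> 0} \<and> {x. f x \<noteq> 0} \<subseteq> carrier G" for f g
    by (simp_all add: integral_group_ring_def)
  have add_closed: "f \<oplus>\<^bsub>?R\<^esub> g \<in> carrier ?R" if "f \<in> carrier ?R" "g \<in> carrier ?R" for f g
    proof -
    have "{x. f x + g x \<noteq> 0} \<subseteq> {x. f x \<noteq> 0} \<union> {x. g x \<noteq> 0}" by auto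
    with that show ?thesis
      unfolding simps by (meson Un_least finite_UnI finite_subset subset_trans)
  qed
  have one: "\<one>\<^bsub>?R\<^esub> \<in> carrier ?R" by (simp add: simps)
  have one_mult: "\<one>\<^bsub>?R\<^esub> \<otimes>\<^bsub>?R\<^esub> f = f" "f \<otimes>\<^bsub>?R\<^esub> \<one>\<^bsub>?R\<^esub> = f" if f: "f \<in> carrier ?R" for f
  proof -
    from f have fin: "finite {x. f x \<noteq> 0}" and car: "\<And>x. f x \<noteq> 0 \<Longrightarrow> x \<in> carrier G"
      by (auto simp: simps)
    show "\<one>\<^bsub>?R\<^esub> \<otimes>\<^bsub>?R\<^esub> f = f"
    proof
      fix x
      have "(\<one>\<^bsub>?R\<^esub> \<otimes>\<^bsub>?R\<^esub> f) x =
          (\<Sum>y\<in>{\<one>}. \<Sum>z\<in>{x. f x \<noteq> 0}. if y \<otimes> z = x then \<one>\<^bsub>?R\<^esub> y * f z else 0)"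
        by (rule integral_group_ring_mult) (auto simp: simps fin)
      also have "\<dots> = (\<Sum>z\<in>{x. f x \<noteq> 0}. if z = x then f z else 0)"
        using car by (auto simp: simps intro!: sum.cong)
      finally show "(\<one>\<^bsub>?R\<^esub> \<otimes>\<^bsub>?R\<^esub> f) x = f x" using fin by simp
    qed
    show "f \<otimes>\<^bsub>?R\<^esub> \<one>\<^bsub>?R\<^esub> = f"
    proof
      fix x
      have "(f \<otimes>\<^bsub>?R\<^esub> \<one>\<^bsub>?R\<^esub>) x =
          (\<Sum>z\<in>{x. f x \<noteq> 0}. \<Sum>y\<in>{\<one>}. if z \<otimes> y = x then f z * \<one>\<^bsub>?R\<^esub> y else 0)"
        by (rule integral_group_ring_mult) (auto simp: simps fin)
      also have "\<dots> = (\<Sum>z\<in>{x. f x \<noteq> 0}. if z = x then f z else 0)"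
        using car by (auto simp: simps intro!: sum.cong)
      finally show "(f \<otimes>\<^bsub>?R\<^esub> \<one>\<^bsub>?R\<^esub>) x = f x" using fin by simp
    qed
  qed
  have distr: "(f \<oplus>\<^bsub>?R\<^esub> g) \<otimes>\<^bsub>?R\<^esub> h = f \<otimes>\<^bsub>?R\<^esub> h \<oplus>\<^bsub>?R\<^esub> g \<otimes>\<^bsub>?R\<^esub> h"
    "h \<otimes>\<^bsub>?R\<^esub> (f \<oplus>\<^bsub>?R\<^esub> g) = h \<otimes>\<^bsub>?R\<^esub> f \<oplus>\<^bsub>?R\<^esub> h \<otimes>\<^bsub>?R\<^esub> g"
    if "f \<in> carrier ?R" "g \<in> carrier ?R" "h \<in> carrier ?R" for f g h
  proof -
    let ?S = "{x. f x \<noteq> 0} \<union> {x. g x \<noteq> 0}" and ?T = "{x. h x \<noteq> 0}"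
    have fin: "finite ?S" "finite ?T" using that by (auto simp: simps)
    have L: "(k \<otimes>\<^bsub>?R\<^esub> h) x = (\<Sum>y\<in>?S. \<Sum>z\<in>?T. if y \<otimes> z = x then k y * h z else 0)"
      "(h \<otimes>\<^bsub>?R\<^esub> k) x = (\<Sum>y\<in>?T. \<Sum>z\<in>?S. if y \<otimes> z = x then h y * k z else 0)"
      if "{x. k x \<noteq> 0} \<subseteq> ?S" for k x
      using fin that by (auto intro!: integral_group_ring_mult)
    have sub: "{x. (f \<oplus>\<^bsub>?R\<^esub> g) x \<noteq> 0} \<subseteq> ?S" "{x. f x \<noteq> 0} \<subseteq> ?S" "{x. g x \<noteq> 0} \<subseteq> ?S"
      by (auto simp: simps)
    show "(f \<oplus>\<^bsub>?R\<^esub> g) \<otimes>\<^bsub>?R\<^esub> h = f \<otimes>\<^bsub>?R\<^esub> h \<oplus>\<^bsub>?R\<^esub> g \<otimes>\<^bsub>?R\<^esub> h"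
      unfolding simps(1)[of "f \<otimes>\<^bsub>?R\<^esub> h"] L(1)[OF sub(1)] L(1)[OF sub(2)] L(1)[OF sub(3)]
      unfolding simps(1) sum.distrib[symmetric] fun_eq_iff L(1)[OF sub(1), unfolded simps(1)]
      by (intro allI sum.cong refl) (auto simp: algebra_simps)
    show "h \<otimes>\<^bsub>?R\<^esub> (f \<oplus>\<^bsub>?R\<^esub> g) = h \<otimes>\<^bsub>?R\<^esub> f \<oplus>\<^bsub>?R\<^esub> h \<otimes>\<^bsub>?R\<^esub> g"
      unfolding simps(1)[of "h \<otimes>\<^bsub>?R\<^esub> f"] L(2)[OF sub(1)] L(2)[OF sub(2)] L(2)[OF sub(3)]
      unfolding simps(1) sum.distrib[symmetric] fun_eq_iff L(2)[OF sub(1), unfolded simps(1)]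
      by (intro allI sum.cong refl) (auto simp: algebra_simps)
  qed
  show ?thesis
  proof (rule ringI)
    show "abelian_group ?R"
    proof (rule abelian_groupI)
      fix f assume "f \<in> carrier ?R"
      thus "\<exists>g\<in>carrier ?R. g \<oplus>\<^bsub>?R\<^esub> f = \<zero>\<^bsub>?R\<^esub>"
        by (intro bexI[of _ "\<lambda>x. - f x"]) (auto simp: simps)
    qed (use add_closed in \<open>auto simp: simps algebra_simps\<close>)
    show "monoid ?R"
      by (rule monoidI)
        (simp_all add: integral_group_ring_mult_closed(1)[OF G] integral_group_ring_assoc[OF G] one one_mult)
  qed (simp_all add: distr)
qed

definition ring_center :: "('a, 'c) ring_scheme \<Rightarrow> ('a, 'c) ring_scheme" where
  "ring_center R = R \<lparr> carrier :=
     {x \<in> carrier R. \<forall>y\<in>carrier R. x \<otimes>\<^bsub>R\<^esub> y = y \<otimes>\<^bsub>R\<^esub> x} \<rparr>"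

end

theory Submission
  imports Defs "Jordan_Normal_Form.Schur_Decomposition"
begin

text \<open>Write \<open>Z\<close> for the centre of the integral group ring of a finite group \<open>G\<close>. Its elements are the integral
  class functions, with convolution as product, and the class sums are a basis. The ring homomorphisms from
  \<open>Z\<close> to the complex numbers are the pairings with the functions \<open>\<theta> = \<chi> / \<chi> \<one>\<close> for irreducible characters
  \<open>\<chi>\<close>. These functions are characterised by a functional equation, and called spherical here. The
  correspondence is \<open>irr_character_spherical\<close> and \<open>spherical_imp_irr_character\<close>. By the orthogonality
  relations, pairings with spherical functions separate class functions (\<open>class_function_eqI\<close>). The degree
  is recovered from \<open>\<chi> \<one> ^ 2 * (\<Sum> \<bar>\<theta> g\<bar> ^ 2) = |G|\<close>.

  From tables to centres: column orthogonality shows that matched classes have equal size and matched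
  characters equal degree. So a matching of the tables also matches the spherical functions, and
  the bijection of class sums is multiplicative because pairings separate (\<open>center_iso_transport\<close>).

  From centres to tables: let \<open>\<phi>\<close> be a ring isomorphism between the centres for \<open>G\<close> and \<open>H\<close>. Homomorphisms to the
  complex numbers can be pulled back along \<open>\<phi>\<close>, and so \<open>\<phi>\<close> commutes with inversion of group elements. The
  pullback of the augmentation belongs to an irreducible character of \<open>G\<close> with rational values. Comparing
  the elements on which the two centres act through these homomorphisms gives \<open>|H| \<le> |G|\<close>, with equality
  only if that character is linear (\<open>augmentation_pullback\<close>). As the situation is symmetric, it is linear with values
  \<open>1\<close> and \<open>- 1\<close>, and after twisting by it \<open>\<phi>\<close> preserves the augmentation (\<open>exists_normalized\<close>).

  Now \<open>\<phi>\<close> maps class sums to class sums, by induction along the upper central series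
  (\<open>class_sums_correspond\<close>). Let \<open>x\<close> be the sum of a class \<open>C\<close> in the next term of the series. All quotients of
  elements of \<open>C\<close> lie in the current term, and there \<open>\<phi>\<close> is known to preserve the coefficient
  of the identity. For the coefficients \<open>b\<close> of \<open>\<phi> x\<close>, looking at \<open>x\<close> times its inverse gives
  \<open>\<Sum> b ^ 2 = |C|\<close>, while the augmentation gives \<open>\<Sum> b = |C|\<close>. Hence \<open>b\<close> only takes the values \<open>0\<close> and \<open>1\<close>. So
  \<open>\<phi> x\<close> is a sum of distinct class sums, and since the same holds for the inverse of \<open>\<phi>\<close>, it is a single one.
  For nilpotent groups the series reaches the whole group. A bijection of class sums
  that respects products and sizes matches the spherical functions, their norms and thus the characters.\<close>

section \<open>Matrices with injective columns and subspaces\<close>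

text \<open>Injectivity of the linear map, for maps between spaces of arbitrary dimensions. Such a matrix serves as a
  basis of its range.\<close>

definition injective_mat :: "'a::semiring_1 mat \<Rightarrow> bool" where
  "injective_mat T \<longleftrightarrow>
     (\<forall>x\<in>carrier_vec (dim_col T). T *\<^sub>v x = 0\<^sub>v (dim_row T) \<longrightarrow> x = 0\<^sub>v (dim_col T))"

lemma injective_matD:
  "\<lbrakk>injective_mat T; T \<in> carrier_mat n m; x \<in> carrier_vec m; T *\<^sub>v x = 0\<^sub>v n\<rbrakk> \<Longrightarrow> x = 0\<^sub>v m"
  by (auto simp: injective_mat_def)

lemma injective_mat_cancel_vec:
  fixes T :: "'a::field mat"
  assumes "injective_mat T" "T \<in> carrier_mat n m" "x \<in> carrier_vec m" "y \<in> carrier_vec m"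
    "T *\<^sub>v x = T *\<^sub>v y"
  shows "x = y"
proof -
  have "T *\<^sub>v (x - y) = 0\<^sub>v n"
    using assms by (simp add: mult_minus_distrib_mat_vec[OF assms(2)])
  hence "x - y = 0\<^sub>v m" using injective_matD[OF assms(1,2)] assms(3,4) by simp
  show ?thesis
  proof (rule eq_vecI)
    fix i assume i: "i < dim_vec y"
    have "(x - y) $ i = 0" using \<open>x - y = 0\<^sub>v m\<close> i assms(4) by simp
    thus "x $ i = y $ i" using i assms by simp
  qed (use assms in auto)
qed

lemma mult_mat_unit_vec:
  fixes A :: "'a::semiring_1 mat"
  assumes "A \<in> carrier_mat n m" "j < m"
  shows "A *\<^sub>v unit_vec m j = col A j"
  using assms by (intro eq_vecI) auto

text \<open>This is what makes the action on an invariant subspace, written in a basis, a homomorphism.\<close>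

lemma injective_mat_cancel_left:
  fixes T :: "'a::field mat"
  assumes "injective_mat T" "T \<in> carrier_mat n m" "A \<in> carrier_mat m k" "B \<in> carrier_mat m k"
    "T * A = T * B"
  shows "A = B"
proof (rule mat_col_eqI)
  fix j assume j: "j < dim_col B"
  have "T *\<^sub>v col A j = T *\<^sub>v col B j"
    using assms(5) j assms(4) col_mult2[OF assms(2,3), of j] col_mult2[OF assms(2,4), of j] by simp
  moreover have "col A j \<in> carrier_vec m" "col B j \<in> carrier_vec m"
    using assms(3,4) by (auto simp: carrier_matD)
  ultimately show "col A j = col B j"
    using injective_mat_cancel_vec[OF assms(1,2)] by blast
qed (use assms in auto)

lemma injective_mat_mult:
  fixes T :: "'a::field mat"
  assumes "injective_mat T" "T \<in> carrier_mat n m" "injective_mat S" "S \<in> carrier_mat m k"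
  shows "injective_mat (T * S)"
  using assms(1,3) unfolding injective_mat_def
  using assms(2,4) by (auto simp: assoc_mult_mat_vec[OF assms(2,4)])

text \<open>Padding a wide matrix with zero rows makes it singular, so it has a kernel.\<close>

lemma injective_mat_dims:
  fixes S :: "'a::field mat"
  assumes inj: "injective_mat S" and S: "S \<in> carrier_mat n m"
  shows "m \<le> n"
proof (rule ccontr)
  assume "\<not> m \<le> n" hence nm: "n < m" by simp
  define A where "A = mat m m (\<lambda>(i,j). if i < n then S $$ (i,j) else 0)"
  have A: "A \<in> carrier_mat m m" by (simp add: A_def)
  have "transpose_mat A *\<^sub>v unit_vec m n = 0\<^sub>v m"
    using nm by (subst mult_mat_unit_vec[of _ m m]) (auto simp: A_def)
  moreover have "unit_vec m n \<noteq> (0\<^sub>v m :: 'a vec)" using nm by (auto simp: vec_eq_iff)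
  ultimately have "det (transpose_mat A) = 0"
    by (subst det_0_iff_vec_prod_zero_field[of _ m]) (auto simp: A_def intro!: exI[of _ "unit_vec m n"])
  hence "det A = 0" using det_transpose[OF A] by simp
  then obtain x where x: "x \<in> carrier_vec m" "x \<noteq> 0\<^sub>v m" "A *\<^sub>v x = 0\<^sub>v m"
    using det_0_iff_vec_prod_zero_field[OF A] by blast
  have "S *\<^sub>v x = 0\<^sub>v n"
  proof (rule eq_vecI)
    fix i assume i: "i < dim_vec (0\<^sub>v n :: 'a vec)"
    have "(A *\<^sub>v x) $ i = 0" using x(3) i nm by simp
    thus "(S *\<^sub>v x) $ i = 0\<^sub>v n $ i" using i nm S x(1) by (simp add: A_def scalar_prod_def)
  qed (use S in auto)
  thus False using injective_matD[OF inj S x(1)] x(2) by simp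
qed

lemma injective_square_mat_surj:
  fixes S :: "'a::field mat"
  assumes inj: "injective_mat S" and S: "S \<in> carrier_mat n n" and w: "w \<in> carrier_vec n"
  obtains x where "x \<in> carrier_vec n" "w = S *\<^sub>v x"
proof -
  have "det S \<noteq> 0"
    using det_0_iff_vec_prod_zero_field[OF S] injective_matD[OF inj S] by blast
  from det_non_zero_imp_unit[OF S this, where b = "()"]
  obtain B where B: "B \<in> carrier_mat n n" "S * B = 1\<^sub>m n"
    by (auto simp: Units_def ring_mat_simps)
  have "S *\<^sub>v (B *\<^sub>v w) = w"
    using assoc_mult_mat_vec[OF S B(1) w] B(2) w by simp
  thus ?thesis using that[of "B *\<^sub>v w"] B(1) w by simp
qed

text \<open>A matrix of maximal width among the injective ones with range in \<open>W\<close> has range \<open>W\<close>: its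
  columns are a basis of \<open>W\<close>.\<close>

lemma subspace_is_range:
  fixes W :: "'a::field vec set"
  assumes sub: "W \<subseteq> carrier_vec n" and zero: "0\<^sub>v n \<in> W"
    and add: "\<And>v w. \<lbrakk>v \<in> W; w \<in> W\<rbrakk> \<Longrightarrow> v + w \<in> W"
    and smult: "\<And>c v. v \<in> W \<Longrightarrow> c \<cdot>\<^sub>v v \<in> W"
  obtains m S where "S \<in> carrier_mat n m" "m \<le> n" "injective_mat S"
    "W = (*\<^sub>v) S ` carrier_vec m"
proof -
  define P where "P m \<longleftrightarrow> (\<exists>S\<in>carrier_mat n m. injective_mat S \<and> (\<forall>x\<in>carrier_vec m. S *\<^sub>v x \<in> W))" for m
  have bound: "m \<le> n" if "P m" for m
    using that injective_mat_dims by (auto simp: P_def)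
  have "P 0"
    unfolding P_def
  proof (intro bexI[of _ "0\<^sub>m n 0"] conjI ballI)
    fix x :: "'a vec" assume "x \<in> carrier_vec 0"
    hence "0\<^sub>m n 0 *\<^sub>v x = 0\<^sub>v n" by (intro eq_vecI) (auto simp: scalar_prod_def)
    thus "0\<^sub>m n 0 *\<^sub>v x \<in> W" using zero by simp
  qed (auto simp: injective_mat_def)
  define m where "m = (GREATEST m. P m)"
  have Pm: "P m" unfolding m_def using \<open>P 0\<close> bound by (rule GreatestI_nat)
  have max: "k \<le> m" if "P k" for k
    unfolding m_def using that bound by (rule Greatest_le_nat)
  from Pm obtain S where S: "S \<in> carrier_mat n m" "injective_mat S"
    and SW: "\<And>x. x \<in> carrier_vec m \<Longrightarrow> S *\<^sub>v x \<in> W"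
    by (auto simp: P_def)
  have "w \<in> (*\<^sub>v) S ` carrier_vec m" if w: "w \<in> W" for w
  proof (rule ccontr)
    assume notin: "w \<notin> (*\<^sub>v) S ` carrier_vec m"
    define S' where "S' = mat n (Suc m) (\<lambda>(i,j). if j < m then S $$ (i,j) else w $ i)"
    define low where "low x = vec m (\<lambda>i. x $ i)" for x :: "'a vec"
    have S': "S' \<in> carrier_mat n (Suc m)" by (simp add: S'_def)
    have wc: "w \<in> carrier_vec n" using w sub by blast
    have low: "low x \<in> carrier_vec m" for x by (simp add: low_def)
    have split: "S' *\<^sub>v x = S *\<^sub>v low x + x $ m \<cdot>\<^sub>v w" if x: "x \<in> carrier_vec (Suc m)" for x
    proof (rule eq_vecI)
      fix i assume "i < dim_vec (S *\<^sub>v low x + x $ m \<cdot>\<^sub>v w)"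
      hence i: "i < n" using wc by simp
      have "(S' *\<^sub>v x) $ i = (\<Sum>j<Suc m. (if j < m then S $$ (i,j) else w $ i) * x $ j)"
        using i x S by (simp add: S'_def scalar_prod_def atLeast0LessThan)
      also have "\<dots> = (\<Sum>j<m. S $$ (i,j) * x $ j) + w $ i * x $ m" by simp
      also have "\<dots> = (S *\<^sub>v low x + x $ m \<cdot>\<^sub>v w) $ i"
        using i x S wc by (simp add: low_def scalar_prod_def atLeast0LessThan mult.commute)
      finally show "(S' *\<^sub>v x) $ i = (S *\<^sub>v low x + x $ m \<cdot>\<^sub>v w) $ i" .
    qed (use S wc in \<open>auto simp: S'_def\<close>)
    have "injective_mat S'"
      unfolding injective_mat_def
    proof (intro ballI impI)
      fix x :: "'a vec" assume "x \<in> carrier_vec (dim_col S')" and eq0: "S' *\<^sub>v x = 0\<^sub>v (dim_row S')"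
      hence x: "x \<in> carrier_vec (Suc m)" by (simp add: S'_def)
      have eq: "S *\<^sub>v low x + x $ m \<cdot>\<^sub>v w = 0\<^sub>v n" using eq0 split[OF x] by (simp add: S'_def)
      have xm: "x $ m = 0"
      proof (rule ccontr)
        assume ne: "x $ m \<noteq> 0"
        have "w = S *\<^sub>v ((- inverse (x $ m)) \<cdot>\<^sub>v low x)"
        proof (rule eq_vecI)
          fix i assume "i < dim_vec (S *\<^sub>v ((- inverse (x $ m)) \<cdot>\<^sub>v low x))"
          hence i: "i < n" using S by simp
          have "(S *\<^sub>v low x) $ i + x $ m * w $ i = 0"
            using arg_cong[OF eq, of "\<lambda>v. v $ i"] i wc S by simp
          hence "w $ i = - inverse (x $ m) * (S *\<^sub>v low x) $ i"
            using ne by (simp add: field_simps eq_neg_iff_add_eq_0)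
          also have "\<dots> = (S *\<^sub>v ((- inverse (x $ m)) \<cdot>\<^sub>v low x)) $ i"
            using i S by (subst mult_mat_vec[OF S(1) low]) simp
          finally show "w $ i = (S *\<^sub>v ((- inverse (x $ m)) \<cdot>\<^sub>v low x)) $ i" .
        qed (use S wc in auto)
        moreover have "(- inverse (x $ m)) \<cdot>\<^sub>v low x \<in> carrier_vec m" using low by simp
        ultimately show False using notin by blast
      qed
      have "S *\<^sub>v low x = 0\<^sub>v n"
        using eq xm S wc low by (intro eq_vecI) (auto simp: vec_eq_iff)
      hence "low x = 0\<^sub>v m" using injective_matD[OF S(2,1) low] by simp
      hence "x $ i = 0" if "i < m" for i
        using that index_vec[of i m "\<lambda>i. x $ i"] by (simp add: low_def)
      thus "x = 0\<^sub>v (dim_col S')" using xm x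
        by (intro eq_vecI) (auto simp: S'_def less_Suc_eq)
    qed
    moreover have "S' *\<^sub>v x \<in> W" if "x \<in> carrier_vec (Suc m)" for x
      unfolding split[OF that] by (intro add smult SW low w)
    ultimately have "P (Suc m)" using S' by (auto simp: P_def)
    from max[OF this] show False by simp
  qed
  hence "W = (*\<^sub>v) S ` carrier_vec m" using SW by blast
  thus ?thesis using that[OF S(1) bound[OF Pm] S(2)] by blast
qed

lemma factor_through_range:
  fixes T B :: "'a::field mat"
  assumes T: "T \<in> carrier_mat n m" and B: "B \<in> carrier_mat n k"
    and ran: "\<And>x. x \<in> carrier_vec k \<Longrightarrow> B *\<^sub>v x \<in> (*\<^sub>v) T ` carrier_vec m"
  obtains C where "C \<in> carrier_mat m k" "B = T * C"
proof -
  have "\<forall>j<k. \<exists>y\<in>carrier_vec m. col B j = T *\<^sub>v y"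
  proof (intro allI impI)
    fix j assume "j < k"
    thus "\<exists>y\<in>carrier_vec m. col B j = T *\<^sub>v y"
      using ran[of "unit_vec k j"] mult_mat_unit_vec[OF B] by auto
  qed
  then obtain y where y: "\<And>j. j < k \<Longrightarrow> y j \<in> carrier_vec m" "\<And>j. j < k \<Longrightarrow> col B j = T *\<^sub>v y j"
    by metis
  define C where "C = mat m k (\<lambda>(i,j). y j $ i)"
  have C: "C \<in> carrier_mat m k" by (simp add: C_def)
  have colC: "col C j = y j" if "j < k" for j
    using that y(1)[OF that] by (intro eq_vecI) (auto simp: C_def)
  have "B = T * C"
    using B T C y colC by (intro mat_col_eqI) auto
  thus ?thesis using that C by blast
qed

section \<open>Matrix representations\<close>

lemma mat_trace_comm:
  fixes A B :: "'a::comm_semiring_0 mat"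
  assumes "A \<in> carrier_mat n m" "B \<in> carrier_mat m n"
  shows "mat_trace (A * B) = mat_trace (B * A)"
proof -
  have "mat_trace (A * B) = (\<Sum>i<n. \<Sum>j<m. A $$ (i,j) * B $$ (j,i))"
    using assms by (simp add: mat_trace_def scalar_prod_def atLeast0LessThan)
  also have "\<dots> = (\<Sum>j<m. \<Sum>i<n. B $$ (j,i) * A $$ (i,j))"
    by (subst sum.swap) (simp add: mult.commute)
  also have "\<dots> = mat_trace (B * A)"
    using assms by (simp add: mat_trace_def scalar_prod_def atLeast0LessThan)
  finally show ?thesis .
qed

lemma mat_trace_scalar: "mat_trace (c \<cdot>\<^sub>m 1\<^sub>m n) = of_nat n * (c::'a::comm_semiring_1)"
  by (simp add: mat_trace_def)

text \<open>Matrices of all sizes share one type, which therefore has no zero and no generic sum; the size has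
  to be supplied, and the sum is taken entrywise.\<close>

definition mat_sum :: "'i set \<Rightarrow> nat \<Rightarrow> nat \<Rightarrow> ('i \<Rightarrow> 'a::comm_monoid_add mat) \<Rightarrow> 'a mat" where
  "mat_sum S n m F = mat n m (\<lambda>p. \<Sum>g\<in>S. F g $$ p)"

lemma mat_sum_carrier [simp]: "mat_sum S n m F \<in> carrier_mat n m"
  by (simp add: mat_sum_def)

lemma mat_sum_index [simp]:
  "i < n \<Longrightarrow> j < m \<Longrightarrow> mat_sum S n m F $$ (i,j) = (\<Sum>g\<in>S. F g $$ (i,j))"
  "dim_row (mat_sum S n m F) = n" "dim_col (mat_sum S n m F) = m"
  by (simp_all add: mat_sum_def)

lemma mat_sum_cong:
  "S = S' \<Longrightarrow> (\<And>g. g \<in> S' \<Longrightarrow> F g = F' g) \<Longrightarrow> mat_sum S n m F = mat_sum S' n m F'"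
  by (simp add: mat_sum_def)

lemma mat_sum_reindex:
  assumes "bij_betw h S S'"
  shows "mat_sum S n m (\<lambda>g. F (h g)) = mat_sum S' n m F"
  by (rule eq_matI) (simp_all add: sum.reindex_bij_betw[OF assms, of "\<lambda>g. F g $$ (_,_)"])

lemma mult_mat_sum:
  fixes A :: "'a::comm_semiring_0 mat"
  assumes A: "A \<in> carrier_mat k n" and F: "\<And>g. g \<in> S \<Longrightarrow> F g \<in> carrier_mat n m"
  shows "A * mat_sum S n m F = mat_sum S k m (\<lambda>g. A * F g)"
proof (rule eq_matI)
  fix i j assume "i < dim_row (mat_sum S k m (\<lambda>g. A * F g))" "j < dim_col (mat_sum S k m (\<lambda>g. A * F g))"
  hence ij: "i < k" "j < m" by auto
  have "(A * mat_sum S n m F) $$ (i,j) = (\<Sum>l<n. \<Sum>g\<in>S. A $$ (i,l) * F g $$ (l,j))"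
    using A ij by (simp add: scalar_prod_def atLeast0LessThan sum_distrib_left)
  also have "\<dots> = (\<Sum>g\<in>S. \<Sum>l<n. A $$ (i,l) * F g $$ (l,j))" by (rule sum.swap)
  also have "\<dots> = (\<Sum>g\<in>S. (A * F g) $$ (i,j))"
    using A ij by (intro sum.cong refl) (use F in \<open>force simp: scalar_prod_def atLeast0LessThan\<close>)
  finally show "(A * mat_sum S n m F) $$ (i,j) = mat_sum S k m (\<lambda>g. A * F g) $$ (i,j)"
    using ij by simp
qed (use A in auto)

lemma mat_sum_mult:
  fixes A :: "'a::comm_semiring_0 mat"
  assumes A: "A \<in> carrier_mat m k" and F: "\<And>g. g \<in> S \<Longrightarrow> F g \<in> carrier_mat n m"
  shows "mat_sum S n m F * A = mat_sum S n k (\<lambda>g. F g * A)"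
proof (rule eq_matI)
  fix i j assume "i < dim_row (mat_sum S n k (\<lambda>g. F g * A))" "j < dim_col (mat_sum S n k (\<lambda>g. F g * A))"
  hence ij: "i < n" "j < k" by auto
  have "(mat_sum S n m F * A) $$ (i,j) = (\<Sum>l<m. \<Sum>g\<in>S. F g $$ (i,l) * A $$ (l,j))"
    using A ij by (simp add: scalar_prod_def atLeast0LessThan sum_distrib_right)
  also have "\<dots> = (\<Sum>g\<in>S. \<Sum>l<m. F g $$ (i,l) * A $$ (l,j))" by (rule sum.swap)
  also have "\<dots> = (\<Sum>g\<in>S. (F g * A) $$ (i,j))"
    using A ij by (intro sum.cong refl) (use F in \<open>force simp: scalar_prod_def atLeast0LessThan\<close>)
  finally show "(mat_sum S n m F * A) $$ (i,j) = mat_sum S n k (\<lambda>g. F g * A) $$ (i,j)"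
    using ij by simp
qed (use A in auto)

lemma mat_trace_mat_sum:
  assumes "\<And>g. g \<in> S \<Longrightarrow> F g \<in> carrier_mat n n"
  shows "mat_trace (mat_sum S n n F) = (\<Sum>g\<in>S. mat_trace (F g))"
proof -
  have "mat_trace (mat_sum S n n F) = (\<Sum>g\<in>S. \<Sum>i<n. F g $$ (i,i))"
    by (simp add: mat_trace_def) (rule sum.swap)
  also have "\<dots> = (\<Sum>g\<in>S. mat_trace (F g))"
    using assms by (intro sum.cong refl) (auto simp: mat_trace_def)
  finally show ?thesis .
qed

lemma vec_subspace_iff:
  fixes W :: "complex vec set"
  shows "VectorSpace.subspace class_ring W (module_vec TYPE(complex) n) \<longleftrightarrow>
    W \<subseteq> carrier_vec n \<and> 0\<^sub>v n \<in> W \<and> (\<forall>v\<in>W. \<forall>w\<in>W. v + w \<in> W) \<and> (\<forall>c. \<forall>v\<in>W. c \<cdot>\<^sub>v v \<in> W)"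
  using vec_vs[where 'a = complex] vec_module[where 'a = complex]
  by (auto simp: VectorSpace.subspace_def submodule_def module_vec_simps class_ring_simps)

lemma complex_rep_dest:
  assumes G: "group G" and rep: "complex_rep G n \<rho>"
  shows "g \<in> carrier G \<Longrightarrow> \<rho> g \<in> carrier_mat n n"
    and "\<lbrakk>g \<in> carrier G; h \<in> carrier G\<rbrakk> \<Longrightarrow> \<rho> (g \<otimes>\<^bsub>G\<^esub> h) = \<rho> g * \<rho> h"
    and "\<rho> \<one>\<^bsub>G\<^esub> = 1\<^sub>m n"
proof -
  interpret M: ring "ring_mat TYPE(complex) n ()" by (rule ring_mat)
  have GL: "group (GL n)" unfolding GL_def by (rule M.units_group)
  show "g \<in> carrier G \<Longrightarrow> \<rho> g \<in> carrier_mat n n"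
    using rep by (auto simp: complex_rep_def hom_def GL_def units_of_def Units_def ring_mat_simps Pi_def)
  show "\<lbrakk>g \<in> carrier G; h \<in> carrier G\<rbrakk> \<Longrightarrow> \<rho> (g \<otimes>\<^bsub>G\<^esub> h) = \<rho> g * \<rho> h"
    using rep by (auto simp: complex_rep_def hom_def GL_def units_of_def ring_mat_simps)
  have "\<rho> \<one>\<^bsub>G\<^esub> = \<one>\<^bsub>GL n\<^esub>"
    using hom_one[OF _ G GL] rep by (simp add: complex_rep_def)
  thus "\<rho> \<one>\<^bsub>G\<^esub> = 1\<^sub>m n" by (simp add: GL_def units_of_def ring_mat_simps)
qed

lemma complex_repI:
  assumes G: "group G" and c: "\<And>g. g \<in> carrier G \<Longrightarrow> \<rho> g \<in> carrier_mat n n"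
    and m: "\<And>g h. \<lbrakk>g \<in> carrier G; h \<in> carrier G\<rbrakk> \<Longrightarrow> \<rho> (g \<otimes>\<^bsub>G\<^esub> h) = \<rho> g * \<rho> h"
    and o: "\<rho> \<one>\<^bsub>G\<^esub> = 1\<^sub>m n"
  shows "complex_rep G n \<rho>"
proof -
  interpret group G by fact
  have "\<rho> g \<in> Units (ring_mat TYPE(complex) n ())" if g: "g \<in> carrier G" for g
    using m[of g "inv\<^bsub>G\<^esub> g"] m[of "inv\<^bsub>G\<^esub> g" g] o c g
    by (auto simp: Units_def ring_mat_simps intro!: bexI[of _ "\<rho> (inv\<^bsub>G\<^esub> g)"])
  thus ?thesis
    using m by (auto simp: complex_rep_def hom_def GL_def units_of_def ring_mat_simps)
qed

text \<open>Schur's lemma: an eigenspace of \<open>A\<close> is an invariant subspace.\<close>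

lemma schur_scalar:
  assumes G: "group G" and irr: "irreducible_rep G n \<rho>" and A: "A \<in> carrier_mat n n"
    and comm: "\<And>g. g \<in> carrier G \<Longrightarrow> A * \<rho> g = \<rho> g * A"
  obtains c where "A = c \<cdot>\<^sub>m 1\<^sub>m n"
proof -
  have rep: "complex_rep G n \<rho>" and n: "n > 0" using irr by (auto simp: irreducible_rep_def)
  note r = complex_rep_dest[OF G rep]
  obtain as where as: "char_poly A = (\<Prod>a\<leftarrow>as. [:- a, 1:])" "length as = n"
    using char_poly_factorized[OF A] by blast
  define c where "c = hd as"
  have "c \<in> set as" using as n by (auto simp: c_def)
  hence "poly (char_poly A) c = 0" by (auto simp: as(1) poly_prod_list prod_list_zero_iff)
  hence "eigenvalue A c" using eigenvalue_root_char_poly[OF A] by simp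
  then obtain v where v: "v \<in> carrier_vec n" "v \<noteq> 0\<^sub>v n" "A *\<^sub>v v = c \<cdot>\<^sub>v v"
    using A by (auto simp: eigenvalue_def eigenvector_def)
  define W where "W = {w \<in> carrier_vec n. A *\<^sub>v w = c \<cdot>\<^sub>v w}"
  have "VectorSpace.subspace class_ring W (module_vec TYPE(complex) n)"
    unfolding vec_subspace_iff W_def using A
    by (auto simp: mult_add_distrib_mat_vec[OF A] mult_mat_vec[OF A] smult_add_distrib_vec[of _ n]
        smult_smult_assoc mult.commute)
  moreover have "\<rho> g *\<^sub>v w \<in> W" if g: "g \<in> carrier G" and w: "w \<in> W" for g w
  proof -
    have w': "w \<in> carrier_vec n" "A *\<^sub>v w = c \<cdot>\<^sub>v w" using w by (auto simp: W_def)
    have "A *\<^sub>v (\<rho> g *\<^sub>v w) = \<rho> g *\<^sub>v (A *\<^sub>v w)"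
      using comm[OF g] assoc_mult_mat_vec[OF A r(1)[OF g] w'(1)]
        assoc_mult_mat_vec[OF r(1)[OF g] A w'(1)] by simp
    also have "\<dots> = c \<cdot>\<^sub>v (\<rho> g *\<^sub>v w)" unfolding w'(2) by (rule mult_mat_vec[OF r(1)[OF g] w'(1)])
    finally show ?thesis using r(1)[OF g] w'(1) by (simp add: W_def)
  qed
  ultimately have "W = {0\<^sub>v n} \<or> W = carrier_vec n"
    using irr by (auto simp: irreducible_rep_def)
  moreover have "v \<in> W" using v by (simp add: W_def)
  ultimately have W: "W = carrier_vec n" using v(2) by auto
  have "A = c \<cdot>\<^sub>m 1\<^sub>m n"
  proof (rule mat_col_eqI)
    fix j assume "j < dim_col (c \<cdot>\<^sub>m 1\<^sub>m n)"
    hence j: "j < n" by simp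
    have "unit_vec n j \<in> W" unfolding W by simp
    hence "col A j = c \<cdot>\<^sub>v unit_vec n j" using mult_mat_unit_vec[OF A j] by (simp add: W_def)
    also have "\<dots> = col (c \<cdot>\<^sub>m 1\<^sub>m n) j" using j by (intro eq_vecI) auto
    finally show "col A j = col (c \<cdot>\<^sub>m 1\<^sub>m n) j" .
  qed (use A in auto)
  thus ?thesis by (rule that)
qed

text \<open>The columns of \<open>T\<close> are a basis of a nonzero invariant subspace of \<open>V\<close> of least dimension;
  \<open>\<sigma>\<close> is the restriction of \<open>\<rho>\<close> to it in this basis.\<close>

lemma irreducible_subrep:
  assumes G: "group G" and rep: "complex_rep G N \<rho>"
    and sub: "V \<subseteq> carrier_vec N" and zero: "0\<^sub>v N \<in> V"
    and add: "\<And>v w. \<lbrakk>v \<in> V; w \<in> V\<rbrakk> \<Longrightarrow> v + w \<in> V"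
    and smult: "\<And>c v. v \<in> V \<Longrightarrow> c \<cdot>\<^sub>v v \<in> V"
    and inv: "\<And>g v. \<lbrakk>g \<in> carrier G; v \<in> V\<rbrakk> \<Longrightarrow> \<rho> g *\<^sub>v v \<in> V"
    and w0: "w0 \<in> V" "w0 \<noteq> 0\<^sub>v N"
  obtains n \<sigma> T where "irreducible_rep G n \<sigma>" "T \<in> carrier_mat N n" "injective_mat T"
    "\<And>g. g \<in> carrier G \<Longrightarrow> \<rho> g * T = T * \<sigma> g"
    "\<And>x. x \<in> carrier_vec n \<Longrightarrow> T *\<^sub>v x \<in> V"
proof -
  note r = complex_rep_dest[OF G rep]
  interpret group G by fact
  define Q where "Q n T \<longleftrightarrow> n > 0 \<and> T \<in> carrier_mat N n \<and> injective_mat T \<and>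
      (\<forall>x\<in>carrier_vec n. T *\<^sub>v x \<in> V) \<and>
      (\<forall>g\<in>carrier G. \<exists>C\<in>carrier_mat n n. \<rho> g * T = T * C)" for n T
  have "\<exists>n T. Q n T"
  proof -
    obtain m S where S: "S \<in> carrier_mat N m" "injective_mat S" "V = (*\<^sub>v) S ` carrier_vec m"
      using subspace_is_range[OF sub zero add smult] by metis
    have "m > 0"
    proof (rule ccontr)
      assume "\<not> m > 0"
      hence "S *\<^sub>v x = 0\<^sub>v N" if "x \<in> carrier_vec m" for x
        using that S(1) by (intro eq_vecI) (auto simp: scalar_prod_def)
      thus False using w0 S(3) by auto
    qed
    moreover have "\<exists>C\<in>carrier_mat m m. \<rho> g * S = S * C" if g: "g \<in> carrier G" for g
    proof -
      have "(\<rho> g * S) *\<^sub>v x \<in> (*\<^sub>v) S ` carrier_vec m" if x: "x \<in> carrier_vec m" for x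
        using inv[OF g, of "S *\<^sub>v x"] S(3) x assoc_mult_mat_vec[OF r(1)[OF g] S(1) x] by auto
      thus ?thesis using factor_through_range[OF S(1), of "\<rho> g * S" m] r(1)[OF g] S(1) by (metis mult_carrier_mat)
    qed
    moreover have "\<forall>x\<in>carrier_vec m. S *\<^sub>v x \<in> V" using S(3) by blast
    ultimately have "Q m S" using S(1,2) by (auto simp: Q_def)
    thus ?thesis by blast
  qed
  define n where "n = (LEAST n. \<exists>T. Q n T)"
  have "\<exists>T. Q n T" unfolding n_def using \<open>\<exists>n T. Q n T\<close> by (rule LeastI_ex)
  then obtain T where QT: "Q n T" by blast
  have least: "n \<le> k" if "Q k T'" for k T'
    unfolding n_def using that by (intro Least_le) blast
  have n: "n > 0" and T: "T \<in> carrier_mat N n" "injective_mat T"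
    and TV: "\<And>x. x \<in> carrier_vec n \<Longrightarrow> T *\<^sub>v x \<in> V"
    using QT by (auto simp: Q_def)
  have "\<forall>g. \<exists>C. g \<in> carrier G \<longrightarrow> C \<in> carrier_mat n n \<and> \<rho> g * T = T * C"
    using QT by (auto simp: Q_def)
  then obtain \<sigma> where \<sigma>: "\<And>g. g \<in> carrier G \<Longrightarrow> \<sigma> g \<in> carrier_mat n n"
      "\<And>g. g \<in> carrier G \<Longrightarrow> \<rho> g * T = T * \<sigma> g"
    by metis
  have "complex_rep G n \<sigma>"
  proof (rule complex_repI[OF G \<sigma>(1)])
    fix g h assume gh: "g \<in> carrier G" "h \<in> carrier G"
    have "T * \<sigma> (g \<otimes>\<^bsub>G\<^esub> h) = \<rho> g * \<rho> h * T" using gh \<sigma>(2)[of "g \<otimes>\<^bsub>G\<^esub> h"] r(2) by simp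
    also have "\<dots> = \<rho> g * (T * \<sigma> h)"
      using assoc_mult_mat[OF r(1)[OF gh(1)] r(1)[OF gh(2)] T(1)] \<sigma>(2)[OF gh(2)] by simp
    also have "\<dots> = \<rho> g * T * \<sigma> h"
      using assoc_mult_mat[OF r(1)[OF gh(1)] T(1) \<sigma>(1)[OF gh(2)]] by simp
    also have "\<dots> = T * (\<sigma> g * \<sigma> h)"
      using assoc_mult_mat[OF T(1) \<sigma>(1)[OF gh(1)] \<sigma>(1)[OF gh(2)]] \<sigma>(2)[OF gh(1)] by simp
    finally show "\<sigma> (g \<otimes>\<^bsub>G\<^esub> h) = \<sigma> g * \<sigma> h"
      using injective_mat_cancel_left[OF T(2,1)] \<sigma>(1) gh by (metis m_closed mult_carrier_mat)
  next
    have "T * \<sigma> \<one>\<^bsub>G\<^esub> = T * 1\<^sub>m n" using \<sigma>(2)[of "\<one>\<^bsub>G\<^esub>"] r(3) T(1) by simp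
    thus "\<sigma> \<one>\<^bsub>G\<^esub> = 1\<^sub>m n"
      using injective_mat_cancel_left[OF T(2,1) \<sigma>(1)] one_closed one_carrier_mat by blast
  qed
  moreover have "W = {0\<^sub>v n} \<or> W = carrier_vec n"
    if W: "VectorSpace.subspace class_ring W (module_vec TYPE(complex) n)"
      and Winv: "\<forall>g\<in>carrier G. \<forall>w\<in>W. \<sigma> g *\<^sub>v w \<in> W" for W
  proof (cases "W = {0\<^sub>v n}")
    case False
    note W' = W[unfolded vec_subspace_iff]
    obtain m S where S: "S \<in> carrier_mat n m" "m \<le> n" "injective_mat S" "W = (*\<^sub>v) S ` carrier_vec m"
      using subspace_is_range[of W n] W' by metis
    have "m > 0"
    proof (rule ccontr)
      assume "\<not> m > 0"
      hence "S *\<^sub>v x = 0\<^sub>v n" if "x \<in> carrier_vec m" for x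
        using that S(1) by (intro eq_vecI) (auto simp: scalar_prod_def)
      thus False using False W' S(4) by auto
    qed
    moreover have "\<exists>C\<in>carrier_mat m m. \<rho> g * (T * S) = (T * S) * C" if g: "g \<in> carrier G" for g
    proof -
      have "(\<sigma> g * S) *\<^sub>v x \<in> (*\<^sub>v) S ` carrier_vec m" if x: "x \<in> carrier_vec m" for x
        using Winv g S(4) x assoc_mult_mat_vec[OF \<sigma>(1)[OF g] S(1) x] by auto
      then obtain C where C: "C \<in> carrier_mat m m" "\<sigma> g * S = S * C"
        using factor_through_range[OF S(1), of "\<sigma> g * S" m] \<sigma>(1)[OF g] S(1) by (metis mult_carrier_mat)
      have "\<rho> g * (T * S) = T * \<sigma> g * S"
        using assoc_mult_mat[OF r(1)[OF g] T(1) S(1)] \<sigma>(2)[OF g] by simp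
      also have "\<dots> = T * S * C"
        using assoc_mult_mat[OF T(1) \<sigma>(1)[OF g] S(1)] assoc_mult_mat[OF T(1) S(1) C(1)] C(2) by simp
      finally show ?thesis using C(1) by blast
    qed
    moreover have "T * S *\<^sub>v x \<in> V" if "x \<in> carrier_vec m" for x
      using assoc_mult_mat_vec[OF T(1) S(1) that] TV S(1) that by simp
    ultimately have "Q m (T * S)"
      using injective_mat_mult[OF T(2,1) S(3,1)] T(1) S(1) by (auto simp: Q_def)
    hence "m = n" using least S(2) by fastforce
    hence "carrier_vec n \<subseteq> W"
      using injective_square_mat_surj[of S n] S by blast
    thus ?thesis using W' by blast
  qed simp
  ultimately have "irreducible_rep G n \<sigma>" using n by (simp add: irreducible_rep_def)
  thus ?thesis using that T \<sigma>(2) TV by blast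
qed

section \<open>Class functions and spherical functions\<close>

locale finite_grp = group +
  assumes fin [simp]: "finite (carrier G)"
begin

definition conj_by :: "'a \<Rightarrow> 'a \<Rightarrow> 'a" where
  "conj_by k g = k \<otimes> g \<otimes> inv k"

definition conj_class :: "'a \<Rightarrow> 'a set" where
  "conj_class g = (\<lambda>k. conj_by k g) ` carrier G"

definition class_function :: "('a \<Rightarrow> 'x) \<Rightarrow> bool" where
  "class_function f \<longleftrightarrow> (\<forall>g\<in>carrier G. \<forall>k\<in>carrier G. f (conj_by k g) = f g)"

definition conv :: "('a \<Rightarrow> 'x::comm_ring_1) \<Rightarrow> ('a \<Rightarrow> 'x) \<Rightarrow> 'a \<Rightarrow> 'x" where
  "conv f h x = (\<Sum>y\<in>carrier G. f y * h (inv y \<otimes> x))"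

definition pairing :: "('a \<Rightarrow> complex) \<Rightarrow> ('a \<Rightarrow> complex) \<Rightarrow> complex" where
  "pairing f \<theta> = (\<Sum>g\<in>carrier G. f g * \<theta> g)"

definition class_sum :: "'a \<Rightarrow> 'a \<Rightarrow> 'x::comm_ring_1" where
  "class_sum g x = of_bool (x \<in> conj_class g)"

text \<open>These are the functions \<open>\<chi>(g) / \<chi>(1)\<close> for irreducible \<open>\<chi>\<close>. The functional equation says that
  pairing with \<open>\<theta>\<close> is multiplicative on class functions, that is, \<open>\<theta>\<close> is an algebra homomorphism
  from the centre of the group algebra to the complex numbers.\<close>

definition spherical :: "('a \<Rightarrow> complex) \<Rightarrow> bool" where
  "spherical \<theta> \<longleftrightarrow> \<theta> \<one> = 1 \<and>
     (\<forall>g\<in>carrier G. \<forall>h\<in>carrier G.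
        of_nat (Coset.order G) * (\<theta> g * \<theta> h) = (\<Sum>k\<in>carrier G. \<theta> (g \<otimes> conj_by k h)))"

lemma order_pos: "Coset.order G > 0"
  using order_gt_0_iff_finite fin by blast

lemma order_neq_0 [simp]: "Coset.order G \<noteq> 0"
  using order_pos by simp

lemma conj_by_closed [simp, intro]: "\<lbrakk>k \<in> carrier G; g \<in> carrier G\<rbrakk> \<Longrightarrow> conj_by k g \<in> carrier G"
  by (simp add: conj_by_def)

lemma conj_by_one [simp]: "g \<in> carrier G \<Longrightarrow> conj_by \<one> g = g"
  by (simp add: conj_by_def)

lemma conj_by_of_one [simp]: "k \<in> carrier G \<Longrightarrow> conj_by k \<one> = \<one>"
  by (simp add: conj_by_def)

lemma inv_mult_cancel [simp]:
  "\<lbrakk>x \<in> carrier G; y \<in> carrier G\<rbrakk> \<Longrightarrow> inv x \<otimes> (x \<otimes> y) = y"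
  "\<lbrakk>x \<in> carrier G; y \<in> carrier G\<rbrakk> \<Longrightarrow> x \<otimes> (inv x \<otimes> y) = y"
  by (simp_all add: m_assoc[symmetric])

lemma conj_by_conj_by:
  "\<lbrakk>k \<in> carrier G; l \<in> carrier G; g \<in> carrier G\<rbrakk> \<Longrightarrow> conj_by k (conj_by l g) = conj_by (k \<otimes> l) g"
  by (simp add: conj_by_def m_assoc inv_mult_group)

lemma conj_by_inv:
  "\<lbrakk>k \<in> carrier G; g \<in> carrier G\<rbrakk> \<Longrightarrow> inv (conj_by k g) = conj_by k (inv g)"
  by (simp add: conj_by_def m_assoc inv_mult_group)

lemma conj_by_mult:
  "\<lbrakk>k \<in> carrier G; g \<in> carrier G; h \<in> carrier G\<rbrakk> \<Longrightarrow> conj_by k (g \<otimes> h) = conj_by k g \<otimes> conj_by k h"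
  by (simp add: conj_by_def m_assoc)

lemma conj_by_inv_cancel [simp]:
  "\<lbrakk>k \<in> carrier G; g \<in> carrier G\<rbrakk> \<Longrightarrow> conj_by (inv k) (conj_by k g) = g"
  "\<lbrakk>k \<in> carrier G; g \<in> carrier G\<rbrakk> \<Longrightarrow> conj_by k (conj_by (inv k) g) = g"
  by (simp_all add: conj_by_conj_by)

lemma sum_mult_left: "a \<in> carrier G \<Longrightarrow> (\<Sum>g\<in>carrier G. F (a \<otimes> g)) = (\<Sum>g\<in>carrier G. F g)"
  by (rule sum.reindex_bij_betw, rule bij_betw_byWitness[where f' = "\<lambda>g. inv a \<otimes> g"]) auto

lemma sum_mult_right: "a \<in> carrier G \<Longrightarrow> (\<Sum>g\<in>carrier G. F (g \<otimes> a)) = (\<Sum>g\<in>carrier G. F g)"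
  by (rule sum.reindex_bij_betw, rule bij_betw_byWitness[where f' = "\<lambda>g. g \<otimes> inv a"]) (auto simp: m_assoc)

lemma sum_inv: "(\<Sum>g\<in>carrier G. F (inv g)) = (\<Sum>g\<in>carrier G. F g)"
  by (rule sum.reindex_bij_betw, rule bij_betw_byWitness[where f' = "\<lambda>g. inv g"]) auto

lemma bij_conj_by: "a \<in> carrier G \<Longrightarrow> bij_betw (conj_by a) (carrier G) (carrier G)"
  by (rule bij_betw_byWitness[where f' = "conj_by (inv a)"]) auto

lemma sum_conj_by: "a \<in> carrier G \<Longrightarrow> (\<Sum>g\<in>carrier G. F (conj_by a g)) = (\<Sum>g\<in>carrier G. F g)"
  by (rule sum.reindex_bij_betw[OF bij_conj_by])

lemma class_functionD:
  "\<lbrakk>class_function f; g \<in> carrier G; k \<in> carrier G\<rbrakk> \<Longrightarrow> f (conj_by k g) = f g"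
  by (simp add: class_function_def)

lemma class_function_mult_commute:
  assumes "class_function f" "x \<in> carrier G" "y \<in> carrier G"
  shows "f (x \<otimes> y) = f (y \<otimes> x)"
  using class_functionD[OF assms(1), of "x \<otimes> y" y] assms by (simp add: conj_by_def m_assoc)

lemma class_function_compose: "class_function f \<Longrightarrow> class_function (\<lambda>x. F (f x))"
  by (simp add: class_function_def)

lemma class_function_inv: "class_function f \<Longrightarrow> class_function (\<lambda>x. f (inv x))"
  by (simp add: class_function_def conj_by_inv)

lemma conj_class_self: "g \<in> carrier G \<Longrightarrow> g \<in> conj_class g"
  by (auto simp: conj_class_def intro!: image_eqI[of _ _ \<one>])

lemma conj_class_subset: "g \<in> carrier G \<Longrightarrow> conj_class g \<subseteq> carrier G"
  by (auto simp: conj_class_def)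

lemma finite_conj_class [simp]: "finite (conj_class g)"
  by (simp add: conj_class_def)

lemma card_conj_class_pos: "g \<in> carrier G \<Longrightarrow> card (conj_class g) > 0"
  using conj_class_self by (auto simp: card_gt_0_iff)

lemma conj_class_eq:
  assumes "g \<in> carrier G" "x \<in> conj_class g" shows "conj_class x = conj_class g"
proof -
  obtain k where k: "k \<in> carrier G" "x = conj_by k g" using assms by (auto simp: conj_class_def)
  have "conj_class x = (\<lambda>l. conj_by l g) ` (\<lambda>l. l \<otimes> k) ` carrier G"
    using k assms(1) by (simp add: conj_class_def image_image conj_by_conj_by cong: image_cong)
  also have "(\<lambda>l. l \<otimes> k) ` carrier G = carrier G"
    using bij_betw_byWitness[of "carrier G" "\<lambda>g. g \<otimes> inv k" "\<lambda>l. l \<otimes> k" "carrier G"] k(1)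
    by (auto simp: m_assoc bij_betw_def)
  finally show ?thesis by (simp add: conj_class_def)
qed

lemma conj_class_eq_iff:
  "\<lbrakk>g \<in> carrier G; h \<in> carrier G\<rbrakk> \<Longrightarrow> conj_class g = conj_class h \<longleftrightarrow> g \<in> conj_class h"
  using conj_class_eq conj_class_self by blast

lemma conj_class_conj_by [simp]:
  "\<lbrakk>g \<in> carrier G; k \<in> carrier G\<rbrakk> \<Longrightarrow> conj_class (conj_by k g) = conj_class g"
  by (rule conj_class_eq) (auto simp: conj_class_def)

lemma mem_conj_class_conj_by [simp]:
  assumes "x \<in> carrier G" "g \<in> carrier G" "k \<in> carrier G"
  shows "conj_by k x \<in> conj_class g \<longleftrightarrow> x \<in> conj_class g"
  using assms conj_class_eq_iff conj_class_conj_by conj_by_closed by metis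

lemma conj_class_one [simp]: "conj_class \<one> = {\<one>}"
  by (auto simp: conj_class_def)

lemma class_function_on_class:
  "\<lbrakk>class_function f; g \<in> carrier G; x \<in> conj_class g\<rbrakk> \<Longrightarrow> f x = f g"
  by (auto simp: conj_class_def class_functionD)

lemma class_function_class_sum: "g \<in> carrier G \<Longrightarrow> class_function (class_sum g)"
  by (simp add: class_function_def class_sum_def)

lemma class_sum_eq_iff:
  assumes "g \<in> carrier G" "h \<in> carrier G"
  shows "(class_sum g :: 'a \<Rightarrow> 'x::comm_ring_1) = class_sum h \<longleftrightarrow> conj_class g = conj_class h"
proof
  assume "(class_sum g :: 'a \<Rightarrow> 'x) = class_sum h"
  hence "(class_sum g g :: 'x) = class_sum h g" by simp
  thus "conj_class g = conj_class h"
    using assms conj_class_self[of g] by (auto simp: class_sum_def conj_class_eq_iff of_bool_def split: if_splits)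
qed (simp add: class_sum_def fun_eq_iff)

text \<open>Orbit--stabiliser: all fibres of \<open>k \<mapsto> conj_by k h\<close> over the class of \<open>h\<close> have the same size.\<close>

lemma sum_over_class:
  fixes F :: "'a \<Rightarrow> complex"
  assumes h: "h \<in> carrier G"
  shows "of_nat (Coset.order G) * (\<Sum>b\<in>conj_class h. F b) =
    of_nat (card (conj_class h)) * (\<Sum>k\<in>carrier G. F (conj_by k h))"
proof -
  define c where "c = card {k \<in> carrier G. conj_by k h = h}"
  have fibre: "card {k \<in> carrier G. conj_by k h = b} = c" if "b \<in> conj_class h" for b
  proof -
    obtain l where l: "l \<in> carrier G" "b = conj_by l h" using \<open>b \<in> conj_class h\<close> by (auto simp: conj_class_def)
    have stab: "conj_by (inv l \<otimes> k) h = h \<longleftrightarrow> conj_by k h = b" if k: "k \<in> carrier G" for k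
      using l k h conj_by_inv_cancel conj_by_closed inv_closed by (metis conj_by_conj_by)
    have "bij_betw (\<lambda>k. inv l \<otimes> k) {k \<in> carrier G. conj_by k h = b} {k \<in> carrier G. conj_by k h = h}"
    proof (rule bij_betw_byWitness[where f' = "\<lambda>k. l \<otimes> k"])
      show "(\<lambda>k. l \<otimes> k) ` {k \<in> carrier G. conj_by k h = h} \<subseteq> {k \<in> carrier G. conj_by k h = b}"
        using l h by (auto simp: conj_by_conj_by[symmetric])
    qed (use l stab in auto)
    thus ?thesis unfolding c_def by (rule bij_betw_same_card)
  qed
  \<comment> \<open>counting the fibres; the constant function \<open>1\<close> then gives the size of the fibres\<close>
  have sum: "(\<Sum>k\<in>carrier G. F' (conj_by k h)) = of_nat c * (\<Sum>b\<in>conj_class h. F' b)"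
    for F' :: "'a \<Rightarrow> complex"
  proof -
    have "(\<Sum>k\<in>carrier G. F' (conj_by k h)) =
      (\<Sum>b\<in>conj_class h. \<Sum>k\<in>{k\<in>carrier G. conj_by k h = b}. F' (conj_by k h))"
      unfolding conj_class_def by (rule sum.image_gen) simp
    also have "\<dots> = (\<Sum>b\<in>conj_class h. of_nat c * F' b)"
      by (rule sum.cong[OF refl]) (simp add: fibre)
    finally show ?thesis by (simp add: sum_distrib_left)
  qed
  from sum[of "\<lambda>_. 1"] have "of_nat (Coset.order G) = (of_nat c * of_nat (card (conj_class h)) :: complex)"
    by (simp add: Coset.order_def)
  thus ?thesis using sum[of F] by simp
qed

lemma sum_class_sum:
  fixes F :: "'a \<Rightarrow> 'x::comm_ring_1"
  assumes "h \<in> carrier G"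
  shows "(\<Sum>g\<in>carrier G. class_sum h g * F g) = (\<Sum>b\<in>conj_class h. F b)"
  using conj_class_subset[OF assms]
  by (intro sum.mono_neutral_cong_right) (auto simp: class_sum_def)

lemma pairing_class_sum:
  assumes g: "g \<in> carrier G" and \<theta>: "class_function \<theta>"
  shows "pairing (class_sum g) \<theta> = of_nat (card (conj_class g)) * \<theta> g"
proof -
  have "pairing (class_sum g) \<theta> = (\<Sum>x\<in>conj_class g. \<theta> x)"
    unfolding pairing_def using g by (rule sum_class_sum)
  also have "\<dots> = (\<Sum>x\<in>conj_class g. \<theta> g)"
    using class_function_on_class[OF \<theta> g] by (intro sum.cong) auto
  finally show ?thesis by simp
qed

lemma pairing_conv:
  "pairing (conv f h) \<theta> = (\<Sum>y\<in>carrier G. \<Sum>g\<in>carrier G. f y * h g * \<theta> (y \<otimes> g))"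
proof -
  have "pairing (conv f h) \<theta> = (\<Sum>y\<in>carrier G. \<Sum>x\<in>carrier G. f y * h (inv y \<otimes> x) * \<theta> x)"
    unfolding pairing_def conv_def sum_distrib_right by (rule sum.swap)
  also have "\<dots> = (\<Sum>y\<in>carrier G. \<Sum>g\<in>carrier G. f y * h g * \<theta> (y \<otimes> g))"
  proof (rule sum.cong[OF refl])
    fix y assume y: "y \<in> carrier G"
    show "(\<Sum>x\<in>carrier G. f y * h (inv y \<otimes> x) * \<theta> x) = (\<Sum>g\<in>carrier G. f y * h g * \<theta> (y \<otimes> g))"
      using y by (subst sum_mult_left[OF y, symmetric]) simp
  qed
  finally show ?thesis .
qed

lemma spherical_one: "spherical \<theta> \<Longrightarrow> \<theta> \<one> = 1"
  by (simp add: spherical_def)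

lemma spherical_eq:
  "\<lbrakk>spherical \<theta>; g \<in> carrier G; h \<in> carrier G\<rbrakk> \<Longrightarrow>
    of_nat (Coset.order G) * (\<theta> g * \<theta> h) = (\<Sum>k\<in>carrier G. \<theta> (g \<otimes> conj_by k h))"
  by (simp add: spherical_def)

lemma spherical_class_function:
  assumes \<theta>: "spherical \<theta>" shows "class_function \<theta>"
  unfolding class_function_def
proof (intro ballI)
  fix g l assume gl: "g \<in> carrier G" "l \<in> carrier G"
  have "of_nat (Coset.order G) * \<theta> (conj_by l g) = (\<Sum>k\<in>carrier G. \<theta> (conj_by (k \<otimes> l) g))"
    using spherical_eq[OF \<theta>, of \<one> "conj_by l g"] spherical_one[OF \<theta>] gl by (simp add: conj_by_conj_by)
  also have "\<dots> = (\<Sum>k\<in>carrier G. \<theta> (conj_by k g))" using gl(2) by (rule sum_mult_right)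
  also have "\<dots> = of_nat (Coset.order G) * \<theta> g"
    using spherical_eq[OF \<theta>, of \<one> g] spherical_one[OF \<theta>] gl by simp
  finally show "\<theta> (conj_by l g) = \<theta> g" by simp
qed

text \<open>Averaging over conjugates of \<open>g\<close> turns the sum on the left into the functional equation.\<close>

lemma spherical_eigenfunction:
  assumes \<theta>: "spherical \<theta>" and f: "class_function f" and x: "x \<in> carrier G"
  shows "(\<Sum>g\<in>carrier G. f g * \<theta> (x \<otimes> g)) = \<theta> x * pairing f \<theta>"
proof -
  let ?S = "\<Sum>g\<in>carrier G. f g * \<theta> (x \<otimes> g)"
  have "of_nat (Coset.order G) * ?S = (\<Sum>k\<in>carrier G. ?S)" by (simp add: Coset.order_def)
  also have "\<dots> = (\<Sum>k\<in>carrier G. \<Sum>g\<in>carrier G. f g * \<theta> (x \<otimes> conj_by k g))"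
  proof (rule sum.cong[OF refl])
    fix k assume k: "k \<in> carrier G"
    have "?S = (\<Sum>g\<in>carrier G. f (conj_by k g) * \<theta> (x \<otimes> conj_by k g))"
      using k by (rule sum_conj_by[symmetric])
    thus "?S = (\<Sum>g\<in>carrier G. f g * \<theta> (x \<otimes> conj_by k g))"
      using k f by (simp add: class_functionD)
  qed
  also have "\<dots> = (\<Sum>g\<in>carrier G. f g * (\<Sum>k\<in>carrier G. \<theta> (x \<otimes> conj_by k g)))"
    by (subst sum.swap) (simp add: sum_distrib_left)
  also have "\<dots> = (\<Sum>g\<in>carrier G. f g * (of_nat (Coset.order G) * (\<theta> x * \<theta> g)))"
    using x by (simp add: spherical_eq[OF \<theta>])
  also have "\<dots> = of_nat (Coset.order G) * (\<theta> x * pairing f \<theta>)"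
    by (simp add: pairing_def sum_distrib_left mult_ac)
  finally show ?thesis by simp
qed

lemma pairing_conv_spherical:
  assumes "spherical \<theta>" "class_function h"
  shows "pairing (conv f h) \<theta> = pairing f \<theta> * pairing h \<theta>"
proof -
  have "pairing (conv f h) \<theta> = (\<Sum>y\<in>carrier G. f y * (\<Sum>g\<in>carrier G. h g * \<theta> (y \<otimes> g)))"
    by (simp add: pairing_conv sum_distrib_left mult_ac)
  also have "\<dots> = (\<Sum>y\<in>carrier G. f y * (\<theta> y * pairing h \<theta>))"
    by (intro sum.cong refl) (simp add: spherical_eigenfunction[OF assms])
  finally show ?thesis by (simp add: pairing_def sum_distrib_right mult_ac)
qed

text \<open>Pairing \<open>\<theta>\<close> with the product of two class sums adds up the values \<open>\<theta> (a \<otimes> b)\<close>. As \<open>\<theta>\<close> is a class function,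
  \<open>a\<close> may be fixed, and by \<open>sum_over_class\<close> the sum over \<open>b\<close> becomes the average of the functional equation.\<close>

lemma sphericalI:
  assumes one: "\<theta> \<one> = 1" and \<theta>: "class_function \<theta>"
    and mult: "\<And>g h. \<lbrakk>g \<in> carrier G; h \<in> carrier G\<rbrakk> \<Longrightarrow>
      pairing (conv (class_sum g) (class_sum h)) \<theta> = pairing (class_sum g) \<theta> * pairing (class_sum h) \<theta>"
  shows "spherical \<theta>"
  unfolding spherical_def
proof (intro conjI one ballI)
  fix g h assume gh: "g \<in> carrier G" "h \<in> carrier G"
  let ?A = "\<lambda>a. \<Sum>k\<in>carrier G. \<theta> (a \<otimes> conj_by k h)"
  let ?m = "of_nat (card (conj_class g)) :: complex" and ?n = "of_nat (card (conj_class h)) :: complex"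
  have A: "class_function ?A"
    unfolding class_function_def
  proof (intro ballI)
    fix a l assume al: "a \<in> carrier G" "l \<in> carrier G"
    have "?A (conj_by l a) = (\<Sum>k\<in>carrier G. \<theta> (conj_by l a \<otimes> conj_by (l \<otimes> k) h))"
      using al by (intro sum_mult_left[symmetric])
    also have "\<dots> = (\<Sum>k\<in>carrier G. \<theta> (conj_by l (a \<otimes> conj_by k h)))"
      using al gh by (simp add: conj_by_conj_by[symmetric] conj_by_mult)
    also have "\<dots> = ?A a" using al gh by (simp add: class_functionD[OF \<theta>])
    finally show "?A (conj_by l a) = ?A a" .
  qed
  have inner: "of_nat (Coset.order G) * pairing (class_sum h) (\<lambda>b. \<theta> (a \<otimes> b)) = ?n * ?A a" for a
  proof -
    have "pairing (class_sum h) (\<lambda>b. \<theta> (a \<otimes> b)) = (\<Sum>b\<in>conj_class h. \<theta> (a \<otimes> b))"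
      unfolding pairing_def using gh(2) by (rule sum_class_sum)
    thus ?thesis using sum_over_class[OF gh(2)] by simp
  qed
  have "of_nat (Coset.order G) * pairing (conv (class_sum g) (class_sum h)) \<theta> =
      (\<Sum>a\<in>carrier G. class_sum g a * (of_nat (Coset.order G) * pairing (class_sum h) (\<lambda>b. \<theta> (a \<otimes> b))))"
    by (simp add: pairing_conv) (simp add: pairing_def sum_distrib_left mult_ac)
  also have "\<dots> = ?n * pairing (class_sum g) ?A"
    unfolding inner by (simp add: pairing_def sum_distrib_left mult_ac)
  also have "\<dots> = ?n * ?m * ?A g" using pairing_class_sum[OF gh(1) A] by simp
  finally have "of_nat (Coset.order G) * (?m * \<theta> g * (?n * \<theta> h)) = ?n * ?m * ?A g"
    using mult[OF gh] pairing_class_sum[OF _ \<theta>] gh by simp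
  hence "?n * ?m * (of_nat (Coset.order G) * (\<theta> g * \<theta> h)) = ?n * ?m * ?A g" by (simp add: mult_ac)
  moreover have "?n * ?m \<noteq> 0" using conj_class_self gh by auto
  ultimately show "of_nat (Coset.order G) * (\<theta> g * \<theta> h) = ?A g" by (metis mult_cancel_left)
qed

text \<open>Apply the eigenfunction identity to the complex conjugate of \<open>\<theta>\<close> and compare with the sum obtained by translating
  the summation variable.\<close>

lemma spherical_inv:
  assumes \<theta>: "spherical \<theta>" and x: "x \<in> carrier G"
  shows "\<theta> (inv x) = cnj (\<theta> x)"
proof -
  note cf = spherical_class_function[OF \<theta>]
  let ?f = "\<lambda>g. cnj (\<theta> g)"
  let ?s = "pairing ?f \<theta>"
  have s: "?s = of_real (\<Sum>g\<in>carrier G. (cmod (\<theta> g))\<^sup>2)"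
    by (simp add: pairing_def complex_norm_square mult.commute del: of_real_power)
  have "(\<Sum>g\<in>carrier G. (cmod (\<theta> g))\<^sup>2) \<ge> (cmod (\<theta> \<one>))\<^sup>2"
    by (rule member_le_sum) auto
  hence s0: "?s \<noteq> 0" unfolding s using spherical_one[OF \<theta>] by (simp del: of_real_sum)
  have f: "class_function ?f" by (rule class_function_compose[OF cf])
  have *: "(\<Sum>g\<in>carrier G. ?f g * \<theta> (y \<otimes> g)) = \<theta> y * ?s" if "y \<in> carrier G" for y
    by (rule spherical_eigenfunction[OF \<theta> f that])
  have "\<theta> (inv x) * ?s = (\<Sum>g\<in>carrier G. ?f g * \<theta> (inv x \<otimes> g))" using * x by simp
  also have "\<dots> = (\<Sum>g\<in>carrier G. ?f (x \<otimes> g) * \<theta> g)"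
    using x by (subst sum_mult_left[OF x, symmetric]) simp
  also have "\<dots> = cnj (\<Sum>g\<in>carrier G. ?f g * \<theta> (x \<otimes> g))" by (simp add: mult.commute)
  also have "\<dots> = cnj (\<theta> x) * ?s" unfolding *[OF x] by (simp add: s)
  finally show ?thesis using s0 by simp
qed

text \<open>The sum of \<open>\<eta> (inv g) * \<theta> (x \<otimes> g)\<close> over \<open>g\<close> can be evaluated with the eigenfunction property of \<open>\<theta>\<close> and, after
  translating the summation variable, with that of \<open>\<eta>\<close>. Both values are multiples by the same pairing.\<close>

lemma spherical_orthogonal:
  assumes \<theta>: "spherical \<theta>" and \<eta>: "spherical \<eta>"
    and ne: "pairing \<theta> (\<lambda>g. \<eta> (inv g)) \<noteq> 0" and x: "x \<in> carrier G"
  shows "\<theta> x = \<eta> x"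
proof -
  let ?s = "pairing \<theta> (\<lambda>g. \<eta> (inv g))"
  note cf = spherical_class_function[OF \<theta>] spherical_class_function[OF \<eta>]
  have "\<theta> x * ?s = (\<Sum>g\<in>carrier G. \<eta> (inv g) * \<theta> (x \<otimes> g))"
    using spherical_eigenfunction[OF \<theta> class_function_inv[OF cf(2)] x]
    by (simp add: pairing_def mult.commute)
  also have "\<dots> = (\<Sum>g\<in>carrier G. \<eta> (inv g \<otimes> x) * \<theta> g)"
    using x by (subst sum_mult_left[OF inv_closed[OF x], symmetric]) (simp add: inv_mult_group)
  also have "\<dots> = (\<Sum>g\<in>carrier G. \<eta> (g \<otimes> x) * \<theta> (inv g))"
    by (subst sum_inv[symmetric]) simp
  also have "\<dots> = (\<Sum>g\<in>carrier G. \<theta> (inv g) * \<eta> (x \<otimes> g))"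
    using x by (intro sum.cong refl) (simp add: class_function_mult_commute[OF cf(2)])
  also have "\<dots> = \<eta> x * pairing (\<lambda>g. \<theta> (inv g)) \<eta>"
    by (rule spherical_eigenfunction[OF \<eta> class_function_inv[OF cf(1)] x])
  also have "pairing (\<lambda>g. \<theta> (inv g)) \<eta> = ?s"
    unfolding pairing_def by (subst sum_inv[symmetric]) simp
  finally show ?thesis using ne by simp
qed

end

section \<open>Integrality of rational character values\<close>

text \<open>Multiplication by the sum \<open>r\<close> of the given roots of unity maps the vector of all \<open>m\<close>-th roots of
  unity to an integral combination of its entries, so \<open>r\<close> is an eigenvalue of an integer matrix.\<close>

lemma sum_roots_of_unity_algebraic_int:
  fixes es :: "complex list"
  assumes m: "m > 0" and es: "\<And>z. z \<in> set es \<Longrightarrow> z ^ m = 1"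
  shows "algebraic_int (sum_list es)"
proof -
  define U where "U = {z::complex. z ^ m = 1}"
  have U: "finite U" unfolding U_def using finite_roots_unity[of m] m by simp
  define d where "d = card U"
  obtain e where e: "bij_betw e {0..<d} U"
    using ex_bij_betw_nat_finite[OF U] by (auto simp: d_def)
  have eU: "e i \<in> U" if "i < d" for i using e that by (auto simp: bij_betw_def)
  \<comment> \<open>row \<open>i\<close> records how multiplication by the roots in \<open>es\<close> moves \<open>e i\<close>\<close>
  define A :: "int mat" where
    "A = mat d d (\<lambda>(i,j). int (length (filter (\<lambda>l. l * e i = e j) es)))"
  have A: "A \<in> carrier_mat d d" by (simp add: A_def)
  define w where "w = vec d e"
  define B :: "complex mat" where "B = map_mat of_int A"
  have B: "B \<in> carrier_mat d d" using A by (simp add: B_def)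
  have count: "(\<Sum>u\<in>U. of_nat (length (filter (\<lambda>l. l * z = u) ls)) * u) = sum_list ls * z"
    if "z \<in> U" "\<forall>l\<in>set ls. l \<in> U" for z ls
    using that(2)
  proof (induction ls)
    case (Cons l ls)
    have lz: "l * z \<in> U" using Cons.prems that(1) by (auto simp: U_def power_mult_distrib)
    have "(\<Sum>u\<in>U. of_nat (length (filter (\<lambda>l. l * z = u) (l # ls))) * u) =
        (\<Sum>u\<in>U. (if l * z = u then u else 0) + of_nat (length (filter (\<lambda>l. l * z = u) ls)) * u)"
      by (intro sum.cong refl) (auto simp: algebra_simps)
    also have "\<dots> = l * z + sum_list ls * z"
      using Cons lz U by (simp add: sum.distrib)
    finally show ?case by (simp add: algebra_simps)
  qed simp
  have "B *\<^sub>v w = sum_list es \<cdot>\<^sub>v w"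
  proof (rule eq_vecI)
    fix i assume "i < dim_vec (sum_list es \<cdot>\<^sub>v w)"
    hence i: "i < d" by (simp add: w_def)
    have "(B *\<^sub>v w) $ i = (\<Sum>j\<in>{0..<d}. of_nat (length (filter (\<lambda>l. l * e i = e j) es)) * e j)"
      using i by (simp add: B_def A_def w_def scalar_prod_def)
    also have "\<dots> = (\<Sum>u\<in>U. of_nat (length (filter (\<lambda>l. l * e i = u) es)) * u)"
      by (rule sum.reindex_bij_betw[OF e])
    also have "\<dots> = sum_list es * e i"
      using eU[OF i] es by (intro count) (auto simp: U_def)
    finally show "(B *\<^sub>v w) $ i = (sum_list es \<cdot>\<^sub>v w) $ i" using i by (simp add: w_def)
  qed (use A in \<open>auto simp: w_def B_def\<close>)
  moreover have "w \<noteq> 0\<^sub>v d"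
  proof
    assume w0: "w = 0\<^sub>v d"
    have "1 \<in> e ` {0..<d}" using e by (auto simp: bij_betw_def U_def)
    then obtain i where i: "i < d" "e i = 1" by auto
    have "w $ i = 0" using w0 i(1) by simp
    thus False using i by (simp add: w_def)
  qed
  ultimately have "eigenvalue B (sum_list es)"
    using B unfolding eigenvalue_def eigenvector_def by (intro exI[of _ w]) (auto simp: w_def)
  hence "poly (char_poly B) (sum_list es) = 0"
    using eigenvalue_root_char_poly[OF B] by simp
  hence "poly (map_poly of_int (char_poly A)) (sum_list es) = 0"
    using of_int_hom.char_poly_hom[OF A, where 'a = complex] by (simp add: B_def)
  thus ?thesis
    using degree_monic_char_poly[OF A] unfolding algebraic_int_altdef_ipoly by blast
qed

text \<open>In triangular form the trace is the sum of the eigenvalues, which are roots of unity.\<close>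

lemma trace_finite_order_algebraic_int:
  fixes A :: "complex mat"
  assumes A: "A \<in> carrier_mat n n" and m: "m > 0" and Am: "A ^\<^sub>m m = 1\<^sub>m n"
  shows "algebraic_int (mat_trace A)"
proof -
  obtain as where as: "char_poly A = (\<Prod>a\<leftarrow>as. [:- a, 1:])"
    using char_poly_factorized[OF A] by blast
  obtain B P Q where BPQ: "schur_decomposition A as = (B, P, Q)"
    by (cases "schur_decomposition A as") auto
  from schur_decomposition[OF A as BPQ]
  have sim: "similar_mat_wit A B P Q" and diag: "diag_mat B = as" by auto
  note s = similar_mat_witD2[OF A sim]
  have "mat_trace A = mat_trace (P * (B * Q))" using s by (simp add: assoc_mult_mat[of P n n B n Q n])
  also have "\<dots> = mat_trace (B * Q * P)" using s by (intro mat_trace_comm[of _ n n]) auto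
  also have "B * Q * P = B * (Q * P)" using s by (simp add: assoc_mult_mat[of B n n Q n P n])
  also have "\<dots> = B" using s by simp
  also have "mat_trace B = sum_list (diag_mat B)"
    using s by (simp add: mat_trace_def diag_mat_def sum_list_sum_nth atLeast0LessThan)
  finally have tr: "mat_trace A = sum_list as" using diag by simp
  have "a ^ m = 1" if "a \<in> set as" for a
  proof -
    have "poly (char_poly A) a = 0" using that by (auto simp: as poly_prod_list prod_list_zero_iff)
    hence "eigenvalue A a" using eigenvalue_root_char_poly[OF A] by simp
    then obtain v where v: "eigenvector A v a" by (auto simp: eigenvalue_def)
    hence vc: "v \<in> carrier_vec n" "v \<noteq> 0\<^sub>v n" using A by (auto simp: eigenvector_def)
    have eq: "v = a ^ m \<cdot>\<^sub>v v" using eigenvector_pow[OF A v, of m] Am vc by simp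
    obtain i where i: "i < n" "v $ i \<noteq> 0"
      using vc by (metis eq_vecI carrier_vecD index_zero_vec)
    have "v $ i = a ^ m * v $ i" using arg_cong[OF eq, of "\<lambda>u. u $ i"] i vc by simp
    thus ?thesis using i(2) by simp
  qed
  thus ?thesis unfolding tr by (rule sum_roots_of_unity_algebraic_int[OF m])
qed

section \<open>Irreducible characters and spherical functions\<close>

context finite_grp
begin

text \<open>The action of the group algebra element with coefficients \<open>f\<close>.\<close>

definition rep_sum :: "nat \<Rightarrow> ('a \<Rightarrow> complex mat) \<Rightarrow> ('a \<Rightarrow> complex) \<Rightarrow> complex mat" where
  "rep_sum n \<rho> f = mat_sum (carrier G) n n (\<lambda>g. f g \<cdot>\<^sub>m \<rho> g)"

lemma rep_sum_carrier [simp]: "rep_sum n \<rho> f \<in> carrier_mat n n"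
  by (simp add: rep_sum_def)

lemmas rep_dest = complex_rep_dest[OF is_group]

lemma mult_rep_sum:
  assumes rep: "complex_rep G n \<rho>" and T: "T \<in> carrier_mat k n"
  shows "T * rep_sum n \<rho> f = mat_sum (carrier G) k n (\<lambda>g. f g \<cdot>\<^sub>m (T * \<rho> g))"
  unfolding rep_sum_def using rep_dest(1)[OF rep] T
  by (subst mult_mat_sum[OF T]) (auto intro!: mat_sum_cong mult_smult_distrib)

lemma rep_sum_mult:
  assumes rep: "complex_rep G n \<rho>" and T: "T \<in> carrier_mat n k"
  shows "rep_sum n \<rho> f * T = mat_sum (carrier G) n k (\<lambda>g. f g \<cdot>\<^sub>m (\<rho> g * T))"
  unfolding rep_sum_def using rep_dest(1)[OF rep] T
  by (subst mat_sum_mult[OF T]) (auto intro!: mat_sum_cong mult_smult_assoc_mat)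

lemma rep_sum_commute:
  assumes rep: "complex_rep G n \<rho>" and f: "class_function f" and l: "l \<in> carrier G"
  shows "rep_sum n \<rho> f * \<rho> l = \<rho> l * rep_sum n \<rho> f"
proof -
  note r = rep_dest[OF rep]
  have "\<rho> l * rep_sum n \<rho> f = mat_sum (carrier G) n n (\<lambda>g. f g \<cdot>\<^sub>m \<rho> (l \<otimes> g))"
    using l r(2) unfolding mult_rep_sum[OF rep r(1)[OF l]] by (intro mat_sum_cong) auto
  also have "\<dots> = mat_sum (carrier G) n n (\<lambda>g. f (conj_by l g) \<cdot>\<^sub>m \<rho> (conj_by l g \<otimes> l))"
    using l by (intro mat_sum_cong refl) (simp add: class_functionD[OF f], simp add: conj_by_def m_assoc)
  also have "\<dots> = mat_sum (carrier G) n n (\<lambda>g. f g \<cdot>\<^sub>m \<rho> (g \<otimes> l))"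
    using mat_sum_reindex[OF bij_conj_by[OF l], of n n "\<lambda>g. f g \<cdot>\<^sub>m \<rho> (g \<otimes> l)"] .
  also have "\<dots> = rep_sum n \<rho> f * \<rho> l"
    using l r(2) unfolding rep_sum_mult[OF rep r(1)[OF l]] by (intro mat_sum_cong) auto
  finally show ?thesis ..
qed

lemma trace_smult: "A \<in> carrier_mat n n \<Longrightarrow> mat_trace (c \<cdot>\<^sub>m A) = (c::complex) * mat_trace A"
  by (simp add: mat_trace_def sum_distrib_left)

lemma trace_class_function:
  assumes rep: "complex_rep G n \<rho>"
  shows "class_function (\<lambda>g. mat_trace (\<rho> g))"
  unfolding class_function_def
proof (intro ballI)
  note r = rep_dest[OF rep]
  fix g k assume gk: "g \<in> carrier G" "k \<in> carrier G"
  have "mat_trace (\<rho> (conj_by k g)) = mat_trace (\<rho> (k \<otimes> g) * \<rho> (inv k))"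
    using gk r(2)[of "k \<otimes> g" "inv k"] by (simp add: conj_by_def)
  also have "\<dots> = mat_trace (\<rho> (inv k) * \<rho> (k \<otimes> g))"
    using gk r(1) by (intro mat_trace_comm[of _ n n]) auto
  also have "\<dots> = mat_trace (\<rho> g)"
    using gk r(2)[of "inv k" "k \<otimes> g"] by (simp add: m_assoc[symmetric])
  finally show "mat_trace (\<rho> (conj_by k g)) = mat_trace (\<rho> g)" .
qed

text \<open>The scalar of Schur's lemma is found by taking traces.\<close>

lemma rep_sum_scalar:
  assumes irr: "irreducible_rep G n \<rho>" and f: "class_function f"
  shows "rep_sum n \<rho> f = (pairing f (\<lambda>g. mat_trace (\<rho> g)) / of_nat n) \<cdot>\<^sub>m 1\<^sub>m n"
proof -
  have rep: "complex_rep G n \<rho>" and n: "n > 0" using irr by (auto simp: irreducible_rep_def)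
  obtain c where c: "rep_sum n \<rho> f = c \<cdot>\<^sub>m 1\<^sub>m n"
    using schur_scalar[OF is_group irr rep_sum_carrier rep_sum_commute[OF rep f]] by metis
  have "of_nat n * c = mat_trace (rep_sum n \<rho> f)" by (simp add: c mat_trace_scalar)
  also have "\<dots> = (\<Sum>g\<in>carrier G. mat_trace (f g \<cdot>\<^sub>m \<rho> g))"
    unfolding rep_sum_def using rep_dest(1)[OF rep] by (intro mat_trace_mat_sum) auto
  also have "\<dots> = pairing f (\<lambda>g. mat_trace (\<rho> g))"
    unfolding pairing_def using rep_dest(1)[OF rep] by (intro sum.cong refl trace_smult) auto
  finally have "c = pairing f (\<lambda>g. mat_trace (\<rho> g)) / of_nat n" using n by (simp add: field_simps)
  thus ?thesis using c by simp
qed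

text \<open>Since class functions act as scalars, the trace of \<open>\<rho> y * rep_sum n \<rho> f\<close> is a multiple of the trace
  of \<open>\<rho> y\<close>. This is the eigenfunction property, and it implies multiplicativity.\<close>

lemma irreducible_rep_spherical:
  assumes irr: "irreducible_rep G n \<rho>"
  shows "spherical (\<lambda>g. mat_trace (\<rho> g) / of_nat n)" (is "spherical ?\<theta>")
proof (rule sphericalI)
  let ?t = "\<lambda>g. mat_trace (\<rho> g)"
  have rep: "complex_rep G n \<rho>" and n: "n > 0" using irr by (auto simp: irreducible_rep_def)
  note r = rep_dest[OF rep]
  show "?\<theta> \<one> = 1" using n r(3) by (simp add: mat_trace_def)
  show "class_function ?\<theta>" by (rule class_function_compose[OF trace_class_function[OF rep]])
  fix g h assume gh: "g \<in> carrier G" "h \<in> carrier G"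
  have eig: "(\<Sum>x\<in>carrier G. f x * ?t (y \<otimes> x)) = ?t y * (pairing f ?t / of_nat n)"
    if y: "y \<in> carrier G" and f: "class_function f" for y f
  proof -
    have "(\<Sum>x\<in>carrier G. f x * ?t (y \<otimes> x)) = mat_trace (\<rho> y * rep_sum n \<rho> f)"
    proof -
      have m: "\<rho> y * \<rho> x \<in> carrier_mat n n" if "x \<in> carrier G" for x
        using mult_carrier_mat[OF r(1)[OF y] r(1)[OF that]] .
      have "mat_trace (\<rho> y * rep_sum n \<rho> f) = (\<Sum>x\<in>carrier G. mat_trace (f x \<cdot>\<^sub>m (\<rho> y * \<rho> x)))"
        unfolding mult_rep_sum[OF rep r(1)[OF y]] using m by (intro mat_trace_mat_sum) simp
      thus ?thesis using r(2) y m by (simp add: trace_smult[OF m])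
    qed
    also have "\<rho> y * rep_sum n \<rho> f = (pairing f ?t / of_nat n) \<cdot>\<^sub>m \<rho> y"
      unfolding rep_sum_scalar[OF irr f] mult_smult_distrib[OF r(1)[OF y] one_carrier_mat]
      using r(1)[OF y] by simp
    finally show ?thesis using trace_smult[OF r(1)[OF y]] by simp
  qed
  let ?f = "class_sum g :: 'a \<Rightarrow> complex" and ?h = "class_sum h :: 'a \<Rightarrow> complex"
  have cfh: "class_function ?h" by (rule class_function_class_sum[OF gh(2)])
  have "pairing (conv ?f ?h) ?\<theta> = (\<Sum>y\<in>carrier G. ?f y * (\<Sum>x\<in>carrier G. ?h x * ?t (y \<otimes> x)) / of_nat n)"
    by (simp add: pairing_conv sum_distrib_left sum_divide_distrib mult_ac)
  also have "\<dots> = (\<Sum>y\<in>carrier G. ?f y * ?\<theta> y * (pairing ?h ?t / of_nat n))"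
    using eig[OF _ cfh] by (intro sum.cong refl) simp
  also have "\<dots> = pairing ?f ?\<theta> * (pairing ?h ?t / of_nat n)"
    unfolding pairing_def[of ?f] by (rule sum_distrib_right[symmetric])
  also have "pairing ?h ?t / of_nat n = pairing ?h ?\<theta>"
    by (simp add: pairing_def sum_divide_distrib)
  finally show "pairing (conv ?f ?h) ?\<theta> = pairing ?f ?\<theta> * pairing ?h ?\<theta>" .
qed

text \<open>Averaging the conjugates of an elementary matrix gives a scalar matrix by Schur's lemma; its
  entries are the orthogonality relations for matrix coefficients.\<close>

lemma irreducible_rep_coefficients:
  assumes irr: "irreducible_rep G n \<rho>" and ik: "i < n" "k < n"
  shows "(\<Sum>g\<in>carrier G. \<rho> g $$ (i,i) * \<rho> (inv g) $$ (k,k)) =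
    (if i = k then of_nat (Coset.order G) / of_nat n else 0)"
proof -
  have rep: "complex_rep G n \<rho>" and n: "n > 0" using irr by (auto simp: irreducible_rep_def)
  note r = rep_dest[OF rep]
  define E :: "complex mat" where "E = mat n n (\<lambda>p. of_bool (p = (i,k)))"
  have E: "E \<in> carrier_mat n n" by (simp add: E_def)
  define M where "M = mat_sum (carrier G) n n (\<lambda>g. \<rho> g * E * \<rho> (inv g))"
  have summand: "\<rho> g * E * \<rho> (inv g) \<in> carrier_mat n n" if "g \<in> carrier G" for g
    using r(1)[of g] r(1)[of "inv g"] E that by (meson inv_closed mult_carrier_mat)
  have "M * \<rho> l = \<rho> l * M" if l: "l \<in> carrier G" for l
  proof -
    have "\<rho> l * M = mat_sum (carrier G) n n (\<lambda>g. \<rho> l * (\<rho> g * E * \<rho> (inv g)))"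
      unfolding M_def using r(1)[OF l] summand by (rule mult_mat_sum)
    also have "\<dots> = mat_sum (carrier G) n n (\<lambda>g. \<rho> (l \<otimes> g) * E * \<rho> (inv (l \<otimes> g)) * \<rho> l)"
    proof (rule mat_sum_cong[OF refl])
      fix g assume g: "g \<in> carrier G"
      have c: "\<rho> l \<in> carrier_mat n n" "\<rho> g \<in> carrier_mat n n" "\<rho> (inv g) \<in> carrier_mat n n"
        "\<rho> (inv (l \<otimes> g)) \<in> carrier_mat n n" using r(1) l g by auto
      have "\<rho> (l \<otimes> g) * E * \<rho> (inv (l \<otimes> g)) * \<rho> l = \<rho> (l \<otimes> g) * E * (\<rho> (inv (l \<otimes> g)) * \<rho> l)"
        using r(1)[of "l \<otimes> g"] l g E c by (intro assoc_mult_mat[of _ n n _ n _ n]) auto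
      also have "\<rho> (inv (l \<otimes> g)) * \<rho> l = \<rho> (inv g)"
        using r(2)[of "inv (l \<otimes> g)" l] l g by (simp add: inv_mult_group m_assoc)
      also have "\<rho> (l \<otimes> g) * E * \<rho> (inv g) = \<rho> l * (\<rho> g * E * \<rho> (inv g))"
        using c E r(2)[OF l g] by (simp add: assoc_mult_mat[of _ n n _ n _ n])
      finally show "\<rho> l * (\<rho> g * E * \<rho> (inv g)) = \<rho> (l \<otimes> g) * E * \<rho> (inv (l \<otimes> g)) * \<rho> l" ..
    qed
    also have "\<dots> = mat_sum (carrier G) n n (\<lambda>g. \<rho> g * E * \<rho> (inv g) * \<rho> l)"
      using mat_sum_reindex[of "\<lambda>g. l \<otimes> g" "carrier G" "carrier G" n n "\<lambda>g. \<rho> g * E * \<rho> (inv g) * \<rho> l"]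
        bij_betw_byWitness[of "carrier G" "\<lambda>g. inv l \<otimes> g" "\<lambda>g. l \<otimes> g" "carrier G"] l by auto
    also have "\<dots> = M * \<rho> l"
      unfolding M_def using r(1)[OF l] summand by (rule mat_sum_mult[symmetric])
    finally show ?thesis ..
  qed
  then obtain c where c: "M = c \<cdot>\<^sub>m 1\<^sub>m n"
    using schur_scalar[OF is_group irr, of M] by (metis M_def mat_sum_carrier)
  have entry: "(\<rho> g * E * \<rho> (inv g)) $$ (i,k) = \<rho> g $$ (i,i) * \<rho> (inv g) $$ (k,k)" if g: "g \<in> carrier G" for g
  proof -
    have c: "\<rho> g \<in> carrier_mat n n" "\<rho> (inv g) \<in> carrier_mat n n" using r(1) g by auto
    have rowE: "(\<rho> g * E) $$ (i,l) = of_bool (l = k) * \<rho> g $$ (i,i)" if "l < n" for l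
      using c(1) that ik by (simp add: E_def scalar_prod_def if_distrib of_bool_def cong: if_cong)
    have "(P * Q) $$ (i,k) = (\<Sum>l\<in>{0..<n}. P $$ (i,l) * Q $$ (l,k))"
      if "P \<in> carrier_mat n n" "Q \<in> carrier_mat n n" for P Q :: "complex mat"
      using that ik by (simp add: scalar_prod_def)
    from this[OF mult_carrier_mat[OF c(1) E] c(2)]
    have "(\<rho> g * E * \<rho> (inv g)) $$ (i,k) = (\<Sum>l\<in>{0..<n}. (\<rho> g * E) $$ (i,l) * \<rho> (inv g) $$ (l,k))" .
    also have "\<dots> = (\<Sum>l\<in>{0..<n}. if l = k then \<rho> g $$ (i,i) * \<rho> (inv g) $$ (k,k) else 0)"
      by (intro sum.cong refl) (simp add: rowE)
    finally show ?thesis using ik by simp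
  qed
  have "of_nat n * c = mat_trace M" by (simp add: c mat_trace_scalar)
  also have "\<dots> = (\<Sum>g\<in>carrier G. mat_trace (\<rho> g * E * \<rho> (inv g)))"
    unfolding M_def using summand by (rule mat_trace_mat_sum)
  also have "\<dots> = (\<Sum>g\<in>carrier G. mat_trace E)"
  proof (rule sum.cong[OF refl])
    fix g assume g: "g \<in> carrier G"
    have c: "\<rho> g \<in> carrier_mat n n" "\<rho> (inv g) \<in> carrier_mat n n" using r(1) g by auto
    have "mat_trace (\<rho> g * E * \<rho> (inv g)) = mat_trace (\<rho> (inv g) * (\<rho> g * E))"
      using c E by (intro mat_trace_comm[of _ n n]) auto
    also have "\<rho> (inv g) * (\<rho> g * E) = \<rho> (inv g) * \<rho> g * E"
      using c E by (simp add: assoc_mult_mat[of _ n n _ n _ n])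
    also have "\<rho> (inv g) * \<rho> g = 1\<^sub>m n" using r(2)[of "inv g" g] r(3) g by simp
    finally show "mat_trace (\<rho> g * E * \<rho> (inv g)) = mat_trace E" using E by simp
  qed
  also have "\<dots> = of_nat (Coset.order G) * mat_trace E" by (simp add: Coset.order_def)
  also have "mat_trace E = of_bool (i = k)"
    using ik by (auto simp: mat_trace_def E_def of_bool_def)
  finally have cval: "c = (if i = k then of_nat (Coset.order G) / of_nat n else 0)"
    using n by (auto simp: field_simps)
  have "(\<Sum>g\<in>carrier G. \<rho> g $$ (i,i) * \<rho> (inv g) $$ (k,k)) = M $$ (i,k)"
    using ik entry by (simp add: M_def)
  also have "\<dots> = c * of_bool (i = k)" using ik by (simp add: c)
  finally show ?thesis using cval by auto
qed

lemma irreducible_rep_norm: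
  assumes irr: "irreducible_rep G n \<rho>"
  shows "(\<Sum>g\<in>carrier G. mat_trace (\<rho> g) * mat_trace (\<rho> (inv g))) = of_nat (Coset.order G)"
proof -
  have rep: "complex_rep G n \<rho>" and n: "n > 0" using irr by (auto simp: irreducible_rep_def)
  have tr: "mat_trace (\<rho> g) = (\<Sum>i<n. \<rho> g $$ (i,i))" if "g \<in> carrier G" for g
    using rep_dest(1)[OF rep that] by (simp add: mat_trace_def)
  have "(\<Sum>g\<in>carrier G. mat_trace (\<rho> g) * mat_trace (\<rho> (inv g))) =
      (\<Sum>g\<in>carrier G. \<Sum>i<n. \<Sum>k<n. \<rho> g $$ (i,i) * \<rho> (inv g) $$ (k,k))"
    by (simp add: tr sum_product)
  also have "\<dots> = (\<Sum>i<n. \<Sum>g\<in>carrier G. \<Sum>k<n. \<rho> g $$ (i,i) * \<rho> (inv g) $$ (k,k))"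
    by (rule sum.swap)
  also have "\<dots> = (\<Sum>i<n. \<Sum>k<n. \<Sum>g\<in>carrier G. \<rho> g $$ (i,i) * \<rho> (inv g) $$ (k,k))"
    by (intro sum.cong refl sum.swap)
  also have "\<dots> = (\<Sum>i<n. \<Sum>k<n. if i = k then of_nat (Coset.order G) / of_nat n else 0)"
    by (simp add: irreducible_rep_coefficients[OF irr])
  also have "\<dots> = of_nat (Coset.order G)" using n by simp
  finally show ?thesis .
qed

lemma irr_character_cases:
  assumes "\<chi> \<in> irr_characters G"
  obtains n \<rho> where "irreducible_rep G n \<rho>" "\<chi> = rep_character G \<rho>" "n > 0" "\<chi> \<one> = of_nat n"
proof -
  obtain n \<rho> where *: "irreducible_rep G n \<rho>" "\<chi> = rep_character G \<rho>"
    using assms by (auto simp: irr_characters_def)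
  hence r: "\<rho> \<one> = 1\<^sub>m n" and n: "n > 0"
    using rep_dest(3) by (auto simp: irreducible_rep_def)
  have "\<chi> \<one> = of_nat n" by (simp add: *(2) rep_character_def r) (simp add: mat_trace_def)
  thus ?thesis using that * n by blast
qed

lemma irr_character_degree_neq_0: "\<chi> \<in> irr_characters G \<Longrightarrow> \<chi> \<one> \<noteq> 0"
  by (elim irr_character_cases) simp

lemma irr_character_extensional: "\<chi> \<in> irr_characters G \<Longrightarrow> \<chi> \<in> extensional (carrier G)"
  by (elim irr_character_cases) (simp add: rep_character_def)

lemma spherical_cong:
  assumes "\<And>g. g \<in> carrier G \<Longrightarrow> \<theta> g = \<eta> g"
  shows "spherical \<theta> \<longleftrightarrow> spherical \<eta>"
  using assms by (simp add: spherical_def)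

lemma irr_character_spherical:
  assumes "\<chi> \<in> irr_characters G"
  shows "spherical (\<lambda>g. \<chi> g / \<chi> \<one>)"
proof -
  obtain n \<rho> where *: "irreducible_rep G n \<rho>" "\<chi> = rep_character G \<rho>" "\<chi> \<one> = of_nat n"
    using assms by (elim irr_character_cases)
  show ?thesis
    using irreducible_rep_spherical[OF *(1)]
    by (subst spherical_cong[of _ "\<lambda>g. mat_trace (\<rho> g) / of_nat n"])
      (simp_all add: *(3), simp add: *(2) rep_character_def)
qed

lemma irr_character_norm:
  assumes "\<chi> \<in> irr_characters G"
  shows "pairing \<chi> (\<lambda>g. \<chi> (inv g)) = of_nat (Coset.order G)"
  using assms irreducible_rep_norm
  by (elim irr_character_cases) (simp add: pairing_def rep_character_def)

lemma irr_character_class_function: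
  assumes \<chi>: "\<chi> \<in> irr_characters G" shows "class_function \<chi>"
proof -
  have "class_function (\<lambda>g. \<chi> \<one> * (\<chi> g / \<chi> \<one>))"
    by (rule class_function_compose[OF spherical_class_function[OF irr_character_spherical[OF \<chi>]]])
  thus ?thesis using irr_character_degree_neq_0[OF \<chi>] by simp
qed

text \<open>For spherical functions a nonzero pairing forces equality. Hence non-orthogonal characters are proportional,
  and as they have the same norm and positive degrees they are equal.\<close>

lemma irr_character_orthogonal:
  assumes \<chi>: "\<chi> \<in> irr_characters G" and \<psi>: "\<psi> \<in> irr_characters G"
  shows "pairing \<chi> (\<lambda>g. \<psi> (inv g)) = (if \<chi> = \<psi> then of_nat (Coset.order G) else 0)"
proof (cases "\<chi> = \<psi>")
  case False
  note nz = irr_character_degree_neq_0[OF \<chi>] irr_character_degree_neq_0[OF \<psi>]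
  have "pairing \<chi> (\<lambda>g. \<psi> (inv g)) = 0"
  proof (rule ccontr)
    assume ne: "pairing \<chi> (\<lambda>g. \<psi> (inv g)) \<noteq> 0"
    have "pairing (\<lambda>g. \<chi> g / \<chi> \<one>) (\<lambda>g. \<psi> (inv g) / \<psi> \<one>) = pairing \<chi> (\<lambda>g. \<psi> (inv g)) / (\<chi> \<one> * \<psi> \<one>)"
      by (simp add: pairing_def sum_divide_distrib)
    hence "pairing (\<lambda>g. \<chi> g / \<chi> \<one>) (\<lambda>g. \<psi> (inv g) / \<psi> \<one>) \<noteq> 0" using ne nz by simp
    hence eq: "\<chi> x / \<chi> \<one> = \<psi> x / \<psi> \<one>" if "x \<in> carrier G" for x
      using spherical_orthogonal[OF irr_character_spherical[OF \<chi>] irr_character_spherical[OF \<psi>]] that by blast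
    obtain m n where mn: "\<chi> \<one> = of_nat m" "\<psi> \<one> = of_nat n" "m > 0" "n > 0"
      using \<chi> \<psi> by (metis irr_character_cases)
    define c where "c = \<chi> \<one> / \<psi> \<one>"
    have c: "\<chi> x = c * \<psi> x" if "x \<in> carrier G" for x using eq[OF that] nz by (simp add: c_def field_simps)
    have "of_nat (Coset.order G) = c * c * pairing \<psi> (\<lambda>g. \<psi> (inv g))"
      unfolding irr_character_norm[OF \<chi>, symmetric] by (simp add: pairing_def c sum_distrib_left mult_ac)
    hence "c * c = 1" by (simp add: irr_character_norm[OF \<psi>])
    hence "of_nat (m * m) = (of_nat (n * n) :: complex)" using mn by (simp add: c_def field_simps)
    hence "m * m = n * n" by (simp only: of_nat_eq_iff)
    hence "m = n" by (metis power2_eq_square power2_eq_iff_nonneg zero_le)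
    hence "c = 1" using mn by (simp add: c_def)
    hence "\<chi> = \<psi>"
      using c irr_character_extensional[OF \<chi>] irr_character_extensional[OF \<psi>]
      by (intro extensionalityI[of _ "carrier G"]) auto
    thus False using False by simp
  qed
  thus ?thesis using False by simp
qed (simp add: irr_character_norm[OF \<psi>])

lemma irr_character_algebraic_int:
  assumes \<chi>: "\<chi> \<in> irr_characters G" and g: "g \<in> carrier G"
  shows "algebraic_int (\<chi> g)"
proof -
  obtain n \<rho> where *: "irreducible_rep G n \<rho>" "\<chi> = rep_character G \<rho>"
    using \<chi> by (elim irr_character_cases)
  hence rep: "complex_rep G n \<rho>" by (simp add: irreducible_rep_def)
  note r = rep_dest[OF rep]
  have "\<rho> g ^\<^sub>m m = \<rho> (g [^] m)" for m
    using g r by (induction m) auto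
  hence "\<rho> g ^\<^sub>m Coset.order G = 1\<^sub>m n"
    using pow_order_eq_1[OF g] r(3) by simp
  thus ?thesis
    using trace_finite_order_algebraic_int[OF r(1)[OF g] order_pos] g by (simp add: *(2) rep_character_def)
qed

lemma linear_character_mult:
  assumes \<chi>: "\<chi> \<in> irr_characters G" and one: "\<chi> \<one> = 1" and gh: "g \<in> carrier G" "h \<in> carrier G"
  shows "\<chi> (g \<otimes> h) = \<chi> g * \<chi> h"
proof -
  obtain n \<rho> where *: "irreducible_rep G n \<rho>" "\<chi> = rep_character G \<rho>" "\<chi> \<one> = of_nat n"
    using \<chi> by (elim irr_character_cases)
  have n: "n = Suc 0" using *(3) one by (metis One_nat_def of_nat_1_eq_iff)
  have rep: "complex_rep G n \<rho>" using *(1) by (simp add: irreducible_rep_def)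
  note r = rep_dest[OF rep]
  show ?thesis
    using gh r(1)[OF gh(1)] r(1)[OF gh(2)] r(2)[OF gh] n
    by (simp add: *(2) rep_character_def mat_trace_def scalar_prod_def)
qed

end

section \<open>Completeness of the irreducible characters\<close>

context finite_grp
begin

text \<open>The simultaneous eigenvectors of the operators \<open>rep_sum N \<rho> f\<close> with eigenvalues \<open>c\<close> form an
  invariant subspace. On an irreducible subspace of it the central element \<open>f\<close> acts by the scalar
  given by its character.\<close>

lemma central_eigenvector_imp_irr_character:
  assumes rep: "complex_rep G N \<rho>" and w0: "w0 \<in> carrier_vec N" "w0 \<noteq> 0\<^sub>v N"
    and F: "\<And>f c. (f, c) \<in> F \<Longrightarrow> class_function f"
    and eig: "\<And>f c. (f, c) \<in> F \<Longrightarrow> rep_sum N \<rho> f *\<^sub>v w0 = c \<cdot>\<^sub>v w0"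
  obtains \<chi> where "\<chi> \<in> irr_characters G" "\<And>f c. (f, c) \<in> F \<Longrightarrow> pairing f \<chi> = \<chi> \<one> * c"
proof -
  note r = rep_dest[OF rep]
  define V where "V = {w \<in> carrier_vec N. \<forall>(f, c) \<in> F. rep_sum N \<rho> f *\<^sub>v w = c \<cdot>\<^sub>v w}"
  have VI: "w \<in> V" if "w \<in> carrier_vec N" "\<And>f c. (f, c) \<in> F \<Longrightarrow> rep_sum N \<rho> f *\<^sub>v w = c \<cdot>\<^sub>v w" for w
    using that by (auto simp: V_def)
  have VD: "w \<in> carrier_vec N" "(f, c) \<in> F \<Longrightarrow> rep_sum N \<rho> f *\<^sub>v w = c \<cdot>\<^sub>v w" if "w \<in> V" for w f c
    using that by (auto simp: V_def)
  note S = rep_sum_carrier[of N \<rho>]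
  have zero: "0\<^sub>v N \<in> V" by (rule VI) (auto simp: rep_sum_def mat_sum_def scalar_prod_def intro!: eq_vecI)
  have add: "v + w \<in> V" if "v \<in> V" "w \<in> V" for v w
    using VD(1)[OF that(1)] VD(1)[OF that(2)] VD(2)[OF that(1)] VD(2)[OF that(2)]
    by (intro VI) (simp_all add: mult_add_distrib_mat_vec[OF S] smult_add_distrib_vec[of _ N])
  have smult: "a \<cdot>\<^sub>v v \<in> V" if "v \<in> V" for a v
    using VD(1)[OF that] VD(2)[OF that]
    by (intro VI) (simp_all add: mult_mat_vec[OF S] smult_smult_assoc mult.commute)
  have inv: "\<rho> g *\<^sub>v v \<in> V" if g: "g \<in> carrier G" and v: "v \<in> V" for g v
  proof (rule VI)
    note vc = VD(1)[OF v]
    show "\<rho> g *\<^sub>v v \<in> carrier_vec N" using r(1)[OF g] vc by simp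
    fix f c assume fc: "(f, c) \<in> F"
    have "rep_sum N \<rho> f *\<^sub>v (\<rho> g *\<^sub>v v) = \<rho> g *\<^sub>v (rep_sum N \<rho> f *\<^sub>v v)"
      using assoc_mult_mat_vec[OF S[of f] r(1)[OF g] vc] assoc_mult_mat_vec[OF r(1)[OF g] S[of f] vc]
        rep_sum_commute[OF rep F[OF fc] g] by simp
    thus "rep_sum N \<rho> f *\<^sub>v (\<rho> g *\<^sub>v v) = c \<cdot>\<^sub>v (\<rho> g *\<^sub>v v)"
      unfolding VD(2)[OF v fc] mult_mat_vec[OF r(1)[OF g] vc] .
  qed
  have "w0 \<in> V" using w0(1) eig by (intro VI)
  obtain n \<sigma> T where irr: "irreducible_rep G n \<sigma>" and T: "T \<in> carrier_mat N n" "injective_mat T"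
    and tw: "\<And>g. g \<in> carrier G \<Longrightarrow> \<rho> g * T = T * \<sigma> g" and TV: "\<And>x. x \<in> carrier_vec n \<Longrightarrow> T *\<^sub>v x \<in> V"
    by (rule irreducible_subrep[OF is_group rep _ zero add smult inv \<open>w0 \<in> V\<close> w0(2)]) (use VD(1) in auto)
  have rep': "complex_rep G n \<sigma>" and n: "n > 0" using irr by (auto simp: irreducible_rep_def)
  let ?\<chi> = "rep_character G \<sigma>"
  have \<chi>1: "?\<chi> \<one> = of_nat n" by (simp add: rep_character_def rep_dest(3)[OF rep']) (simp add: mat_trace_def)
  have "pairing f ?\<chi> = ?\<chi> \<one> * c" if fc: "(f, c) \<in> F" for f c
  proof -
    let ?p = "pairing f (\<lambda>g. mat_trace (\<sigma> g)) / of_nat n"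
    define e :: "complex vec" where "e = unit_vec n 0"
    have e: "e \<in> carrier_vec n" by (simp add: e_def)
    have "T * rep_sum n \<sigma> f = rep_sum N \<rho> f * T"
      unfolding mult_rep_sum[OF rep' T(1)] rep_sum_mult[OF rep T(1)]
      by (intro mat_sum_cong refl) (simp add: tw)
    hence "T *\<^sub>v (rep_sum n \<sigma> f *\<^sub>v e) = rep_sum N \<rho> f *\<^sub>v (T *\<^sub>v e)"
      using assoc_mult_mat_vec[OF T(1) rep_sum_carrier[of n \<sigma> f] e] assoc_mult_mat_vec[OF S[of f] T(1) e] by simp
    also have "\<dots> = T *\<^sub>v (c \<cdot>\<^sub>v e)"
      unfolding VD(2)[OF TV[OF e] fc] mult_mat_vec[OF T(1) e] ..
    finally have "rep_sum n \<sigma> f *\<^sub>v e = c \<cdot>\<^sub>v e"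
      by (rule injective_mat_cancel_vec[OF T(2,1) mult_mat_vec_carrier[OF rep_sum_carrier e]
          smult_carrier_vec[THEN iffD2, OF e]])
    hence "(rep_sum n \<sigma> f *\<^sub>v e) $ 0 = c" using n by (simp add: e_def)
    moreover have "(rep_sum n \<sigma> f *\<^sub>v e) $ 0 = ?p"
    proof -
      have "rep_sum n \<sigma> f *\<^sub>v e = col (rep_sum n \<sigma> f) 0"
        unfolding e_def by (rule mult_mat_unit_vec[OF rep_sum_carrier n])
      thus ?thesis using n by (simp add: rep_sum_scalar[OF irr F[OF fc]])
    qed
    moreover have "pairing f ?\<chi> = pairing f (\<lambda>g. mat_trace (\<sigma> g))"
      by (simp add: pairing_def rep_character_def)
    ultimately show ?thesis using n \<chi>1 by (simp add: field_simps)
  qed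
  moreover have "?\<chi> \<in> irr_characters G" using irr by (auto simp: irr_characters_def)
  ultimately show ?thesis using that by blast
qed

text \<open>The same for functions on \<open>G\<close>: in the regular representation \<open>rep_sum f\<close> is convolution with
  \<open>f\<close>.\<close>

lemma central_eigenfunction_imp_irr_character:
  assumes x0: "x0 \<in> carrier G" "v x0 \<noteq> 0"
    and F: "\<And>f c. (f, c) \<in> F \<Longrightarrow> class_function f"
    and eig: "\<And>f c x. \<lbrakk>(f, c) \<in> F; x \<in> carrier G\<rbrakk> \<Longrightarrow> conv f v x = c * v x"
  obtains \<chi> where "\<chi> \<in> irr_characters G" "\<And>f c. (f, c) \<in> F \<Longrightarrow> pairing f \<chi> = \<chi> \<one> * c"
proof -
  define N where "N = card (carrier G)"
  obtain e where e: "bij_betw e {0..<N} (carrier G)"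
    using ex_bij_betw_nat_finite[OF fin] by (auto simp: N_def)
  have ec [simp]: "e i \<in> carrier G" if "i < N" for i using e that by (auto simp: bij_betw_def)
  have einj: "e i = e j \<longleftrightarrow> i = j" if "i < N" "j < N" for i j
    using e that by (auto simp: bij_betw_def inj_on_def)
  have sum_e: "(\<Sum>j\<in>{0..<N}. H (e j)) = (\<Sum>x\<in>carrier G. H x)" for H :: "'a \<Rightarrow> complex"
    by (rule sum.reindex_bij_betw[OF e])
  define \<rho> :: "'a \<Rightarrow> complex mat" where "\<rho> g = mat N N (\<lambda>(i,j). of_bool (e i = g \<otimes> e j))" for g
  have delta: "(\<Sum>x\<in>carrier G. of_bool (y = g \<otimes> x) * H x) = H (inv g \<otimes> y)"
    if "y \<in> carrier G" "g \<in> carrier G" for y g and H :: "'a \<Rightarrow> complex"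
  proof -
    have "(\<Sum>x\<in>carrier G. of_bool (y = g \<otimes> x) * H x) = (\<Sum>x\<in>carrier G. if inv g \<otimes> y = x then H x else 0)"
      using that by (intro sum.cong refl) auto
    thus ?thesis using that by simp
  qed
  have rep: "complex_rep G N \<rho>"
  proof (rule complex_repI[OF is_group])
    show "\<rho> g \<in> carrier_mat N N" for g by (simp add: \<rho>_def)
    show "\<rho> \<one> = 1\<^sub>m N" by (rule eq_matI) (auto simp: \<rho>_def einj)
    fix g h assume gh: "g \<in> carrier G" "h \<in> carrier G"
    show "\<rho> (g \<otimes> h) = \<rho> g * \<rho> h"
    proof (rule eq_matI)
      fix i j assume "i < dim_row (\<rho> g * \<rho> h)" "j < dim_col (\<rho> g * \<rho> h)"
      hence ij: "i < N" "j < N" by (auto simp: \<rho>_def)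
      have "(\<rho> g * \<rho> h) $$ (i,j) = (\<Sum>l\<in>{0..<N}. of_bool (e i = g \<otimes> e l) * of_bool (e l = h \<otimes> e j))"
        using ij by (simp add: \<rho>_def scalar_prod_def)
      also have "\<dots> = of_bool (inv g \<otimes> e i = h \<otimes> e j)"
        using delta[of "e i" g "\<lambda>x. of_bool (x = h \<otimes> e j)"] gh ij
        by (simp add: sum_e[of "\<lambda>x. of_bool (e i = g \<otimes> x) * of_bool (x = h \<otimes> e j)"])
      also have "\<dots> = \<rho> (g \<otimes> h) $$ (i,j)"
      proof -
        have "inv g \<otimes> e i = h \<otimes> e j \<longleftrightarrow> e i = g \<otimes> h \<otimes> e j"
          using gh ij inv_mult_cancel ec by (metis m_assoc m_closed)
        thus ?thesis using ij by (simp add: \<rho>_def)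
      qed
      finally show "\<rho> (g \<otimes> h) $$ (i,j) = (\<rho> g * \<rho> h) $$ (i,j)" ..
    qed (auto simp: \<rho>_def)
  qed
  have act: "rep_sum N \<rho> f *\<^sub>v vec N (\<lambda>i. v (e i)) = vec N (\<lambda>i. conv f v (e i))" for f
  proof (rule eq_vecI)
    fix i assume "i < dim_vec (vec N (\<lambda>i. conv f v (e i)))"
    hence i: "i < N" by simp
    have "(rep_sum N \<rho> f *\<^sub>v vec N (\<lambda>i. v (e i))) $ i =
        (\<Sum>j\<in>{0..<N}. (\<Sum>g\<in>carrier G. f g * of_bool (e i = g \<otimes> e j)) * v (e j))"
      using i by (simp add: rep_sum_def \<rho>_def scalar_prod_def)
    also have "\<dots> = (\<Sum>x\<in>carrier G. (\<Sum>g\<in>carrier G. f g * of_bool (e i = g \<otimes> x)) * v x)"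
      by (rule sum_e)
    also have "\<dots> = (\<Sum>g\<in>carrier G. f g * (\<Sum>x\<in>carrier G. of_bool (e i = g \<otimes> x) * v x))"
      unfolding sum_distrib_right sum_distrib_left mult.assoc by (rule sum.swap)
    also have "\<dots> = conv f v (e i)"
      unfolding conv_def by (intro sum.cong refl) (simp only: delta[OF ec[OF i]])
    finally show "(rep_sum N \<rho> f *\<^sub>v vec N (\<lambda>i. v (e i))) $ i = vec N (\<lambda>i. conv f v (e i)) $ i"
      using i by simp
  qed (simp add: rep_sum_def mat_sum_def)
  have nz: "vec N (\<lambda>i. v (e i)) \<noteq> 0\<^sub>v N"
  proof -
    obtain i where i: "i < N" "x0 = e i" using x0(1) bij_betw_imp_surj_on[OF e] by fastforce
    hence "vec N (\<lambda>i. v (e i)) $ i \<noteq> 0\<^sub>v N $ i" using x0(2) by simp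
    thus ?thesis by metis
  qed
  have eig': "rep_sum N \<rho> f *\<^sub>v vec N (\<lambda>i. v (e i)) = c \<cdot>\<^sub>v vec N (\<lambda>i. v (e i))"
    if "(f, c) \<in> F" for f c
    unfolding act using eig[OF that] by (intro eq_vecI) auto
  show ?thesis
  proof (rule central_eigenvector_imp_irr_character[OF rep _ nz])
    show "class_function f" if "(f, c) \<in> F" for f c using that by (rule F)
    show "rep_sum N \<rho> f *\<^sub>v vec N (\<lambda>i. v (e i)) = c \<cdot>\<^sub>v vec N (\<lambda>i. v (e i))"
      if "(f, c) \<in> F" for f c using that by (rule eig')
  qed (use that in auto)
qed

text \<open>By the eigenfunction property \<open>\<theta> (inv x)\<close> is a common eigenfunction of all convolution operators with
  class functions \<open>f\<close>, with eigenvalues the pairings of \<open>f\<close> and \<open>\<theta>\<close>. A character that yields these eigenvalues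
  is a multiple of \<open>\<theta>\<close>.\<close>

lemma spherical_imp_irr_character:
  assumes \<theta>: "spherical \<theta>"
  obtains \<chi> where "\<chi> \<in> irr_characters G" "\<And>g. g \<in> carrier G \<Longrightarrow> \<chi> g = \<chi> \<one> * \<theta> g"
proof -
  define F where "F = {(f, pairing f \<theta>) | f. class_function f}"
  have "conv f (\<lambda>g. \<theta> (inv g)) x = c * \<theta> (inv x)" if "(f, c) \<in> F" "x \<in> carrier G" for f c x
  proof -
    have f: "class_function f" and c: "c = pairing f \<theta>" using that(1) by (auto simp: F_def)
    have "conv f (\<lambda>g. \<theta> (inv g)) x = (\<Sum>y\<in>carrier G. f y * \<theta> (inv x \<otimes> y))"
      using that(2) by (simp add: conv_def inv_mult_group)
    thus ?thesis using spherical_eigenfunction[OF \<theta> f, of "inv x"] that(2) c by simp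
  qed
  moreover have "\<theta> (inv \<one>) \<noteq> 0" using spherical_one[OF \<theta>] by simp
  ultimately obtain \<chi> where \<chi>: "\<chi> \<in> irr_characters G" "\<And>f c. (f, c) \<in> F \<Longrightarrow> pairing f \<chi> = \<chi> \<one> * c"
    using central_eigenfunction_imp_irr_character[of \<one> "\<lambda>g. \<theta> (inv g)" F] by (auto simp: F_def)
  have "\<chi> g = \<chi> \<one> * \<theta> g" if g: "g \<in> carrier G" for g
  proof -
    have "pairing (class_sum g) \<chi> = \<chi> \<one> * pairing (class_sum g) \<theta>"
      using class_function_class_sum[OF g] by (intro \<chi>(2)) (auto simp: F_def)
    thus ?thesis
      using conj_class_self[OF g]
      by (auto simp: pairing_class_sum[OF g] spherical_class_function[OF \<theta>] irr_character_class_function[OF \<chi>(1)])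
  qed
  thus ?thesis using that \<chi>(1) by blast
qed

lemma irr_character_inv:
  assumes \<chi>: "\<chi> \<in> irr_characters G" and x: "x \<in> carrier G"
  shows "\<chi> (inv x) = cnj (\<chi> x)"
proof -
  obtain n where n: "\<chi> \<one> = of_nat n" using \<chi> by (metis irr_character_cases)
  show ?thesis
    using spherical_inv[OF irr_character_spherical[OF \<chi>] x] irr_character_degree_neq_0[OF \<chi>] n by simp
qed

text \<open>For a finite set \<open>F\<close> of irreducible characters let \<open>z\<close> be the coefficient function of the sum of
  their central idempotents. Orthogonality gives \<open>\<Sum> \<bar>z g\<bar>\<^sup>2 = z \<one>\<close>, whence \<open>z \<one> \<le> 1\<close>; and
  every character contributes at least \<open>1 / |G|\<close> to \<open>z \<one>\<close>.\<close>

lemma finite_irr_characters: "finite (irr_characters G)"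
proof (rule finite_if_finite_subsets_card_bdd[THEN conjunct1])
  fix F assume F: "F \<subseteq> irr_characters G" "finite F"
  let ?N = "of_nat (Coset.order G) :: complex"
  have "\<forall>\<chi>. \<exists>n. \<chi> \<in> F \<longrightarrow> \<chi> \<one> = of_nat n \<and> n > 0"
    using F(1) by (meson irr_character_cases subsetD)
  then obtain n where n: "\<And>\<chi>. \<chi> \<in> F \<Longrightarrow> \<chi> \<one> = of_nat (n \<chi>)" "\<And>\<chi>. \<chi> \<in> F \<Longrightarrow> n \<chi> > 0"
    by metis
  define z where "z g = (\<Sum>\<chi>\<in>F. \<chi> \<one> * \<chi> g) / ?N" for g
  define a where "a = (\<Sum>\<chi>\<in>F. real (n \<chi> * n \<chi>)) / Coset.order G"
  have z1: "z \<one> = of_real a" by (simp add: z_def a_def n(1) cong: sum.cong)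
  have zinv: "z (inv g) = cnj (z g)" if "g \<in> carrier G" for g
    using F(1) that by (auto simp: z_def irr_character_inv n(1) intro!: sum.cong)
  have "(\<Sum>g\<in>carrier G. z g * z (inv g)) =
      (\<Sum>g\<in>carrier G. \<Sum>\<chi>\<in>F. \<Sum>\<psi>\<in>F. \<chi> \<one> * \<psi> \<one> * (\<chi> g * \<psi> (inv g))) / (?N * ?N)"
    by (simp add: z_def sum_product sum_divide_distrib mult_ac)
  also have "(\<Sum>g\<in>carrier G. \<Sum>\<chi>\<in>F. \<Sum>\<psi>\<in>F. \<chi> \<one> * \<psi> \<one> * (\<chi> g * \<psi> (inv g))) =
      (\<Sum>\<chi>\<in>F. \<Sum>g\<in>carrier G. \<Sum>\<psi>\<in>F. \<chi> \<one> * \<psi> \<one> * (\<chi> g * \<psi> (inv g)))"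
    by (rule sum.swap)
  also have "\<dots> = (\<Sum>\<chi>\<in>F. \<Sum>\<psi>\<in>F. \<chi> \<one> * \<psi> \<one> * pairing \<chi> (\<lambda>g. \<psi> (inv g)))"
    unfolding pairing_def sum_distrib_left by (intro sum.cong refl sum.swap)
  also have "\<dots> = (\<Sum>\<chi>\<in>F. \<Sum>\<psi>\<in>F. if \<chi> = \<psi> then \<chi> \<one> * \<psi> \<one> * ?N else 0)"
    using F(1) by (intro sum.cong refl) (simp add: subset_eq irr_character_orthogonal)
  also have "\<dots> = (\<Sum>\<chi>\<in>F. \<chi> \<one> * \<chi> \<one>) * ?N" using F(2) by (simp add: sum_distrib_right)
  also have "\<dots> / (?N * ?N) = z \<one>" by (simp add: z_def)
  finally have "(\<Sum>g\<in>carrier G. z g * z (inv g)) = of_real a" using z1 by simp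
  moreover have "(\<Sum>g\<in>carrier G. z g * z (inv g)) = of_real (\<Sum>g\<in>carrier G. (cmod (z g))\<^sup>2)"
    by (simp add: zinv complex_norm_square del: of_real_power)
  ultimately have sq: "(\<Sum>g\<in>carrier G. (cmod (z g))\<^sup>2) = a" by (metis of_real_eq_iff)
  have "(cmod (z \<one>))\<^sup>2 \<le> (\<Sum>g\<in>carrier G. (cmod (z g))\<^sup>2)" by (rule member_le_sum) auto
  hence "a\<^sup>2 \<le> a" unfolding sq z1 by simp
  hence "a \<le> 1" by (cases "a \<le> 0") (auto simp: power2_eq_square mult_le_cancel_left2)
  hence "(\<Sum>\<chi>\<in>F. real (n \<chi> * n \<chi>)) \<le> Coset.order G"
    using order_pos by (simp add: a_def field_simps)
  moreover have "real (card F) \<le> (\<Sum>\<chi>\<in>F. real (n \<chi> * n \<chi>))"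
  proof -
    have "(\<Sum>\<chi>\<in>F. 1) \<le> (\<Sum>\<chi>\<in>F. real (n \<chi> * n \<chi>))"
      using n(2) by (intro sum_mono) (metis Suc_leI mult_pos_pos of_nat_1 of_nat_mono One_nat_def)
    thus ?thesis by simp
  qed
  ultimately show "card F \<le> Coset.order G" by linarith
qed

text \<open>Otherwise the complement \<open>z\<close> of the sum of the central idempotents would be a nonzero element of
  the group algebra killed by all of them. An irreducible subspace of the annihilator of the
  idempotents would have a character that is not in the list.\<close>

lemma regular_character:
  assumes x: "x \<in> carrier G"
  shows "(\<Sum>\<chi>\<in>irr_characters G. \<chi> \<one> * \<chi> x) = of_nat (Coset.order G) * of_bool (x = \<one>)"
proof (rule ccontr)
  let ?I = "irr_characters G" and ?N = "of_nat (Coset.order G) :: complex"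
  assume contra: "(\<Sum>\<chi>\<in>?I. \<chi> \<one> * \<chi> x) \<noteq> ?N * of_bool (x = \<one>)"
  define z where "z y = ?N * of_bool (y = \<one>) - (\<Sum>\<psi>\<in>?I. \<psi> \<one> * \<psi> (inv y))" for y
  have nz: "z (inv x) \<noteq> 0" using contra x by (auto simp: z_def)
  define F where "F = {((\<lambda>g. \<chi> (inv g)), 0::complex) | \<chi>. \<chi> \<in> ?I}"
  have conv0: "conv f z y = c * z y" if fc: "(f, c) \<in> F" and y: "y \<in> carrier G" for f c y
  proof -
    obtain \<chi> where \<chi>: "\<chi> \<in> ?I" "f = (\<lambda>g. \<chi> (inv g))" "c = 0"
      using fc unfolding F_def by blast
    have delta: "(\<Sum>u\<in>carrier G. \<chi> (inv u) * of_bool (inv u \<otimes> y = \<one>)) = \<chi> (inv y)"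
    proof -
      have "(\<Sum>u\<in>carrier G. \<chi> (inv u) * of_bool (inv u \<otimes> y = \<one>)) = (\<Sum>u\<in>carrier G. if u = y then \<chi> (inv u) else 0)"
        using y by (intro sum.cong refl) (auto dest: inv_equality)
      thus ?thesis using y by simp
    qed
    have inner: "(\<Sum>u\<in>carrier G. \<chi> (inv u) * \<psi> (inv y \<otimes> u)) = (if \<chi> = \<psi> then ?N * \<chi> (inv y) / \<chi> \<one> else 0)"
      if \<psi>: "\<psi> \<in> ?I" for \<psi>
    proof -
      note nz = irr_character_degree_neq_0[OF \<psi>]
      have "(\<Sum>u\<in>carrier G. \<chi> (inv u) * \<psi> (inv y \<otimes> u)) =
          \<psi> \<one> * (\<Sum>u\<in>carrier G. \<chi> (inv u) * (\<psi> (inv y \<otimes> u) / \<psi> \<one>))"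
        using nz by (simp add: sum_distrib_left)
      also have "\<dots> = \<psi> \<one> * (\<psi> (inv y) / \<psi> \<one> * pairing (\<lambda>u. \<chi> (inv u)) (\<lambda>g. \<psi> g / \<psi> \<one>))"
        using y by (subst spherical_eigenfunction[OF irr_character_spherical[OF \<psi>]
            class_function_inv[OF irr_character_class_function[OF \<chi>(1)]]]) auto
      also have "pairing (\<lambda>u. \<chi> (inv u)) (\<lambda>g. \<psi> g / \<psi> \<one>) = pairing \<psi> (\<lambda>g. \<chi> (inv g)) / \<psi> \<one>"
        by (simp add: pairing_def sum_divide_distrib mult.commute)
      also have "pairing \<psi> (\<lambda>g. \<chi> (inv g)) = (if \<chi> = \<psi> then ?N else 0)"
        by (subst irr_character_orthogonal[OF \<psi> \<chi>(1)]) auto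
      finally show ?thesis using nz by auto
    qed
    have "conv f z y = (\<Sum>u\<in>carrier G. \<chi> (inv u) * (?N * of_bool (inv u \<otimes> y = \<one>)
        - (\<Sum>\<psi>\<in>?I. \<psi> \<one> * \<psi> (inv y \<otimes> u))))"
      using y by (simp add: conv_def \<chi>(2) z_def inv_mult_group)
    also have "\<dots> = ?N * (\<Sum>u\<in>carrier G. \<chi> (inv u) * of_bool (inv u \<otimes> y = \<one>))
        - (\<Sum>u\<in>carrier G. \<Sum>\<psi>\<in>?I. \<psi> \<one> * (\<chi> (inv u) * \<psi> (inv y \<otimes> u)))"
      by (simp add: right_diff_distrib sum_subtractf sum_distrib_left mult_ac
          del: sum_mult_of_bool_eq sum_of_bool_mult_eq)
    also have "\<dots> = ?N * \<chi> (inv y) - (\<Sum>\<psi>\<in>?I. \<Sum>u\<in>carrier G. \<psi> \<one> * (\<chi> (inv u) * \<psi> (inv y \<otimes> u)))"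
      unfolding delta by (subst sum.swap) (rule refl)
    also have "\<dots> = ?N * \<chi> (inv y) - (\<Sum>\<psi>\<in>?I. \<psi> \<one> * (if \<chi> = \<psi> then ?N * \<chi> (inv y) / \<chi> \<one> else 0))"
      by (simp add: sum_distrib_left[symmetric] inner)
    also have "(\<Sum>\<psi>\<in>?I. \<psi> \<one> * (if \<chi> = \<psi> then ?N * \<chi> (inv y) / \<chi> \<one> else 0)) =
        (\<Sum>\<psi>\<in>?I. if \<chi> = \<psi> then ?N * \<chi> (inv y) else 0)"
      using irr_character_degree_neq_0 by (intro sum.cong refl) auto
    also have "?N * \<chi> (inv y) - \<dots> = 0" using finite_irr_characters \<chi>(1) by simp
    finally show ?thesis using \<chi>(3) by simp
  qed
  have cfF: "class_function f" if "(f, c) \<in> F" for f c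
    using that class_function_inv irr_character_class_function by (auto simp: F_def)
  obtain \<psi> where \<psi>: "\<psi> \<in> ?I" "\<And>f c. (f, c) \<in> F \<Longrightarrow> pairing f \<psi> = \<psi> \<one> * c"
    by (rule central_eigenfunction_imp_irr_character[of "inv x" z F]) (use x nz conv0 cfF in blast)+
  have "pairing (\<lambda>g. \<psi> (inv g)) \<psi> = 0"
    using \<psi>(2)[of "\<lambda>g. \<psi> (inv g)" 0] \<psi>(1) by (auto simp: F_def)
  moreover have "pairing (\<lambda>g. \<psi> (inv g)) \<psi> = ?N"
    using irr_character_norm[OF \<psi>(1)] by (simp add: pairing_def mult.commute)
  ultimately show False by simp
qed

text \<open>Fourier inversion: evaluate the regular character at \<open>inv x \<otimes> g\<close> and sum against \<open>f\<close>.\<close>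

lemma class_function_expansion:
  assumes f: "class_function f" and x: "x \<in> carrier G"
  shows "of_nat (Coset.order G) * f x = (\<Sum>\<chi>\<in>irr_characters G. \<chi> (inv x) * pairing f \<chi>)"
proof -
  let ?I = "irr_characters G" and ?N = "of_nat (Coset.order G) :: complex"
  have "(\<Sum>\<chi>\<in>?I. \<chi> (inv x) * pairing f \<chi>) = (\<Sum>\<chi>\<in>?I. \<Sum>g\<in>carrier G. f g * (\<chi> \<one> * \<chi> (inv x \<otimes> g)))"
  proof (rule sum.cong[OF refl])
    fix \<chi> assume \<chi>: "\<chi> \<in> ?I"
    have "(\<Sum>g\<in>carrier G. f g * (\<chi> \<one> * \<chi> (inv x \<otimes> g))) =
        \<chi> \<one> * \<chi> \<one> * (\<Sum>g\<in>carrier G. f g * (\<chi> (inv x \<otimes> g) / \<chi> \<one>))"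
      using irr_character_degree_neq_0[OF \<chi>] by (simp add: sum_distrib_left mult_ac)
    also have "\<dots> = \<chi> \<one> * \<chi> \<one> * (\<chi> (inv x) / \<chi> \<one> * pairing f (\<lambda>g. \<chi> g / \<chi> \<one>))"
      using x by (subst spherical_eigenfunction[OF irr_character_spherical[OF \<chi>] f]) auto
    also have "pairing f (\<lambda>g. \<chi> g / \<chi> \<one>) = pairing f \<chi> / \<chi> \<one>"
      by (simp add: pairing_def sum_divide_distrib)
    finally show "\<chi> (inv x) * pairing f \<chi> = (\<Sum>g\<in>carrier G. f g * (\<chi> \<one> * \<chi> (inv x \<otimes> g)))"
      using irr_character_degree_neq_0[OF \<chi>] by simp
  qed
  also have "\<dots> = (\<Sum>g\<in>carrier G. f g * (\<Sum>\<chi>\<in>?I. \<chi> \<one> * \<chi> (inv x \<otimes> g)))"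
    unfolding sum_distrib_left by (rule sum.swap)
  also have "\<dots> = (\<Sum>g\<in>carrier G. if g = x then ?N * f g else 0)"
  proof (rule sum.cong[OF refl])
    fix g assume g: "g \<in> carrier G"
    have "inv x \<otimes> g = \<one> \<longleftrightarrow> g = x" using x g by (metis inv_mult_cancel(2) l_inv r_one)
    thus "f g * (\<Sum>\<chi>\<in>?I. \<chi> \<one> * \<chi> (inv x \<otimes> g)) = (if g = x then ?N * f g else 0)"
      using x g by (simp add: regular_character)
  qed
  also have "\<dots> = ?N * f x" using x by simp
  finally show ?thesis ..
qed

lemma column_orthogonality:
  assumes g: "g \<in> carrier G" and x: "x \<in> carrier G"
  shows "of_nat (card (conj_class g)) * (\<Sum>\<chi>\<in>irr_characters G. \<chi> g * \<chi> (inv x)) =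
    of_nat (Coset.order G) * of_bool (x \<in> conj_class g)"
proof -
  have "of_nat (Coset.order G) * of_bool (x \<in> conj_class g) =
      (\<Sum>\<chi>\<in>irr_characters G. \<chi> (inv x) * (of_nat (card (conj_class g)) * \<chi> g))"
    using class_function_expansion[OF class_function_class_sum[OF g] x]
    by (simp add: class_sum_def[of g x] pairing_class_sum[OF g irr_character_class_function])
  thus ?thesis by (simp add: sum_distrib_left mult_ac)
qed

lemma class_function_eqI:
  assumes "class_function f" "class_function h" and x: "x \<in> carrier G"
    and eq: "\<And>\<theta>. spherical \<theta> \<Longrightarrow> pairing f \<theta> = pairing h \<theta>"
  shows "f x = h x"
proof -
  have "pairing f \<chi> = pairing h \<chi>" if \<chi>: "\<chi> \<in> irr_characters G" for \<chi>
  proof -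
    have "pairing f (\<lambda>g. \<chi> g / \<chi> \<one>) = pairing h (\<lambda>g. \<chi> g / \<chi> \<one>)"
      by (rule eq[OF irr_character_spherical[OF \<chi>]])
    thus ?thesis
      using irr_character_degree_neq_0[OF \<chi>] by (simp add: pairing_def sum_divide_distrib[symmetric])
  qed
  hence "of_nat (Coset.order G) * f x = of_nat (Coset.order G) * h x"
    unfolding class_function_expansion[OF assms(1) x] class_function_expansion[OF assms(2) x] by simp
  thus ?thesis by simp
qed

end

section \<open>The centre of the integral group ring\<close>

context finite_grp
begin

definition center :: "('a \<Rightarrow> int) set" where
  "center = {f. (\<forall>x. x \<notin> carrier G \<longrightarrow> f x = 0) \<and> class_function f}"

text \<open>The product of the group ring, written so that it vanishes outside the group.\<close>

definition center_mult :: "('a \<Rightarrow> int) \<Rightarrow> ('a \<Rightarrow> int) \<Rightarrow> 'a \<Rightarrow> int" where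
  "center_mult f h = (\<lambda>x. if x \<in> carrier G then conv f h x else 0)"

lemma centerI:
  "\<lbrakk>\<And>x. x \<notin> carrier G \<Longrightarrow> f x = 0; class_function f\<rbrakk> \<Longrightarrow> f \<in> center"
  by (simp add: center_def)

lemma center_class_function: "f \<in> center \<Longrightarrow> class_function f"
  by (simp add: center_def)

lemma center_outside: "\<lbrakk>f \<in> center; x \<notin> carrier G\<rbrakk> \<Longrightarrow> f x = 0"
  by (simp add: center_def)

lemma center_eqI:
  assumes "f \<in> center" "h \<in> center" "\<And>x. x \<in> carrier G \<Longrightarrow> f x = h x"
  shows "f = h"
proof
  fix x show "f x = h x" using assms by (cases "x \<in> carrier G") (auto simp: center_def)
qed

lemma of_int_class_function:
  "f \<in> center \<Longrightarrow> class_function (\<lambda>x. complex_of_int (f x))"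
  by (rule class_function_compose[OF center_class_function])

lemma class_sum_center [simp, intro]: "g \<in> carrier G \<Longrightarrow> class_sum g \<in> center"
  using conj_class_subset[of g]
  by (intro centerI class_function_class_sum) (auto simp: class_sum_def)

lemma of_int_class_sum [simp]: "(\<lambda>x. complex_of_int (class_sum g x)) = class_sum g"
  by (simp add: class_sum_def fun_eq_iff)

lemma center_add [intro]:
  "\<lbrakk>f \<in> center; h \<in> center\<rbrakk> \<Longrightarrow> (\<lambda>x. f x + h x) \<in> center"
  by (simp add: center_def class_function_def)

lemma center_scale [intro]: "f \<in> center \<Longrightarrow> (\<lambda>x. n * f x) \<in> center"
  by (simp add: center_def class_function_def)

lemma conv_class_function:
  assumes f: "class_function f" and h: "class_function h"
  shows "class_function (conv f h)"
  unfolding class_function_def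
proof (intro ballI)
  fix x k assume xk: "x \<in> carrier G" "k \<in> carrier G"
  have "conv f h (conj_by k x) = (\<Sum>y\<in>carrier G. f (conj_by k y) * h (inv (conj_by k y) \<otimes> conj_by k x))"
    unfolding conv_def using xk(2) by (rule sum_conj_by[symmetric])
  also have "\<dots> = (\<Sum>y\<in>carrier G. f y * h (inv y \<otimes> x))"
    using xk by (intro sum.cong refl)
      (simp add: class_functionD[OF f] conj_by_inv conj_by_mult[symmetric] class_functionD[OF h])
  finally show "conv f h (conj_by k x) = conv f h x" by (simp add: conv_def)
qed

lemma conv_commute:
  assumes f: "class_function f" and x: "x \<in> carrier G"
  shows "conv h f x = conv f h x"
proof -
  have "conv h f x = (\<Sum>y\<in>carrier G. h y * f (x \<otimes> inv y))"
    unfolding conv_def using x by (intro sum.cong refl) (simp add: class_function_mult_commute[OF f])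
  also have "\<dots> = (\<Sum>u\<in>carrier G. h (u \<otimes> x) * f (x \<otimes> inv (u \<otimes> x)))"
    using x by (rule sum_mult_right[symmetric])
  also have "\<dots> = (\<Sum>u\<in>carrier G. h (u \<otimes> x) * f (inv u))"
    using x by (intro sum.cong refl) (simp add: inv_mult_group)
  also have "\<dots> = (\<Sum>u\<in>carrier G. h (inv u \<otimes> x) * f u)"
    by (subst sum_inv[symmetric]) simp
  finally show ?thesis by (simp add: conv_def mult.commute)
qed

lemma center_mult_closed [intro]:
  assumes "f \<in> center" "h \<in> center"
  shows "center_mult f h \<in> center"
  using conv_class_function[OF assms[THEN center_class_function]]
  by (auto simp: center_def center_mult_def class_function_def)

lemma of_int_conv:
  "complex_of_int (conv f h x) = conv (\<lambda>x. of_int (f x)) (\<lambda>x. of_int (h x)) x"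
  by (simp add: conv_def)

lemma pairing_center_mult:
  assumes "spherical \<theta>" "h \<in> center"
  shows "pairing (\<lambda>x. of_int (center_mult f h x)) \<theta> =
    pairing (\<lambda>x. of_int (f x)) \<theta> * pairing (\<lambda>x. of_int (h x)) \<theta>"
proof -
  have "pairing (\<lambda>x. of_int (center_mult f h x)) \<theta> = pairing (conv (\<lambda>x. of_int (f x)) (\<lambda>x. of_int (h x))) \<theta>"
    by (simp add: pairing_def center_mult_def of_int_conv)
  thus ?thesis using pairing_conv_spherical[OF assms(1) of_int_class_function[OF assms(2)]] by simp
qed

lemma group_ring_mult_eq_conv:
  assumes f: "\<And>x. x \<notin> carrier G \<Longrightarrow> f x = 0" and h: "\<And>x. x \<notin> carrier G \<Longrightarrow> h x = 0"
  shows "f \<otimes>\<^bsub>integral_group_ring G\<^esub> h = center_mult f h"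
proof
  fix x
  have "(f \<otimes>\<^bsub>integral_group_ring G\<^esub> h) x =
      (\<Sum>y\<in>carrier G. \<Sum>z\<in>carrier G. if y \<otimes> z = x then f y * h z else 0)"
    using f h by (intro integral_group_ring_mult) auto
  also have "\<dots> = center_mult f h x"
  proof (cases "x \<in> carrier G")
    case True
    have "(\<Sum>z\<in>carrier G. if y \<otimes> z = x then f y * h z else 0) = f y * h (inv y \<otimes> x)"
      if y: "y \<in> carrier G" for y
    proof -
      have "(\<Sum>z\<in>carrier G. if y \<otimes> z = x then f y * h z else 0) =
          (\<Sum>z\<in>carrier G. if z = inv y \<otimes> x then f y * h z else 0)"
        using y True by (intro sum.cong refl) auto
      thus ?thesis using y True by simp
    qed
    thus ?thesis using True by (simp add: center_mult_def conv_def)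
  next
    case False
    hence "(\<Sum>y\<in>carrier G. \<Sum>z\<in>carrier G. if y \<otimes> z = x then f y * h z else 0) = 0"
      by (intro sum.neutral ballI) auto
    thus ?thesis using False by (simp add: center_mult_def)
  qed
  finally show "(f \<otimes>\<^bsub>integral_group_ring G\<^esub> h) x = center_mult f h x" .
qed

lemma carrier_integral_group_ring:
  "f \<in> carrier (integral_group_ring G) \<longleftrightarrow> (\<forall>x. x \<notin> carrier G \<longrightarrow> f x = 0)"
proof -
  have "finite {x. f x \<noteq> 0}" if "{x. f x \<noteq> 0} \<subseteq> carrier G"
    using that fin finite_subset by blast
  thus ?thesis by (auto simp: integral_group_ring_def)
qed

text \<open>Commuting with the group elements \<open>k\<close> forces the coefficients to be constant on classes.\<close>

lemma carrier_ring_center: "carrier (ring_center (integral_group_ring G)) = center"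
proof (intro equalityI subsetI)
  fix f assume "f \<in> carrier (ring_center (integral_group_ring G))"
  hence out: "\<And>x. x \<notin> carrier G \<Longrightarrow> f x = 0"
    and comm: "\<And>h. h \<in> carrier (integral_group_ring G) \<Longrightarrow>
      f \<otimes>\<^bsub>integral_group_ring G\<^esub> h = h \<otimes>\<^bsub>integral_group_ring G\<^esub> f"
    by (auto simp: ring_center_def carrier_integral_group_ring)
  show "f \<in> center"
  proof (rule centerI[OF out])
    show "class_function f"
      unfolding class_function_def
    proof (intro ballI)
      fix g k assume gk: "g \<in> carrier G" "k \<in> carrier G"
      define d :: "'a \<Rightarrow> int" where "d x = of_bool (x = k)" for x
      have d: "\<And>x. x \<notin> carrier G \<Longrightarrow> d x = 0" using gk(2) by (auto simp: d_def)
      have "center_mult f d = center_mult d f"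
        using comm[of d] group_ring_mult_eq_conv[OF out d] group_ring_mult_eq_conv[OF d out] d
        by (simp add: carrier_integral_group_ring)
      hence eq: "conv f d (k \<otimes> g) = conv d f (k \<otimes> g)"
        using gk by (metis center_mult_def m_closed)
      have "conv d f (k \<otimes> g) = (\<Sum>y\<in>carrier G. if y = k then f (inv k \<otimes> (k \<otimes> g)) else 0)"
        unfolding conv_def d_def by (intro sum.cong refl) auto
      hence 1: "conv d f (k \<otimes> g) = f g" using gk by simp
      have "inv y \<otimes> (k \<otimes> g) = k \<longleftrightarrow> y = conj_by k g" if y: "y \<in> carrier G" for y
      proof
        assume "inv y \<otimes> (k \<otimes> g) = k"
        hence "k \<otimes> g = y \<otimes> k" using y gk by (metis inv_mult_cancel(2) m_closed)
        thus "y = conj_by k g" using y gk by (simp add: conj_by_def m_assoc)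
      next
        assume "y = conj_by k g"
        hence "k \<otimes> g = y \<otimes> k" using gk by (simp add: conj_by_def m_assoc)
        thus "inv y \<otimes> (k \<otimes> g) = k" using y gk by simp
      qed
      hence "conv f d (k \<otimes> g) = (\<Sum>y\<in>carrier G. if y = conj_by k g then f y else 0)"
        unfolding conv_def d_def by (intro sum.cong refl) auto
      hence 2: "conv f d (k \<otimes> g) = f (conj_by k g)" using gk by simp
      show "f (conj_by k g) = f g" using eq 1 2 by simp
    qed
  qed
next
  fix f assume f: "f \<in> center"
  have "f \<otimes>\<^bsub>integral_group_ring G\<^esub> h = h \<otimes>\<^bsub>integral_group_ring G\<^esub> f"
    if h: "h \<in> carrier (integral_group_ring G)" for h
    using h center_outside[OF f] conv_commute[OF center_class_function[OF f]]
    by (simp add: carrier_integral_group_ring group_ring_mult_eq_conv) (auto simp: center_mult_def)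
  thus "f \<in> carrier (ring_center (integral_group_ring G))"
    using center_outside[OF f] by (simp add: ring_center_def carrier_integral_group_ring)
qed

lemma ring_center_simps:
  "\<lbrakk>f \<in> center; h \<in> center\<rbrakk> \<Longrightarrow>
     f \<otimes>\<^bsub>ring_center (integral_group_ring G)\<^esub> h = center_mult f h"
  "f \<oplus>\<^bsub>ring_center (integral_group_ring G)\<^esub> h = (\<lambda>x. f x + h x)"
  "\<one>\<^bsub>ring_center (integral_group_ring G)\<^esub> = class_sum \<one>"
  using group_ring_mult_eq_conv[of f h] center_outside
  by (auto simp: ring_center_def) (auto simp: integral_group_ring_def class_sum_def fun_eq_iff)

text \<open>The class sums are a basis of the centre; dividing by the size of the class compensates for summing over
  all elements of it.\<close>

lemma additive_class_sum_expansion: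
  fixes A :: "('a \<Rightarrow> int) \<Rightarrow> complex"
  assumes add: "\<And>f h. \<lbrakk>f \<in> center; h \<in> center\<rbrakk> \<Longrightarrow> A (\<lambda>x. f x + h x) = A f + A h"
    and f: "f \<in> center"
  shows "A f = (\<Sum>g\<in>carrier G. of_int (f g) * (A (class_sum g) / of_nat (card (conj_class g))))"
proof -
  have zero_mem: "(\<lambda>x. 0) \<in> center" by (simp add: center_def class_function_def)
  have A0: "A (\<lambda>x. 0) = 0" using add[OF zero_mem zero_mem] by simp
  have scale: "A (\<lambda>x. n * h x) = of_int n * A h" if h: "h \<in> center" for n h
  proof (induction n rule: int_induct[where k = 0])
    case base show ?case by (simp add: A0)
  next
    case (step1 i)
    thus ?case using add[OF center_scale[OF h, of i] h] by (simp add: algebra_simps)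
  next
    case (step2 i)
    thus ?case using add[OF center_scale[OF h, of "i - 1"] h] by (simp add: algebra_simps)
  qed
  define B where "B f = (\<Sum>g\<in>carrier G. of_int (f g) * (A (class_sum g) / of_nat (card (conj_class g))))" for f
  have B_class: "B (class_sum g) = A (class_sum g)" if g: "g \<in> carrier G" for g
  proof -
    have "B (class_sum g) = (\<Sum>x\<in>conj_class g. A (class_sum x) / of_nat (card (conj_class x)))"
      unfolding B_def using sum_class_sum[OF g, of "\<lambda>x. A (class_sum x) / of_nat (card (conj_class x))"]
      by (simp add: fun_cong[OF of_int_class_sum])
    also have "\<dots> = (\<Sum>x\<in>conj_class g. A (class_sum g) / of_nat (card (conj_class g)))"
    proof (rule sum.cong[OF refl])
      fix x assume "x \<in> conj_class g"
      hence "conj_class x = conj_class g" by (rule conj_class_eq[OF g])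
      moreover from this have "(class_sum x :: 'a \<Rightarrow> int) = class_sum g" by (simp add: class_sum_def fun_eq_iff)
      ultimately show "A (class_sum x) / of_nat (card (conj_class x)) = A (class_sum g) / of_nat (card (conj_class g))"
        by simp
    qed
    finally show ?thesis using conj_class_self[OF g] by auto
  qed
  have "A f = B f"
    using f
  proof (induction "card {x. f x \<noteq> 0}" arbitrary: f rule: less_induct)
    case (less f)
    show ?case
    proof (cases "\<exists>g\<in>carrier G. f g \<noteq> 0")
      case False
      hence "f = (\<lambda>x. 0)" using less.prems by (auto simp: center_def fun_eq_iff)
      thus ?thesis by (simp add: A0 B_def)
    next
      case True
      then obtain g where g: "g \<in> carrier G" "f g \<noteq> 0" by blast
      define f' where "f' x = f x + (- f g) * class_sum g x" for x
      have f': "f' \<in> center"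
        unfolding f'_def using less.prems g(1) by (intro center_add center_scale class_sum_center)
      have sub: "{x. f' x \<noteq> 0} \<subset> {x. f x \<noteq> 0}"
      proof
        show "{x. f' x \<noteq> 0} \<subseteq> {x. f x \<noteq> 0}"
          using class_function_on_class[OF center_class_function[OF less.prems] g(1)]
          by (auto simp: f'_def class_sum_def)
        have "g \<in> {x. f x \<noteq> 0} - {x. f' x \<noteq> 0}"
          using g conj_class_self[OF g(1)] by (simp add: f'_def class_sum_def)
        thus "{x. f' x \<noteq> 0} \<noteq> {x. f x \<noteq> 0}" by blast
      qed
      have "{x. f x \<noteq> 0} \<subseteq> carrier G" using less.prems by (auto simp: center_def)
      hence "finite {x. f x \<noteq> 0}" by (rule finite_subset) simp
      hence "card {x. f' x \<noteq> 0} < card {x. f x \<noteq> 0}" using sub by (rule psubset_card_mono)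
      from less.hyps[OF this f'] have IH: "A f' = B f'" .
      have feq: "f = (\<lambda>x. f' x + f g * class_sum g x)" by (simp add: f'_def)
      have "A f = A f' + of_int (f g) * A (class_sum g)"
        by (subst feq, subst add[OF f' center_scale[OF class_sum_center[OF g(1)]]])
          (simp add: scale[OF class_sum_center[OF g(1)]])
      moreover have "B f = B f' + of_int (f g) * B (class_sum g)"
        by (subst feq) (simp add: B_def algebra_simps sum.distrib sum_distrib_left)
      ultimately show ?thesis using IH B_class[OF g(1)] by simp
    qed
  qed
  thus ?thesis by (simp add: B_def)
qed

lemma spherical_const_1: "spherical (\<lambda>_. 1)"
  by (simp add: spherical_def Coset.order_def)

end

section \<open>Isomorphisms of centres\<close>

locale center_iso = G: finite_grp G + H: finite_grp H
  for G :: "('a, 'c) monoid_scheme" (structure) and H :: "('b, 'd) monoid_scheme" (structure) +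
  fixes \<phi> :: "('a \<Rightarrow> int) \<Rightarrow> 'b \<Rightarrow> int"
  assumes bij: "bij_betw \<phi> G.center H.center"
    and add: "\<lbrakk>f \<in> G.center; h \<in> G.center\<rbrakk> \<Longrightarrow>
      \<phi> (\<lambda>x. f x + h x) = (\<lambda>y. \<phi> f y + \<phi> h y)"
    and mult: "\<lbrakk>f \<in> G.center; h \<in> G.center\<rbrakk> \<Longrightarrow>
      \<phi> (G.center_mult f h) = H.center_mult (\<phi> f) (\<phi> h)"
    and one: "\<phi> (G.class_sum \<one>) = H.class_sum \<one>\<^bsub>H\<^esub>"
begin

definition \<psi> :: "('b \<Rightarrow> int) \<Rightarrow> 'a \<Rightarrow> int" where
  "\<psi> = inv_into G.center \<phi>"

lemma \<phi>_closed [simp, intro]: "f \<in> G.center \<Longrightarrow> \<phi> f \<in> H.center"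
  using bij by (auto simp: bij_betw_def)

lemma \<psi>_closed [simp, intro]: "f \<in> H.center \<Longrightarrow> \<psi> f \<in> G.center"
  using bij by (auto simp: bij_betw_def \<psi>_def inv_into_into)

lemma \<psi>_\<phi> [simp]: "f \<in> G.center \<Longrightarrow> \<psi> (\<phi> f) = f"
  using bij by (simp add: \<psi>_def bij_betw_inv_into_left)

lemma \<phi>_\<psi> [simp]: "f \<in> H.center \<Longrightarrow> \<phi> (\<psi> f) = f"
  using bij by (simp add: \<psi>_def bij_betw_inv_into_right)

lemma \<phi>_inj: "\<lbrakk>f \<in> G.center; h \<in> G.center; \<phi> f = \<phi> h\<rbrakk> \<Longrightarrow> f = h"
  using \<psi>_\<phi> by metis

lemma inverse: "center_iso H G \<psi>"
proof (unfold_locales, goal_cases)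
  case 1 show ?case unfolding \<psi>_def by (rule bij_betw_inv_into[OF bij])
next
  case (2 f h)
  show ?case
    using 2 by (intro \<phi>_inj G.center_add) (auto simp: add H.center_add)
next
  case (3 f h)
  show ?case
    using 3 by (intro \<phi>_inj G.center_mult_closed) (auto simp: mult H.center_mult_closed)
next
  case 4
  show ?case using one G.class_sum_center[OF G.one_closed] by (metis \<psi>_\<phi>)
qed

lemma expansion:
  assumes f: "f \<in> G.center"
  shows "complex_of_int (\<phi> f y) =
    (\<Sum>g\<in>carrier G. of_int (f g) * (of_int (\<phi> (G.class_sum g) y) / of_nat (card (G.conj_class g))))"
  using f by (intro G.additive_class_sum_expansion[where A = "\<lambda>f. complex_of_int (\<phi> f y)"]) (simp_all add: add)

lemma scale:
  assumes f: "f \<in> G.center"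
  shows "\<phi> (\<lambda>x. n * f x) = (\<lambda>y. n * \<phi> f y)"
proof
  fix y
  have "complex_of_int (\<phi> (\<lambda>x. n * f x) y) = of_int n * of_int (\<phi> f y)"
    unfolding expansion[OF f] expansion[OF G.center_scale[OF f]] by (simp add: sum_distrib_left mult_ac)
  also have "\<dots> = of_int (n * \<phi> f y)" by simp
  finally show "\<phi> (\<lambda>x. n * f x) y = n * \<phi> f y" by (simp only: of_int_eq_iff)
qed

text \<open>Spherical functions are the ring homomorphisms from the centre to the complex numbers, so
  they can be pulled back.\<close>

lemma pullback_spherical:
  assumes \<eta>: "H.spherical \<eta>"
  obtains \<theta> where "G.spherical \<theta>"
    "\<And>f. f \<in> G.center \<Longrightarrow>
       G.pairing (\<lambda>x. of_int (f x)) \<theta> = H.pairing (\<lambda>y. of_int (\<phi> f y)) \<eta>"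
proof -
  define A where "A f = H.pairing (\<lambda>y. of_int (\<phi> f y)) \<eta>" for f
  define \<theta> where "\<theta> g = A (G.class_sum g) / of_nat (card (G.conj_class g))" for g
  have pair: "G.pairing (\<lambda>x. of_int (f x)) \<theta> = A f" if f: "f \<in> G.center" for f
    unfolding G.pairing_def \<theta>_def using f
    by (intro G.additive_class_sum_expansion[symmetric])
      (auto simp: A_def add H.pairing_def algebra_simps sum.distrib)
  have "G.spherical \<theta>"
  proof (rule G.sphericalI)
    show "\<theta> \<one> = 1"
      using H.pairing_class_sum[OF H.one_closed H.spherical_class_function[OF \<eta>]] H.spherical_one[OF \<eta>]
      by (simp add: \<theta>_def A_def one)
    show "G.class_function \<theta>"
      unfolding G.class_function_def
    proof (intro ballI)
      fix g k assume gk: "g \<in> carrier G" "k \<in> carrier G"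
      hence "(G.class_sum (G.conj_by k g) :: 'a \<Rightarrow> int) = G.class_sum g"
        by (simp add: G.class_sum_eq_iff)
      thus "\<theta> (G.conj_by k g) = \<theta> g" using gk by (simp add: \<theta>_def)
    qed
    fix g h assume gh: "g \<in> carrier G" "h \<in> carrier G"
    have "G.pairing (G.conv (G.class_sum g) (G.class_sum h)) \<theta> =
        G.pairing (\<lambda>x. of_int (G.center_mult (G.class_sum g) (G.class_sum h) x)) \<theta>"
      by (simp add: G.pairing_def G.center_mult_def G.of_int_conv)
    also have "\<dots> = A (G.class_sum g) * A (G.class_sum h)"
      using gh H.pairing_center_mult[OF \<eta>] by (subst pair) (auto simp: A_def mult)
    also have "\<dots> = G.pairing (G.class_sum g) \<theta> * G.pairing (G.class_sum h) \<theta>"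
      using pair[OF G.class_sum_center[OF gh(1)]] pair[OF G.class_sum_center[OF gh(2)]] by simp
    finally show "G.pairing (G.conv (G.class_sum g) (G.class_sum h)) \<theta> =
        G.pairing (G.class_sum g) \<theta> * G.pairing (G.class_sum h) \<theta>" .
  qed
  thus ?thesis using that pair by (auto simp: A_def)
qed

end

context finite_grp
begin

definition center_star :: "('a \<Rightarrow> int) \<Rightarrow> 'a \<Rightarrow> int" where
  "center_star f = (\<lambda>x. if x \<in> carrier G then f (inv x) else 0)"

lemma center_star_closed [intro]:
  "f \<in> center \<Longrightarrow> center_star f \<in> center"
  using class_function_inv[OF center_class_function, of f]
  by (auto simp: center_def center_star_def class_function_def)

lemma pairing_center_star:
  assumes "spherical \<theta>"
  shows "pairing (\<lambda>x. of_int (center_star f x)) \<theta> = cnj (pairing (\<lambda>x. of_int (f x)) \<theta>)"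
proof -
  have "pairing (\<lambda>x. of_int (center_star f x)) \<theta> = (\<Sum>x\<in>carrier G. of_int (f x) * \<theta> (inv x))"
    unfolding pairing_def by (subst sum_inv[symmetric]) (simp add: center_star_def)
  thus ?thesis using spherical_inv[OF assms] by (simp add: pairing_def)
qed

end

context center_iso
begin

text \<open>Inversion of group elements corresponds to complex conjugation of all values of all
  homomorphisms to the complex numbers.\<close>

lemma star:
  assumes f: "f \<in> G.center"
  shows "\<phi> (G.center_star f) = H.center_star (\<phi> f)"
proof (rule H.center_eqI)
  fix y assume y: "y \<in> carrier H"
  have "complex_of_int (\<phi> (G.center_star f) y) = of_int (H.center_star (\<phi> f) y)"
  proof (rule H.class_function_eqI[OF _ _ y])
    show "H.class_function (\<lambda>y. complex_of_int (\<phi> (G.center_star f) y))"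
      "H.class_function (\<lambda>y. complex_of_int (H.center_star (\<phi> f) y))"
      using f by (auto intro!: H.of_int_class_function)
    fix \<eta> assume \<eta>: "H.spherical \<eta>"
    obtain \<theta> where \<theta>: "G.spherical \<theta>" "\<And>f. f \<in> G.center \<Longrightarrow>
       G.pairing (\<lambda>x. of_int (f x)) \<theta> = H.pairing (\<lambda>y. of_int (\<phi> f y)) \<eta>"
      using pullback_spherical[OF \<eta>] by blast
    show "H.pairing (\<lambda>y. complex_of_int (\<phi> (G.center_star f) y)) \<eta> =
        H.pairing (\<lambda>y. complex_of_int (H.center_star (\<phi> f) y)) \<eta>"
      using f by (simp add: \<theta>(2)[symmetric] G.center_star_closed H.pairing_center_star[OF \<eta>]
          G.pairing_center_star[OF \<theta>(1)])
  qed
  thus "\<phi> (G.center_star f) y = H.center_star (\<phi> f) y" by simp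
qed (use f in auto)

text \<open>Let \<open>\<theta>\<close> be the pullback of the augmentation and \<open>\<chi> = d \<theta>\<close> its irreducible character. The
  preimage \<open>y0\<close> of the sum of all elements of \<open>H\<close> spans the same line as \<open>\<chi>\<close>, say \<open>y0 = c \<theta>\<close>. Since
  \<open>\<chi>\<close> is integral and \<open>y0\<close> is primitive, \<open>d = m c\<close> with an integer \<open>m\<close>, and
  \<open>|H| = c \<Sum> \<theta>\<^sup>2 = c |G| / d\<^sup>2\<close>.\<close>

lemma augmentation_pullback:
  obtains \<chi> and d m :: nat where "\<chi> \<in> irr_characters G" "\<chi> \<one> = of_nat d" "d > 0" "m > 0"
    "card (carrier H) * d * m = card (carrier G)"
    "\<And>g. g \<in> carrier G \<Longrightarrow> \<chi> g \<in> \<int>"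
    "\<And>f. f \<in> G.center \<Longrightarrow>
       of_nat d * of_int (\<Sum>y\<in>carrier H. \<phi> f y) = G.pairing (\<lambda>x. of_int (f x)) \<chi>"
proof -
  obtain \<theta> where \<theta>: "G.spherical \<theta>" and pull: "\<And>f. f \<in> G.center \<Longrightarrow>
       G.pairing (\<lambda>x. of_int (f x)) \<theta> = of_int (\<Sum>y\<in>carrier H. \<phi> f y)"
    using pullback_spherical[OF H.spherical_const_1] by (auto simp: H.pairing_def)
  obtain \<chi> where \<chi>: "\<chi> \<in> irr_characters G" "\<And>g. g \<in> carrier G \<Longrightarrow> \<chi> g = \<chi> \<one> * \<theta> g"
    using G.spherical_imp_irr_character[OF \<theta>] by blast
  obtain d where d: "\<chi> \<one> = of_nat d" "d > 0" using \<chi>(1) by (metis G.irr_character_cases)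
  define u :: "'b \<Rightarrow> int" where "u y = of_bool (y \<in> carrier H)" for y
  have u: "u \<in> H.center" by (simp add: H.center_def u_def H.class_function_def)
  define y0 where "y0 = \<psi> u"
  have y0: "y0 \<in> G.center" "\<phi> y0 = u" using u by (simp_all add: y0_def)
  define c where "c = y0 \<one>"
  have card_class: "of_nat (card (G.conj_class g)) * \<theta> g = of_int (\<Sum>y\<in>carrier H. \<phi> (G.class_sum g) y)"
    if g: "g \<in> carrier G" for g
    using pull[OF G.class_sum_center[OF g]] G.pairing_class_sum[OF g G.spherical_class_function[OF \<theta>]]
    by simp
  have rat: "\<theta> g \<in> \<rat>" if g: "g \<in> carrier G" for g
  proof -
    have "\<theta> g = of_int (\<Sum>y\<in>carrier H. \<phi> (G.class_sum g) y) / of_nat (card (G.conj_class g))"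
    proof -
      have "complex_of_nat (card (G.conj_class g)) \<noteq> 0" using G.conj_class_self[OF g] by auto
      thus ?thesis unfolding card_class[OF g, symmetric] by simp
    qed
    thus ?thesis by (simp del: of_int_sum)
  qed
  have \<theta>inv: "\<theta> (inv g) = \<theta> g" if g: "g \<in> carrier G" for g
  proof -
    obtain r where "\<theta> g = of_rat r" using rat[OF g] by (auto elim: Rats_cases)
    hence "cnj (\<theta> g) = \<theta> g" by (cases r) (simp add: of_rat_rat)
    thus ?thesis using G.spherical_inv[OF \<theta> g] by simp
  qed
  \<comment> \<open>multiplication by a class sum acts on \<open>u\<close>, and so on \<open>y0\<close>, by a scalar; compare coefficients at the identity\<close>
  have y0_eq: "of_int (y0 g) = of_int c * \<theta> g" if g: "g \<in> carrier G" for g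
  proof -
    let ?g = "inv g"
    have g': "?g \<in> carrier G" using g by simp
    define n where "n = (\<Sum>y\<in>carrier H. \<phi> (G.class_sum ?g) y)"
    have "H.center_mult (\<phi> (G.class_sum ?g)) u = (\<lambda>y. n * u y)"
      by (auto simp: fun_eq_iff H.center_mult_def H.conv_def u_def n_def)
    hence "\<phi> (G.center_mult (G.class_sum ?g) y0) = \<phi> (\<lambda>x. n * y0 x)"
      using mult[OF G.class_sum_center[OF g'] y0(1)] scale[OF y0(1)] y0(2) by simp
    hence eq: "G.center_mult (G.class_sum ?g) y0 = (\<lambda>x. n * y0 x)"
      using y0(1) g' by (intro \<phi>_inj) auto
    have "int (card (G.conj_class ?g)) * y0 g = (\<Sum>x\<in>G.conj_class ?g. y0 (inv x))"
      using G.class_function_on_class[OF G.class_function_inv[OF G.center_class_function[OF y0(1)]] g'] g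
      by simp
    also have "\<dots> = G.center_mult (G.class_sum ?g) y0 \<one>"
      using G.sum_class_sum[OF g', of "\<lambda>x. y0 (inv x)"] by (simp add: G.center_mult_def G.conv_def)
    also have "\<dots> = n * c" by (simp add: eq c_def)
    finally have "of_nat (card (G.conj_class ?g)) * complex_of_int (y0 g) = of_int n * of_int c"
      by (metis of_int_mult of_int_of_nat_eq)
    also have "of_int n = of_nat (card (G.conj_class ?g)) * \<theta> ?g" using card_class[OF g'] by (simp add: n_def)
    finally show ?thesis using G.conj_class_self[OF g'] \<theta>inv[OF g] by auto
  qed
  define s where "s = G.pairing \<theta> \<theta>"
  have H_eq: "of_nat (card (carrier H)) = of_int c * s"
  proof -
    have "of_nat (card (carrier H)) = G.pairing (\<lambda>x. of_int (y0 x)) \<theta>"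
      using pull[OF y0(1)] by (simp add: y0(2) u_def)
    also have "\<dots> = of_int c * s" by (simp add: G.pairing_def y0_eq s_def sum_distrib_left mult_ac)
    finally show ?thesis .
  qed
  have G_eq: "of_nat (card (carrier G)) = of_nat d * of_nat d * s"
    using G.irr_character_norm[OF \<chi>(1)]
    by (simp add: G.pairing_def \<chi>(2) d(1) \<theta>inv s_def Coset.order_def sum_distrib_left mult_ac)
  have \<chi>int: "\<chi> g \<in> \<int>" if g: "g \<in> carrier G" for g
    using G.irr_character_algebraic_int[OF \<chi>(1) g] rat[OF g] \<chi>(2)[OF g] d(1)
    by (intro rational_algebraic_int_is_int) auto
  \<comment> \<open>the values of \<open>\<chi>\<close> are rational algebraic integers, so \<open>\<chi>\<close> is an element of the centre\<close>
  define v where "v g = (if g \<in> carrier G then \<lfloor>Re (\<chi> g)\<rfloor> else 0)" for g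
  have v_eq: "of_int (v g) = \<chi> g" if g: "g \<in> carrier G" for g
    using \<chi>int[OF g] g by (auto simp: v_def elim: Ints_cases)
  have v: "v \<in> G.center"
    using G.irr_character_class_function[OF \<chi>(1)]
    by (auto simp: G.center_def v_def G.class_function_def)
  have "(\<lambda>x. c * v x) = (\<lambda>x. int d * y0 x)"
  proof (rule G.center_eqI)
    fix x assume x: "x \<in> carrier G"
    have "complex_of_int (c * v x) = of_int (int d * y0 x)"
      using v_eq[OF x] y0_eq[OF x] \<chi>(2)[OF x] d(1) by simp
    thus "c * v x = int d * y0 x" by (simp only: of_int_eq_iff)
  qed (use v y0(1) in auto)
  from arg_cong[OF this, of \<phi>] have "c * \<phi> v \<one>\<^bsub>H\<^esub> = int d"
    by (simp add: scale[OF v] scale[OF y0(1)] y0(2) u_def fun_eq_iff split: if_splits)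
  then obtain m' where m': "int d = c * m'" by metis
  have "complex_of_int (int (card (carrier H)) * int d * m') = of_nat d * of_int (c * m') * s"
    using H_eq by (simp add: mult_ac)
  also have "\<dots> = of_int (int (card (carrier G)))" using G_eq by (simp add: m'[symmetric])
  finally have cards: "int (card (carrier H)) * int d * m' = int (card (carrier G))"
    by (simp only: of_int_eq_iff)
  have "m' > 0"
  proof (rule ccontr)
    assume "\<not> m' > 0"
    hence "int (card (carrier H)) * int d * m' \<le> 0" by (simp add: mult_nonneg_nonpos)
    thus False using cards G.order_pos by (simp add: Coset.order_def)
  qed
  hence "card (carrier H) * d * nat m' = card (carrier G)" using cards
    by (metis int_nat_eq nat_int of_nat_mult less_imp_le)
  moreover have "of_nat d * of_int (\<Sum>y\<in>carrier H. \<phi> f y) = G.pairing (\<lambda>x. of_int (f x)) \<chi>"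
    if f: "f \<in> G.center" for f
    unfolding pull[OF f, symmetric] by (simp add: G.pairing_def \<chi>(2) d(1) sum_distrib_left mult_ac)
  ultimately show ?thesis using that[OF \<chi>(1) d, of "nat m'"] \<open>m' > 0\<close> \<chi>int by simp
qed

lemma card_le: "card (carrier H) \<le> card (carrier G)"
proof -
  obtain d m :: nat where "d > 0" "m > 0" "card (carrier H) * d * m = card (carrier G)"
    using augmentation_pullback by metis
  moreover from this have "d * m \<ge> 1" by simp
  ultimately show ?thesis by (metis mult.assoc mult_le_mono2 nat_mult_1_right)
qed

lemma card_eq: "card (carrier H) = card (carrier G)"
  using card_le center_iso.card_le[OF inverse] by simp

end

locale normalized_center_iso = center_iso +
  assumes aug: "f \<in> G.center \<Longrightarrow> (\<Sum>y\<in>carrier H. \<phi> f y) = (\<Sum>x\<in>carrier G. f x)"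

text \<open>By symmetry \<open>|G| = |H|\<close>, so that \<open>d = 1\<close> in \<open>augmentation_pullback\<close>. The character is then a homomorphism
  to the integers, hence has values \<open>1\<close> and \<open>- 1\<close>, and multiplying coefficients by it is an automorphism of
  the centre that turns the pulled back augmentation into the augmentation.\<close>

lemma (in center_iso) exists_normalized: "\<exists>\<phi>'. normalized_center_iso G H \<phi>'"
proof -
  obtain \<chi> and d m :: nat where \<chi>: "\<chi> \<in> irr_characters G" "\<chi> \<one> = of_nat d" "d > 0" "m > 0"
    and cards: "card (carrier H) * d * m = card (carrier G)"
    and \<chi>int: "\<And>g. g \<in> carrier G \<Longrightarrow> \<chi> g \<in> \<int>"
    and pull: "\<And>f. f \<in> G.center \<Longrightarrow>
       of_nat d * of_int (\<Sum>y\<in>carrier H. \<phi> f y) = G.pairing (\<lambda>x. of_int (f x)) \<chi>"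
    using augmentation_pullback by metis
  have "card (carrier H) > 0" using H.order_pos by (simp add: Coset.order_def)
  moreover have "card (carrier H) * (d * m) = card (carrier H) * 1"
    using cards card_eq by (simp add: mult.assoc)
  ultimately have "d * m = 1" by (metis mult_left_cancel not_less_zero)
  hence d: "d = 1" by simp
  define u where "u g = \<lfloor>Re (\<chi> g)\<rfloor>" for g
  have u_eq: "of_int (u g) = \<chi> g" if g: "g \<in> carrier G" for g
    using \<chi>int[OF g] by (auto simp: u_def elim: Ints_cases)
  have u1: "u \<one> = 1" using \<chi>(2) by (simp add: u_def d)
  have u_mult: "u (g \<otimes> h) = u g * u h" if "g \<in> carrier G" "h \<in> carrier G" for g h
  proof -
    have "complex_of_int (u (g \<otimes> h)) = of_int (u g * u h)"
      using that G.linear_character_mult[OF \<chi>(1) _ that] \<chi>(2) d by (simp add: u_eq)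
    thus ?thesis by (simp only: of_int_eq_iff)
  qed
  have u_sq: "u g * u g = 1" if g: "g \<in> carrier G" for g
  proof -
    have "u g * u (inv g) = 1" using u_mult[of g "inv g"] g u1 by simp
    thus ?thesis by (auto simp: zmult_eq_1_iff)
  qed
  have u_class: "G.class_function u"
    using G.irr_character_class_function[OF \<chi>(1)] by (simp add: u_def G.class_function_def)
  define tw where "tw f = (\<lambda>x. u x * f x)" for f
  have tw: "tw f \<in> G.center" if "f \<in> G.center" for f
    using that u_class by (simp add: G.center_def tw_def G.class_function_def)
  have tw_tw: "tw (tw f) = f" if f: "f \<in> G.center" for f
  proof (rule G.center_eqI)
    fix x assume "x \<in> carrier G"
    thus "tw (tw f) x = f x" by (simp add: tw_def mult.assoc[symmetric] u_sq)
  qed (use f tw in auto)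
  have "normalized_center_iso G H (\<phi> \<circ> tw)"
  proof (unfold_locales, goal_cases)
    case 1
    have "bij_betw tw G.center G.center"
      by (rule bij_betw_byWitness[where f' = tw]) (auto simp: tw tw_tw)
    thus ?case using bij by (rule bij_betw_trans)
  next
    case (2 f h)
    thus ?case using add[OF tw tw, of f h] by (simp add: tw_def algebra_simps)
  next
    case (3 f h)
    have "tw (G.center_mult f h) = G.center_mult (tw f) (tw h)"
    proof
      fix x
      have summand: "u x * (f y * h (inv y \<otimes> x)) =
          u y * f y * (u (inv y \<otimes> x) * h (inv y \<otimes> x))"
        if "x \<in> carrier G" "y \<in> carrier G" for y
        using u_mult[of y "inv y \<otimes> x"] that by simp
      have "u x * G.conv f h x = G.conv (tw f) (tw h) x" if "x \<in> carrier G"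
        unfolding G.conv_def tw_def sum_distrib_left by (intro sum.cong refl summand that)
      thus "tw (G.center_mult f h) x = G.center_mult (tw f) (tw h) x"
        by (simp add: tw_def G.center_mult_def)
    qed
    thus ?case using mult[OF tw tw] 3 by simp
  next
    case 4
    have "tw (G.class_sum \<one>) = G.class_sum \<one>"
      using u1 by (auto simp: tw_def G.class_sum_def fun_eq_iff)
    thus ?case using one by simp
  next
    case (5 f)
    have "complex_of_int (\<Sum>y\<in>carrier H. \<phi> (tw f) y) = G.pairing (\<lambda>x. of_int (tw f x)) \<chi>"
      using pull[OF tw[OF 5]] d by simp
    also have "\<dots> = of_int (\<Sum>x\<in>carrier G. f x)"
    proof -
      have "complex_of_int (tw f x) * \<chi> x = of_int (f x)" if x: "x \<in> carrier G" for x
      proof -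
        have "complex_of_int (tw f x) * \<chi> x = of_int (u x * u x * f x)"
          using u_eq[OF x] by (simp add: tw_def mult_ac)
        thus ?thesis using u_sq[OF x] by simp
      qed
      thus ?thesis by (simp add: G.pairing_def)
    qed
    finally show ?case by (simp only: of_int_eq_iff o_apply)
  qed
  thus ?thesis by blast
qed

lemma (in normalized_center_iso) normalized_inverse: "normalized_center_iso H G \<psi>"
proof -
  interpret inv: center_iso H G \<psi> by (rule inverse)
  show ?thesis
  proof (unfold_locales, goal_cases)
    case (1 f)
    thus ?case using aug[of "\<psi> f"] by simp
  qed
qed

section \<open>Class sums in the upper central series\<close>

context finite_grp
begin

primrec upper_central :: "nat \<Rightarrow> 'a set" where
  "upper_central 0 = {\<one>}"
| "upper_central (Suc i) =
     {g \<in> carrier G. \<forall>h\<in>carrier G. g \<otimes> h \<otimes> inv g \<otimes> inv h \<in> upper_central i}"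

lemma upper_central_subset: "upper_central i \<subseteq> carrier G"
  by (cases i) auto

lemma upper_central_conj_by:
  "\<lbrakk>g \<in> upper_central i; k \<in> carrier G\<rbrakk> \<Longrightarrow> conj_by k g \<in> upper_central i"
proof (induction i arbitrary: g k)
  case (Suc i)
  have g: "g \<in> carrier G" using Suc.prems by simp
  have "conj_by k g \<otimes> h \<otimes> inv (conj_by k g) \<otimes> inv h \<in> upper_central i" if h: "h \<in> carrier G" for h
  proof -
    let ?h = "conj_by (inv k) h"
    have "conj_by k (g \<otimes> ?h \<otimes> inv g \<otimes> inv ?h) \<in> upper_central i"
      using Suc.prems h by (intro Suc.IH) auto
    also have "conj_by k (g \<otimes> ?h \<otimes> inv g \<otimes> inv ?h) = conj_by k g \<otimes> h \<otimes> inv (conj_by k g) \<otimes> inv h"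
      using Suc.prems(2) g h by (simp add: conj_by_mult conj_by_inv[symmetric])
    finally show ?thesis .
  qed
  thus ?case using g Suc.prems(2) by simp
qed simp

lemma upper_central_class:
  assumes "x \<in> conj_class g" "g \<in> upper_central i" shows "x \<in> upper_central i"
  using assms upper_central_conj_by by (auto simp: conj_class_def)

lemma commutator_eq:
  "\<lbrakk>g \<in> carrier G; h \<in> carrier G\<rbrakk> \<Longrightarrow> g \<otimes> h \<otimes> inv g \<otimes> inv h = g \<otimes> inv (conj_by h g)"
  by (simp add: conj_by_def inv_mult_group m_assoc)

text \<open>Quotients of conjugates of \<open>g\<close> are conjugates of commutators with \<open>g\<close>.\<close>

lemma quotient_in_upper_central:
  assumes g: "g \<in> upper_central (Suc i)" and ab: "a \<in> conj_class g" "b \<in> conj_class g"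
  shows "a \<otimes> inv b \<in> upper_central i"
proof -
  have gc: "g \<in> carrier G" using g by simp
  obtain k l where kl: "k \<in> carrier G" "a = conj_by k g" "l \<in> carrier G" "b = conj_by l g"
    using ab by (auto simp: conj_class_def)
  let ?m = "inv k \<otimes> l"
  have "b = conj_by k (conj_by ?m g)" using kl gc by (simp add: conj_by_conj_by)
  hence "a \<otimes> inv b = conj_by k (g \<otimes> ?m \<otimes> inv g \<otimes> inv ?m)"
    using kl gc by (simp add: commutator_eq conj_by_mult conj_by_inv)
  moreover have "g \<otimes> ?m \<otimes> inv g \<otimes> inv ?m \<in> upper_central i"
    using g kl by simp
  ultimately show ?thesis using upper_central_conj_by kl(1) by simp
qed

lemma lower_central_subset: "lower_central G n \<subseteq> carrier G"
proof (induction n)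
  case (Suc n)
  have "generate G {x \<otimes> y \<otimes> inv x \<otimes> inv y | x y. x \<in> lower_central G n \<and> y \<in> carrier G} \<subseteq> carrier G"
    using Suc by (intro generate_incl) auto
  thus ?case by simp
qed simp

text \<open>The lower central series, read backwards from the trivial group, is contained in the upper one.\<close>

lemma upper_central_eq_carrier:
  assumes n: "lower_central G n = {\<one>}" and "n \<le> m"
  shows "upper_central m = carrier G"
proof -
  have "lower_central G (n - i) \<subseteq> upper_central i" if "i \<le> n" for i
    using that
  proof (induction i)
    case (Suc i)
    hence eq: "n - i = Suc (n - Suc i)" by simp
    show ?case
    proof
      fix g assume g: "g \<in> lower_central G (n - Suc i)"
      have "g \<otimes> h \<otimes> inv g \<otimes> inv h \<in> lower_central G (n - i)" if "h \<in> carrier G" for h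
        unfolding eq lower_central.simps using g that by (intro generate.incl) auto
      thus "g \<in> upper_central (Suc i)" using Suc g lower_central_subset by fastforce
    qed
  qed (simp add: n)
  from this[of n] have "upper_central n = carrier G" using upper_central_subset by auto
  moreover have "upper_central (n + k) = carrier G" if "upper_central n = carrier G" for k
    using that by (induction k) auto
  ultimately show ?thesis using \<open>n \<le> m\<close> by (metis le_add_diff_inverse)
qed

lemma sum_class_sum_int:
  assumes "g \<in> carrier G" shows "(\<Sum>x\<in>carrier G. class_sum g x :: int) = int (card (conj_class g))"
  using sum_class_sum[OF assms, of "\<lambda>_. 1::int"] by simp

end

context center_iso
begin

text \<open>Expand \<open>f\<close> in class sums. Only classes in the given term of the series occur, and only
  the class of the identity has an image with a nonzero coefficient at the identity.\<close>

lemma transfer_support: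
  assumes corr: "\<And>g. g \<in> G.upper_central i \<Longrightarrow>
      \<exists>g'\<in>H.upper_central i. \<phi> (G.class_sum g) = H.class_sum g'"
    and f: "f \<in> G.center" and supp: "\<And>x. f x \<noteq> 0 \<Longrightarrow> x \<in> G.upper_central i"
  shows "\<phi> f y \<noteq> 0 \<Longrightarrow> y \<in> H.upper_central i" and "\<phi> f \<one>\<^bsub>H\<^esub> = f \<one>"
proof -
  show "y \<in> H.upper_central i" if nz: "\<phi> f y \<noteq> 0"
  proof (rule ccontr)
    assume y: "y \<notin> H.upper_central i"
    have "of_int (f g) * (of_int (\<phi> (G.class_sum g) y) / of_nat (card (G.conj_class g))) = (0::complex)" for g
    proof (cases "f g = 0")
      case False
      then obtain g' where "g' \<in> H.upper_central i" "\<phi> (G.class_sum g) = H.class_sum g'"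
        using corr supp by blast
      thus ?thesis using H.upper_central_class y by (auto simp: H.class_sum_def)
    qed simp
    hence "complex_of_int (\<phi> f y) = 0" unfolding expansion[OF f] by (intro sum.neutral) blast
    thus False using nz by simp
  qed
  have "of_int (f g) * (of_int (\<phi> (G.class_sum g) \<one>\<^bsub>H\<^esub>) / of_nat (card (G.conj_class g))) =
      (if g = \<one> then complex_of_int (f g) else 0)" if g: "g \<in> carrier G" for g
  proof (cases "f g = 0 \<or> g = \<one>")
    case True
    thus ?thesis by (auto simp: one H.class_sum_def)
  next
    case False
    then obtain g' where g': "g' \<in> H.upper_central i" "\<phi> (G.class_sum g) = H.class_sum g'"
      using corr supp by blast
    hence g'c: "g' \<in> carrier H" using H.upper_central_subset by blast
    have "\<one>\<^bsub>H\<^esub> \<notin> H.conj_class g'"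
    proof
      assume "\<one>\<^bsub>H\<^esub> \<in> H.conj_class g'"
      hence "H.conj_class \<one>\<^bsub>H\<^esub> = H.conj_class g'" using H.conj_class_eq[OF g'c] by blast
      hence "(H.class_sum g' :: 'b \<Rightarrow> int) = H.class_sum \<one>\<^bsub>H\<^esub>" by (simp add: H.class_sum_def fun_eq_iff)
      hence "\<phi> (G.class_sum g) = \<phi> (G.class_sum \<one>)" using g'(2) one by simp
      hence "(G.class_sum g :: 'a \<Rightarrow> int) = G.class_sum \<one>" using g by (intro \<phi>_inj) auto
      hence "G.conj_class g = {\<one>}" using g by (simp add: G.class_sum_eq_iff)
      thus False using False G.conj_class_self[OF g] by auto
    qed
    thus ?thesis using False g'(2) by (simp add: H.class_sum_def)
  qed
  hence "complex_of_int (\<phi> f \<one>\<^bsub>H\<^esub>) = of_int (f \<one>)" unfolding expansion[OF f] by simp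
  thus "\<phi> f \<one>\<^bsub>H\<^esub> = f \<one>" by simp
qed

end

context normalized_center_iso
begin

text \<open>For a class \<open>C\<close> in the next term of the series, \<open>C * star C\<close> is supported in the current term, where
  the coefficient at the identity is known to be preserved. Hence the image \<open>b\<close> of \<open>C\<close> satisfies
  \<open>\<Sum> b\<^sup>2 = |C| = \<Sum> b\<close>, so that its integer coefficients are \<open>0\<close> or \<open>1\<close>.\<close>

lemma image_class_sum_01:
  assumes corr: "\<And>g. g \<in> G.upper_central i \<Longrightarrow>
      \<exists>g'\<in>H.upper_central i. \<phi> (G.class_sum g) = H.class_sum g'"
    and g: "g \<in> G.upper_central (Suc i)"
  shows "\<phi> (G.class_sum g) y \<in> {0, 1}"
    and "\<phi> (G.class_sum g) y \<noteq> 0 \<Longrightarrow> y \<in> H.upper_central (Suc i)"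
proof -
  have gc: "g \<in> carrier G" using g by simp
  define x :: "'a \<Rightarrow> int" where "x = G.class_sum g"
  define w where "w = G.center_mult x (G.center_star x)"
  define b where "b = \<phi> x"
  have x: "x \<in> G.center" and b: "b \<in> H.center"
    using gc by (auto simp: x_def b_def)
  have w: "w \<in> G.center" using x unfolding w_def by blast
  have \<phi>w: "\<phi> w = H.center_mult b (H.center_star b)"
    using x by (simp add: w_def b_def mult star G.center_star_closed)
  have w_eq: "w z = (\<Sum>u\<in>carrier G. x u * x (inv z \<otimes> u))" if "z \<in> carrier G" for z
    using that by (simp add: w_def G.center_mult_def G.conv_def G.center_star_def G.inv_mult_group)
  have \<phi>w_eq: "\<phi> w z = (\<Sum>u\<in>carrier H. b u * b (inv\<^bsub>H\<^esub> z \<otimes>\<^bsub>H\<^esub> u))" if "z \<in> carrier H" for z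
    using that by (simp add: \<phi>w H.center_mult_def H.conv_def H.center_star_def H.inv_mult_group)
  have supp: "z \<in> G.upper_central i" if "w z \<noteq> 0" for z
  proof -
    have z: "z \<in> carrier G" using that w G.center_outside by blast
    obtain u where u: "u \<in> carrier G" "x u * x (inv z \<otimes> u) \<noteq> 0"
      using \<open>w z \<noteq> 0\<close> unfolding w_eq[OF z] by (meson sum.not_neutral_contains_not_neutral)
    hence "u \<in> G.conj_class g" "inv z \<otimes> u \<in> G.conj_class g"
      by (auto simp: x_def G.class_sum_def split: if_splits)
    hence "u \<otimes> inv (inv z \<otimes> u) \<in> G.upper_central i"
      by (rule G.quotient_in_upper_central[OF g])
    thus ?thesis using u(1) z by (simp add: G.inv_mult_group)
  qed
  have image_supp: "z \<in> H.upper_central i" if "\<phi> w z \<noteq> 0" for z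
    by (rule transfer_support(1)[OF corr w supp that])
  have "\<phi> w \<one>\<^bsub>H\<^esub> = w \<one>"
    by (rule transfer_support(2)[OF corr w supp])
  hence "(\<Sum>u\<in>carrier H. b u * b u) = (\<Sum>u\<in>carrier G. x u * x u)"
    using \<phi>w_eq[of "\<one>\<^bsub>H\<^esub>"] w_eq[of "\<one>"] by simp
  also have "\<dots> = (\<Sum>u\<in>carrier G. x u)" by (simp add: x_def G.class_sum_def)
  also have "\<dots> = (\<Sum>u\<in>carrier H. b u)" using aug[OF x] by (simp add: b_def)
  finally have "(\<Sum>u\<in>carrier H. b u * b u - b u) = 0" by (simp add: sum_subtractf)
  moreover have "b u * b u - b u \<ge> 0" for u
    by (cases "b u \<le> 0") (auto simp: mult_le_cancel_left1 zero_le_mult_iff algebra_simps intro: order_trans[of _ 0])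
  ultimately have "\<forall>u\<in>carrier H. b u * b u - b u = 0"
    by (subst (asm) sum_nonneg_eq_0_iff) auto
  hence b01: "b u \<in> {0, 1}" for u
    using b by (cases "u \<in> carrier H") (auto simp: H.center_outside)
  thus "\<phi> (G.class_sum g) y \<in> {0, 1}" by (simp add: b_def x_def)
  assume "\<phi> (G.class_sum g) y \<noteq> 0"
  hence by1: "b y = 1" using b01[of y] by (auto simp: b_def x_def)
  hence y: "y \<in> carrier H" using b H.center_outside by fastforce
  have "y \<otimes>\<^bsub>H\<^esub> h \<otimes>\<^bsub>H\<^esub> inv\<^bsub>H\<^esub> y \<otimes>\<^bsub>H\<^esub> inv\<^bsub>H\<^esub> h \<in> H.upper_central i" if h: "h \<in> carrier H" for h
  proof -
    \<comment> \<open>all summands of \<open>\<phi> w ?z\<close> are nonnegative, and the one for \<open>y\<close> is \<open>1\<close>\<close>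
    let ?z = "y \<otimes>\<^bsub>H\<^esub> inv\<^bsub>H\<^esub> (H.conj_by h y)"
    have z: "?z \<in> carrier H" using y h by simp
    have "inv\<^bsub>H\<^esub> ?z \<otimes>\<^bsub>H\<^esub> y = H.conj_by h y" using y h by (simp add: H.inv_mult_group H.m_assoc)
    hence "b y * b (inv\<^bsub>H\<^esub> ?z \<otimes>\<^bsub>H\<^esub> y) = 1"
      using H.class_functionD[OF H.center_class_function[OF b] y h] by1 by simp
    moreover have "b y * b (inv\<^bsub>H\<^esub> ?z \<otimes>\<^bsub>H\<^esub> y) \<le> \<phi> w ?z"
      unfolding \<phi>w_eq[OF z] using y
    proof (intro member_le_sum)
      fix u show "0 \<le> b u * b (inv\<^bsub>H\<^esub> ?z \<otimes>\<^bsub>H\<^esub> u)"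
        using b01[of u] b01[of "inv\<^bsub>H\<^esub> ?z \<otimes>\<^bsub>H\<^esub> u"] by auto
    qed auto
    ultimately have "\<phi> w ?z \<noteq> 0" by linarith
    from image_supp[OF this] show ?thesis using y h by (simp add: H.commutator_eq)
  qed
  thus "y \<in> H.upper_central (Suc i)" using y by simp
qed

text \<open>The image of a class sum contains a whole class sum \<open>C'\<close>, and the preimage of the remainder is
  nonnegative because both the map and its inverse send class sums to sums of class sums. So the preimage
  of \<open>C'\<close> is contained in the original class and thus equal to it.\<close>

lemma image_class_sum:
  assumes corr: "\<And>g. g \<in> G.upper_central i \<Longrightarrow>
      \<exists>g'\<in>H.upper_central i. \<phi> (G.class_sum g) = H.class_sum g'"
    and corr': "\<And>g'. g' \<in> H.upper_central i \<Longrightarrow>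
      \<exists>g\<in>G.upper_central i. \<psi> (H.class_sum g') = G.class_sum g"
    and g: "g \<in> G.upper_central (Suc i)"
  shows "\<exists>g'\<in>H.upper_central (Suc i). \<phi> (G.class_sum g) = H.class_sum g'"
proof -
  interpret inv: normalized_center_iso H G \<psi> by (rule normalized_inverse)
  have gc: "g \<in> carrier G" using g by simp
  define b where "b = \<phi> (G.class_sum g)"
  have b: "b \<in> H.center" using gc by (simp add: b_def)
  have b01: "b y \<in> {0, 1}" "b y \<noteq> 0 \<Longrightarrow> y \<in> H.upper_central (Suc i)" for y
    unfolding b_def
    by (rule image_class_sum_01(1)[OF corr g]; assumption) (rule image_class_sum_01(2)[OF corr g]; assumption)
  have "(\<Sum>y\<in>carrier H. b y) > 0"
    using aug[OF G.class_sum_center[OF gc]] G.card_conj_class_pos[OF gc] G.sum_class_sum_int[OF gc]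
    by (simp add: b_def)
  then obtain a where a: "a \<in> carrier H" "b a \<noteq> 0" by (metis less_irrefl sum.neutral)
  hence ba: "b a = 1" and au: "a \<in> H.upper_central (Suc i)" using b01 by auto
  define r where "r y = b y + (- 1) * H.class_sum a y" for y
  have r: "r \<in> H.center"
    unfolding r_def using b a(1) by (intro H.center_add H.center_scale H.class_sum_center)
  have b_on_class: "b y = 1" if "y \<in> H.conj_class a" for y
    using H.class_function_on_class[OF H.center_class_function[OF b] a(1) that] ba by simp
  have r0: "r y \<ge> 0" for y
    using b01(1)[of y] b_on_class[of y] by (auto simp: r_def H.class_sum_def)
  have r_supp: "y \<in> H.upper_central (Suc i)" if "r y \<noteq> 0" for y
  proof -
    have "b y \<noteq> 0" using that b_on_class[of y] by (cases "y \<in> H.conj_class a") (auto simp: r_def H.class_sum_def)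
    thus ?thesis by (rule b01(2))
  qed
  define f where "f = \<psi> (H.class_sum a)"
  have f: "f \<in> G.center" using a(1) by (simp add: f_def)
  have f01: "f x \<in> {0, 1}" for x
    unfolding f_def using inv.image_class_sum_01(1)[OF corr' au] .
  \<comment> \<open>\<open>r\<close> is what remains of the image after removing the class of \<open>a\<close>\<close>
  have "\<psi> r = (\<lambda>x. G.class_sum g x + (- 1) * f x)"
    unfolding r_def using b a(1) gc
    by (subst inv.add, simp, intro H.center_scale H.class_sum_center, simp, subst inv.scale)
      (auto simp: f_def b_def)
  hence \<psi>r: "\<psi> r x = G.class_sum g x - f x" for x by simp
  have nonneg: "\<psi> r x \<ge> 0" for x
  proof -
    have nn: "real_of_int (r y) * (of_int (\<psi> (H.class_sum y) x) / of_nat (card (H.conj_class y))) \<ge> 0" for y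
    proof (cases "r y = 0")
      case False
      hence "\<psi> (H.class_sum y) x \<in> {0, 1}" using inv.image_class_sum_01(1)[OF corr' r_supp] by blast
      thus ?thesis using r0[of y] by auto
    qed simp
    have "complex_of_real (of_int (\<psi> r x)) = of_real (\<Sum>y\<in>carrier H. of_int (r y) *
        (of_int (\<psi> (H.class_sum y) x) / of_nat (card (H.conj_class y))))"
      using inv.expansion[OF r] by simp
    hence "of_int (\<psi> r x) = (\<Sum>y\<in>carrier H. real_of_int (r y) *
        (of_int (\<psi> (H.class_sum y) x) / of_nat (card (H.conj_class y))))"
      by (simp only: of_real_eq_iff)
    also have "\<dots> \<ge> 0" by (intro sum_nonneg nn)
    finally show ?thesis by simp
  qed
  have le: "f x \<le> G.class_sum g x" for x using nonneg[of x] \<psi>r[of x] by simp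
  have "(\<Sum>x\<in>carrier G. f x) > 0"
    using inv.aug[OF H.class_sum_center[OF a(1)]] H.card_conj_class_pos[OF a(1)] H.sum_class_sum_int[OF a(1)]
    by (simp add: f_def)
  then obtain x0 where x0: "x0 \<in> carrier G" "f x0 \<noteq> 0" by (metis less_irrefl sum.neutral)
  have "x0 \<in> G.conj_class g" using le[of x0] f01[of x0] x0(2)
    by (cases "x0 \<in> G.conj_class g") (auto simp: G.class_sum_def)
  hence "f x = f x0" if "x \<in> G.conj_class g" for x
    using G.class_function_on_class[OF G.center_class_function[OF f] gc] that by metis
  hence "f x = G.class_sum g x" for x
    using le[of x] f01[of x] f01[of x0] x0(2)
    by (cases "x \<in> G.conj_class g") (auto simp: G.class_sum_def)
  hence "f = G.class_sum g" by blast
  hence "\<phi> (G.class_sum g) = H.class_sum a" using a(1) by (simp add: f_def) (metis \<phi>_\<psi> H.class_sum_center)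
  thus ?thesis using au by blast
qed

text \<open>The locale instance for the inverse isomorphism has its own inverse, which is the original isomorphism.\<close>

lemma \<psi>_inverse: "f \<in> G.center \<Longrightarrow> center_iso.\<psi> H \<psi> f = \<phi> f"
proof -
  interpret inv: center_iso H G \<psi> by (rule inverse)
  assume f: "f \<in> G.center"
  show "inv.\<psi> f = \<phi> f" using f inv.\<psi>_closed inv.\<phi>_\<psi> \<phi>_\<psi> by metis
qed

text \<open>The statement for the inverse is carried along, because the induction step needs it for both maps.\<close>

lemma class_sums_correspond:
  "(\<forall>g\<in>G.upper_central i. \<exists>g'\<in>H.upper_central i. \<phi> (G.class_sum g) = H.class_sum g') \<and>
   (\<forall>g'\<in>H.upper_central i. \<exists>g\<in>G.upper_central i. \<psi> (H.class_sum g') = G.class_sum g)"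
proof (induction i)
  case 0
  interpret inv: center_iso H G \<psi> by (rule inverse)
  show ?case using one inv.one by simp
next
  case (Suc i)
  interpret inv: normalized_center_iso H G \<psi> by (rule normalized_inverse)
  have corr: "\<exists>g'\<in>H.upper_central i. \<phi> (G.class_sum g) = H.class_sum g'" if "g \<in> G.upper_central i" for g
    using Suc that by blast
  have corr': "\<exists>g\<in>G.upper_central i. \<psi> (H.class_sum g') = G.class_sum g" if "g' \<in> H.upper_central i" for g'
    using Suc that by blast
  have corr'': "\<exists>g'\<in>H.upper_central i. inv.\<psi> (G.class_sum g) = H.class_sum g'"
    if g: "g \<in> G.upper_central i" for g
    using corr[OF g] g G.upper_central_subset by (auto simp: \<psi>_inverse subset_eq)
  show ?case
    using image_class_sum[OF corr corr'] inv.image_class_sum[OF corr' corr''] by blast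
qed

end

section \<open>Matching conjugacy classes\<close>

context finite_grp
begin

lemma conjugacy_classes_eq: "conjugacy_classes G = conj_class ` carrier G"
  by (auto simp: conjugacy_classes_def orbits_def orbit_def conj_class_def conj_by_def image_iff) 

lemma sum_by_classes:
  fixes F :: "'a \<Rightarrow> complex"
  shows "(\<Sum>x\<in>carrier G. F x) = (\<Sum>C\<in>conjugacy_classes G. \<Sum>x\<in>C. F x)"
proof -
  have "(\<Sum>x\<in>carrier G. F x) =
      (\<Sum>C\<in>conj_class ` carrier G. \<Sum>x\<in>{x \<in> carrier G. conj_class x = C}. F x)"
    by (rule sum.image_gen) simp
  also have "\<dots> = (\<Sum>C\<in>conj_class ` carrier G. \<Sum>x\<in>C. F x)"
  proof (rule sum.cong[OF refl])
    fix C assume "C \<in> conj_class ` carrier G"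
    then obtain g where g: "g \<in> carrier G" "C = conj_class g" by blast
    have "x \<in> carrier G \<and> conj_class x = C \<longleftrightarrow> x \<in> C" for x
      using g conj_class_subset[OF g(1)] conj_class_eq_iff[of x g] by blast
    hence "{x \<in> carrier G. conj_class x = C} = C" by blast
    thus "(\<Sum>x\<in>{x \<in> carrier G. conj_class x = C}. F x) = (\<Sum>x\<in>C. F x)" by simp
  qed
  finally show ?thesis by (simp add: conjugacy_classes_eq)
qed

end

locale class_matching = G: finite_grp G + H: finite_grp H
  for G :: "('a, 'c) monoid_scheme" (structure) and H :: "('b, 'd) monoid_scheme" (structure) +
  fixes \<Psi> :: "'a set \<Rightarrow> 'b set"
  assumes bij_classes: "bij_betw \<Psi> (conjugacy_classes G) (conjugacy_classes H)"
    and card_class: "C \<in> conjugacy_classes G \<Longrightarrow> card (\<Psi> C) = card C"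
begin

lemma sum_matching:
  fixes F :: "'a \<Rightarrow> complex" and F' :: "'b \<Rightarrow> complex"
  assumes eq: "\<And>C g g'. \<lbrakk>C \<in> conjugacy_classes G; g \<in> C; g' \<in> \<Psi> C\<rbrakk> \<Longrightarrow> F' g' = F g"
  shows "(\<Sum>y\<in>carrier H. F' y) = (\<Sum>x\<in>carrier G. F x)"
proof -
  have "(\<Sum>y\<in>carrier H. F' y) = (\<Sum>C\<in>conjugacy_classes G. \<Sum>y\<in>\<Psi> C. F' y)"
    unfolding H.sum_by_classes by (rule sum.reindex_bij_betw[OF bij_classes, symmetric])
  also have "\<dots> = (\<Sum>C\<in>conjugacy_classes G. \<Sum>x\<in>C. F x)"
  proof (rule sum.cong[OF refl])
    fix C assume C: "C \<in> conjugacy_classes G"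
    then obtain g where g: "g \<in> C" using G.conj_class_self by (auto simp: G.conjugacy_classes_eq)
    have "\<Psi> C \<in> conjugacy_classes H" using C bij_classes by (auto simp: bij_betw_def)
    then obtain g' where g': "g' \<in> \<Psi> C" using H.conj_class_self by (auto simp: H.conjugacy_classes_eq)
    have "(\<Sum>y\<in>\<Psi> C. F' y) = (\<Sum>y\<in>\<Psi> C. F g)" using eq[OF C g] by (intro sum.cong) auto
    also have "\<dots> = (\<Sum>x\<in>C. F g)" using card_class[OF C] by simp
    also have "\<dots> = (\<Sum>x\<in>C. F x)" using eq[OF C _ g'] g by (intro sum.cong) metis+
    finally show "(\<Sum>y\<in>\<Psi> C. F' y) = (\<Sum>x\<in>C. F x)" .
  qed
  finally show ?thesis by (simp add: G.sum_by_classes)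
qed

end

text \<open>The situation reached for nilpotent groups: class sums correspond to class sums in both directions.\<close>

locale class_sum_iso = normalized_center_iso +
  assumes to_class_sum: "g \<in> carrier G \<Longrightarrow> \<exists>g'\<in>carrier H. \<phi> (G.class_sum g) = H.class_sum g'"
    and from_class_sum: "g' \<in> carrier H \<Longrightarrow> \<exists>g\<in>carrier G. \<psi> (H.class_sum g') = G.class_sum g"
begin

lemma inverse_class_sum_iso: "class_sum_iso H G \<psi>"
proof -
  interpret inv: normalized_center_iso H G \<psi> by (rule normalized_inverse)
  show ?thesis
    using from_class_sum to_class_sum by unfold_locales (auto simp: \<psi>_inverse)
qed

text \<open>The matching of class sums as a map of classes, which is the form that character tables need.\<close>

definition \<Psi> where
  "\<Psi> C = {y \<in> carrier H. \<phi> (\<lambda>x. of_bool (x \<in> C)) y = 1}"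

lemma \<Psi>_conj_class:
  assumes "g' \<in> carrier H" "\<phi> (G.class_sum g) = H.class_sum g'"
  shows "\<Psi> (G.conj_class g) = H.conj_class g'"
proof -
  have "(\<lambda>x. of_bool (x \<in> G.conj_class g)) = (G.class_sum g :: 'a \<Rightarrow> int)"
    by (simp add: G.class_sum_def fun_eq_iff)
  thus ?thesis
    using assms H.conj_class_subset[OF assms(1)] by (auto simp: \<Psi>_def H.class_sum_def)
qed

lemma \<Psi>_eq_iff:
  assumes "g \<in> carrier G" "g' \<in> carrier H"
  shows "\<Psi> (G.conj_class g) = H.conj_class g' \<longleftrightarrow> \<phi> (G.class_sum g) = H.class_sum g'"
proof -
  obtain h where h: "h \<in> carrier H" "\<phi> (G.class_sum g) = H.class_sum h"
    using to_class_sum assms(1) by blast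
  show ?thesis using \<Psi>_conj_class[OF h] h assms(2) H.class_sum_eq_iff[OF h(1) assms(2)] by metis
qed

lemma card_corresponding_classes:
  assumes g: "g \<in> carrier G" "g' \<in> carrier H" "\<phi> (G.class_sum g) = H.class_sum g'"
  shows "card (H.conj_class g') = card (G.conj_class g)"
proof -
  have "int (card (H.conj_class g')) = int (card (G.conj_class g))"
    using aug[OF G.class_sum_center[OF g(1)]] g(3)
    by (simp add: G.sum_class_sum_int[OF g(1)] H.sum_class_sum_int[OF g(2)])
  thus ?thesis by simp
qed

sublocale class_matching G H \<Psi>
proof
  show "bij_betw \<Psi> (conjugacy_classes G) (conjugacy_classes H)"
  proof (rule bij_betw_imageI)
    show "inj_on \<Psi> (conjugacy_classes G)"
    proof (rule inj_onI)
      fix C D assume "C \<in> conjugacy_classes G" "D \<in> conjugacy_classes G" and eq: "\<Psi> C = \<Psi> D"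
      then obtain g h where gh: "g \<in> carrier G" "C = G.conj_class g" "h \<in> carrier G" "D = G.conj_class h"
        by (auto simp: G.conjugacy_classes_eq)
      obtain g' where g': "g' \<in> carrier H" "\<phi> (G.class_sum g) = H.class_sum g'" using to_class_sum gh(1) by blast
      hence "\<phi> (G.class_sum h) = H.class_sum g'"
        using eq gh \<Psi>_eq_iff by metis
      hence "(G.class_sum g :: 'a \<Rightarrow> int) = G.class_sum h" using g'(2) gh by (intro \<phi>_inj) auto
      thus "C = D" using gh by (simp add: G.class_sum_eq_iff)
    qed
    show "\<Psi> ` conjugacy_classes G = conjugacy_classes H"
    proof (intro equalityI subsetI)
      fix D assume "D \<in> \<Psi> ` conjugacy_classes G"
      then obtain g where "g \<in> carrier G" "D = \<Psi> (G.conj_class g)" by (auto simp: G.conjugacy_classes_eq)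
      thus "D \<in> conjugacy_classes H" using to_class_sum \<Psi>_conj_class by (fastforce simp: H.conjugacy_classes_eq)
    next
      fix D assume "D \<in> conjugacy_classes H"
      then obtain g' where g': "g' \<in> carrier H" "D = H.conj_class g'" by (auto simp: H.conjugacy_classes_eq)
      obtain g where g: "g \<in> carrier G" "\<psi> (H.class_sum g') = G.class_sum g" using from_class_sum g'(1) by blast
      have "\<phi> (G.class_sum g) = H.class_sum g'" using g g'(1) \<phi>_\<psi> H.class_sum_center by metis
      hence "D = \<Psi> (G.conj_class g)" using \<Psi>_conj_class g' by simp
      thus "D \<in> \<Psi> ` conjugacy_classes G" using g(1) by (auto simp: G.conjugacy_classes_eq)
    qed
  qed
next
  fix C assume "C \<in> conjugacy_classes G"
  then obtain g where g: "g \<in> carrier G" "C = G.conj_class g" by (auto simp: G.conjugacy_classes_eq)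
  obtain g' where "g' \<in> carrier H" "\<phi> (G.class_sum g) = H.class_sum g'" using to_class_sum g(1) by blast
  thus "card (\<Psi> C) = card C" using \<Psi>_conj_class card_corresponding_classes g by simp
qed

lemma \<Psi>_elems:
  assumes "C \<in> conjugacy_classes G" "g \<in> C" "g' \<in> \<Psi> C"
  shows "g \<in> carrier G" "g' \<in> carrier H" "\<phi> (G.class_sum g) = H.class_sum g'"
proof -
  obtain h where h: "h \<in> carrier G" "C = G.conj_class h" using assms(1) by (auto simp: G.conjugacy_classes_eq)
  show g: "g \<in> carrier G" using h assms(2) G.conj_class_subset by blast
  show g': "g' \<in> carrier H" using assms(3) by (simp add: \<Psi>_def)
  have C: "C = G.conj_class g" using h assms(2) G.conj_class_eq by simp
  obtain k where k: "k \<in> carrier H" "\<phi> (G.class_sum g) = H.class_sum k" using to_class_sum g by blast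
  have "g' \<in> H.conj_class k" using \<Psi>_conj_class[OF k] assms(3) C by simp
  hence "H.conj_class g' = H.conj_class k" using H.conj_class_eq k(1) by simp
  thus "\<phi> (G.class_sum g) = H.class_sum g'" using k(2) by (simp add: H.class_sum_def fun_eq_iff)
qed

text \<open>Pull back the spherical function of \<open>\<chi>\<close> along the inverse isomorphism. The degrees agree because they are
  determined by the group order and the norm of the spherical function.\<close>

lemma matching_character:
  assumes \<chi>: "\<chi> \<in> irr_characters G"
  obtains \<chi>' where "\<chi>' \<in> irr_characters H"
    "\<And>g g'. \<lbrakk>g \<in> carrier G; g' \<in> carrier H; \<phi> (G.class_sum g) = H.class_sum g'\<rbrakk> \<Longrightarrow> \<chi>' g' = \<chi> g"
proof -
  interpret inv: class_sum_iso H G \<psi> by (rule inverse_class_sum_iso)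
  define \<theta> where "\<theta> = (\<lambda>g. \<chi> g / \<chi> \<one>)"
  have \<theta>: "G.spherical \<theta>" using G.irr_character_spherical[OF \<chi>] by (simp add: \<theta>_def)
  obtain \<eta> where \<eta>: "H.spherical \<eta>" and pull: "\<And>f. f \<in> H.center \<Longrightarrow>
      H.pairing (\<lambda>y. of_int (f y)) \<eta> = G.pairing (\<lambda>x. of_int (\<psi> f x)) \<theta>"
    using inv.pullback_spherical[OF \<theta>] by blast
  have match: "\<eta> g' = \<theta> g"
    if g: "g \<in> carrier G" "g' \<in> carrier H" "\<phi> (G.class_sum g) = H.class_sum g'" for g g'
  proof -
    have "\<psi> (H.class_sum g') = G.class_sum g" using g by (metis \<psi>_\<phi> G.class_sum_center)
    hence "of_nat (card (H.conj_class g')) * \<eta> g' = of_nat (card (G.conj_class g)) * \<theta> g"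
      using pull[OF H.class_sum_center[OF g(2)]] g
      by (simp add: H.pairing_class_sum H.spherical_class_function[OF \<eta>]
          G.pairing_class_sum G.spherical_class_function[OF \<theta>])
    thus ?thesis using card_corresponding_classes[OF g] G.conj_class_self[OF g(1)] by auto
  qed
  obtain \<chi>' where \<chi>': "\<chi>' \<in> irr_characters H" "\<And>y. y \<in> carrier H \<Longrightarrow> \<chi>' y = \<chi>' \<one>\<^bsub>H\<^esub> * \<eta> y"
    using H.spherical_imp_irr_character[OF \<eta>] by blast
  obtain m n where mn: "\<chi> \<one> = of_nat m" "\<chi>' \<one>\<^bsub>H\<^esub> = of_nat n" "m > 0" "n > 0"
    using \<chi> \<chi>'(1) by (metis G.irr_character_cases H.irr_character_cases)
  define s where "s = (\<Sum>x\<in>carrier G. \<theta> x * cnj (\<theta> x))"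
  have "s = (\<Sum>y\<in>carrier H. \<eta> y * cnj (\<eta> y))"
    unfolding s_def by (rule sum_matching[symmetric]) (use match \<Psi>_elems in metis)
  hence "of_nat n * of_nat n * s = H.pairing \<chi>' (\<lambda>y. \<chi>' (inv\<^bsub>H\<^esub> y))"
    by (simp add: H.pairing_def \<chi>'(2) H.spherical_inv[OF \<eta>] mn(2) sum_distrib_left mult_ac)
  also have "\<dots> = of_nat (card (carrier G))"
    using H.irr_character_norm[OF \<chi>'(1)] card_eq by (simp add: Coset.order_def)
  also have "\<dots> = of_nat m * of_nat m * s"
    using G.irr_character_norm[OF \<chi>] G.spherical_inv[OF \<theta>] mn(1,3)
    by (simp add: Coset.order_def G.pairing_def s_def sum_distrib_left \<theta>_def field_simps)
  finally have eq: "of_nat n * of_nat n * s = of_nat m * of_nat m * s" .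
  have "s \<noteq> 0"
  proof
    assume "s = 0"
    hence "of_nat (card (carrier G)) = (0::complex)"
      using \<open>of_nat (card (carrier G)) = of_nat m * of_nat m * s\<close> by simp
    thus False using G.order_pos by (simp add: Coset.order_def)
  qed
  hence "of_nat (n * n) = (of_nat (m * m) :: complex)" using eq by simp
  hence "n * n = m * m" by (simp only: of_nat_eq_iff)
  hence "n = m" by (metis power2_eq_square power2_eq_iff_nonneg zero_le)
  hence "\<chi>' g' = \<chi> g"
    if "g \<in> carrier G" "g' \<in> carrier H" "\<phi> (G.class_sum g) = H.class_sum g'" for g g'
    using match[OF that] \<chi>'(2)[OF that(2)] mn by (simp add: \<theta>_def)
  thus ?thesis using that \<chi>'(1) by blast
qed

lemma identical_character_tables: "identical_character_tables G H"
proof -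
  interpret inv: class_sum_iso H G \<psi> by (rule inverse_class_sum_iso)
  define matched where "matched \<chi> \<chi>' \<longleftrightarrow> (\<forall>g\<in>carrier G. \<forall>g'\<in>carrier H.
      \<phi> (G.class_sum g) = H.class_sum g' \<longrightarrow> \<chi>' g' = (\<chi> g :: complex))" for \<chi> \<chi>'
  have "\<forall>\<chi>. \<exists>\<chi>'. \<chi> \<in> irr_characters G \<longrightarrow> \<chi>' \<in> irr_characters H \<and> matched \<chi> \<chi>'"
    using matching_character unfolding matched_def by metis
  then obtain \<Phi> where \<Phi>: "\<And>\<chi>. \<chi> \<in> irr_characters G \<Longrightarrow> \<Phi> \<chi> \<in> irr_characters H \<and> matched \<chi> (\<Phi> \<chi>)"
    by metis
  have "bij_betw \<Phi> (irr_characters G) (irr_characters H)"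
  proof (rule bij_betw_imageI)
    show "inj_on \<Phi> (irr_characters G)"
    proof (rule inj_onI)
      fix \<chi>1 \<chi>2 assume \<chi>: "\<chi>1 \<in> irr_characters G" "\<chi>2 \<in> irr_characters G" and eq: "\<Phi> \<chi>1 = \<Phi> \<chi>2"
      show "\<chi>1 = \<chi>2"
      proof (rule extensionalityI)
        fix g assume g: "g \<in> carrier G"
        then obtain g' where "g' \<in> carrier H" "\<phi> (G.class_sum g) = H.class_sum g'" using to_class_sum by blast
        thus "\<chi>1 g = \<chi>2 g" using \<Phi>[OF \<chi>(1)] \<Phi>[OF \<chi>(2)] g eq unfolding matched_def by metis
      qed (use \<chi> G.irr_character_extensional in auto)
    qed
    show "\<Phi> ` irr_characters G = irr_characters H"
    proof (intro equalityI subsetI)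
      fix \<chi>' assume \<chi>': "\<chi>' \<in> irr_characters H"
      obtain \<chi> where \<chi>: "\<chi> \<in> irr_characters G"
        "\<And>g' g. \<lbrakk>g' \<in> carrier H; g \<in> carrier G; \<psi> (H.class_sum g') = G.class_sum g\<rbrakk> \<Longrightarrow> \<chi> g = \<chi>' g'"
        using inv.matching_character[OF \<chi>'] by metis
      have "\<Phi> \<chi> = \<chi>'"
      proof (rule extensionalityI)
        fix g' assume g': "g' \<in> carrier H"
        then obtain g where g: "g \<in> carrier G" "\<psi> (H.class_sum g') = G.class_sum g" using from_class_sum by blast
        have "\<phi> (G.class_sum g) = H.class_sum g'" using g(2) g' by (metis \<phi>_\<psi> H.class_sum_center)
        thus "\<Phi> \<chi> g' = \<chi>' g'" using \<Phi>[OF \<chi>(1)] \<chi>(2)[OF g' g] g(1) g' unfolding matched_def by metis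
      qed (use \<Phi>[OF \<chi>(1)] \<chi>' H.irr_character_extensional in auto)
      thus "\<chi>' \<in> \<Phi> ` irr_characters G" using \<chi>(1) by blast
    qed (use \<Phi> in auto)
  qed
  moreover have "\<chi> g = \<Phi> \<chi> g'"
    if "\<chi> \<in> irr_characters G" "C \<in> conjugacy_classes G" "g \<in> C" "g' \<in> \<Psi> C" for \<chi> C g g'
    using \<Phi>[OF that(1)] \<Psi>_elems[OF that(2-4)] unfolding matched_def by metis
  ultimately show ?thesis unfolding identical_character_tables_def using bij_classes by blast
qed

end

section \<open>From character tables to centres\<close>

locale identical_tables = G: finite_grp G + H: finite_grp H
  for G :: "('a, 'c) monoid_scheme" (structure) and H :: "('b, 'd) monoid_scheme" (structure) +
  fixes \<Phi> :: "('a \<Rightarrow> complex) \<Rightarrow> 'b \<Rightarrow> complex" and \<Psi> :: "'a set \<Rightarrow> 'b set"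
  assumes bij_chars: "bij_betw \<Phi> (irr_characters G) (irr_characters H)"
    and bij_cls: "bij_betw \<Psi> (conjugacy_classes G) (conjugacy_classes H)"
    and tables: "\<lbrakk>\<chi> \<in> irr_characters G; C \<in> conjugacy_classes G; g \<in> C; g' \<in> \<Psi> C\<rbrakk> \<Longrightarrow> \<chi> g = \<Phi> \<chi> g'"
begin

definition corr :: "'a \<Rightarrow> 'b \<Rightarrow> bool" where
  "corr g g' \<longleftrightarrow> g \<in> carrier G \<and> g' \<in> carrier H \<and> \<Psi> (G.conj_class g) = H.conj_class g'"

lemma corr_carrier: "corr g g' \<Longrightarrow> g \<in> carrier G" "corr g g' \<Longrightarrow> g' \<in> carrier H"
  by (simp_all add: corr_def)

lemma corr_left_total:
  assumes "g \<in> carrier G" shows "\<exists>g'. corr g g'"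
proof -
  have "\<Psi> (G.conj_class g) \<in> conjugacy_classes H"
    using assms bij_cls by (auto simp: bij_betw_def G.conjugacy_classes_eq)
  thus ?thesis using assms by (auto simp: corr_def H.conjugacy_classes_eq)
qed

lemma corr_right_total:
  assumes "g' \<in> carrier H" shows "\<exists>g. corr g g'"
proof -
  have "H.conj_class g' \<in> \<Psi> ` conjugacy_classes G"
    using assms bij_cls by (auto simp: bij_betw_def H.conjugacy_classes_eq)
  thus ?thesis using assms by (auto simp: corr_def G.conjugacy_classes_eq)
qed

lemma corr_value:
  assumes "\<chi> \<in> irr_characters G" "corr g g'" shows "\<chi> g = \<Phi> \<chi> g'"
  using assms G.conj_class_self H.conj_class_self
  by (intro tables[of _ "G.conj_class g"]) (auto simp: corr_def G.conjugacy_classes_eq)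

lemma column_sums:
  assumes "corr g g'" "corr x x'"
  shows "(\<Sum>\<chi>\<in>irr_characters G. \<chi> g * \<chi> x) = (\<Sum>\<chi>\<in>irr_characters H. \<chi> g' * \<chi> x')"
proof -
  have "(\<Sum>\<chi>\<in>irr_characters G. \<chi> g * \<chi> x) = (\<Sum>\<chi>\<in>irr_characters G. \<Phi> \<chi> g' * \<Phi> \<chi> x')"
    using assms corr_value by (intro sum.cong) auto
  also have "\<dots> = (\<Sum>\<chi>\<in>irr_characters H. \<chi> g' * \<chi> x')" by (rule sum.reindex_bij_betw[OF bij_chars])
  finally show ?thesis .
qed

text \<open>By column orthogonality the product of the columns of \<open>g\<close> and \<open>x\<close> is the order of a centralizer
  if \<open>x\<close> is conjugate to the inverse of \<open>g\<close> and vanishes otherwise. So the table determines both which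
  classes are inverse to each other and the orders of centralizers.\<close>

lemma centralizer_orders:
  assumes c: "corr g g'"
  shows "card (carrier G) * card (H.conj_class g') = card (carrier H) * card (G.conj_class g)"
proof -
  note g = corr_carrier[OF c]
  obtain x' where x': "corr (inv g) x'" using g corr_left_total by blast
  note x'c = corr_carrier(2)[OF x']
  define S where "S = (\<Sum>\<chi>\<in>irr_characters G. \<chi> g * \<chi> (inv g))"
  have 1: "of_nat (card (G.conj_class g)) * S = of_nat (card (carrier G))"
    using G.column_orthogonality[OF g(1) g(1)] G.conj_class_self[OF g(1)] by (simp add: S_def Coset.order_def)
  have "S \<noteq> 0"
  proof
    assume "S = 0"
    hence "of_nat (card (carrier G)) = (0::complex)" using 1 by simp
    thus False using G.order_pos by (simp add: Coset.order_def)
  qed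
  have "of_nat (card (H.conj_class g')) * S =
      of_nat (card (carrier H)) * of_bool (inv\<^bsub>H\<^esub> x' \<in> H.conj_class g')"
    using H.column_orthogonality[OF g(2), of "inv\<^bsub>H\<^esub> x'"] x'c column_sums[OF c x']
    by (simp add: S_def Coset.order_def)
  moreover have "of_nat (card (H.conj_class g')) * S \<noteq> 0"
    using \<open>S \<noteq> 0\<close> H.conj_class_self[OF g(2)] by auto
  ultimately have 2: "of_nat (card (H.conj_class g')) * S = of_nat (card (carrier H))"
    by (auto split: if_splits)
  have "complex_of_nat (card (carrier G) * card (H.conj_class g')) =
      of_nat (card (carrier H) * card (G.conj_class g))"
    using 1 2 by (simp add: mult_ac flip: 1 2)
  thus ?thesis by (simp only: of_nat_eq_iff)
qed

text \<open>Apply the previous lemma to the two identity elements, whose classes have only one element.\<close>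

lemma card_groups: "card (carrier G) = card (carrier H)"
proof (rule antisym)
  obtain z where z: "corr \<one> z" using corr_left_total by blast
  show "card (carrier G) \<le> card (carrier H)"
    using centralizer_orders[OF z] H.card_conj_class_pos[OF corr_carrier(2)[OF z]]
      mult_le_mono2[of 1 "card (H.conj_class z)" "card (carrier G)"] by simp
  obtain z' where z': "corr z' \<one>\<^bsub>H\<^esub>" using corr_right_total by blast
  show "card (carrier H) \<le> card (carrier G)"
    using centralizer_orders[OF z'] G.card_conj_class_pos[OF corr_carrier(1)[OF z']]
      mult_le_mono2[of 1 "card (G.conj_class z')" "card (carrier H)"] by simp
qed

lemma card_corr_classes: "corr g g' \<Longrightarrow> card (H.conj_class g') = card (G.conj_class g)"
  using centralizer_orders[of g g'] card_groups H.order_neq_0 by (simp add: Coset.order_def)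

sublocale class_matching G H \<Psi>
proof
  fix C assume "C \<in> conjugacy_classes G"
  then obtain g where g: "g \<in> carrier G" "C = G.conj_class g" by (auto simp: G.conjugacy_classes_eq)
  obtain g' where "corr g g'" using corr_left_total g(1) by blast
  thus "card (\<Psi> C) = card C" using card_corr_classes g(2) by (auto simp: corr_def)
qed (rule bij_cls)

lemma corr_of_classes:
  assumes C: "C \<in> conjugacy_classes G" "g \<in> C" "g' \<in> \<Psi> C" shows "corr g g'"
proof -
  obtain h where h: "h \<in> carrier G" "C = G.conj_class h" using C(1) by (auto simp: G.conjugacy_classes_eq)
  obtain h' where h': "corr h h'" using corr_left_total h(1) by blast
  have h'2: "h' \<in> carrier H" "\<Psi> C = H.conj_class h'" using h' h(2) by (auto simp: corr_def)
  have "g \<in> carrier G" "G.conj_class g = C" using h C(2) G.conj_class_subset G.conj_class_eq by blast+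
  moreover have "g' \<in> carrier H" "H.conj_class g' = \<Psi> C"
    using h'2 C(3) H.conj_class_subset H.conj_class_eq by blast+
  ultimately show ?thesis by (simp add: corr_def)
qed

text \<open>The class matched with the identity consists of a central element \<open>z\<close>, on which \<open>\<Phi> \<chi>\<close> takes the
  value \<open>\<chi> \<one>\<close>. The quotient of this value by the degree of \<open>\<Phi> \<chi>\<close> is a root of unity, because the
  spherical function of \<open>\<Phi> \<chi>\<close> is multiplicative on the powers of \<open>z\<close>. Being positive, it is \<open>1\<close>.\<close>

lemma degree:
  assumes \<chi>: "\<chi> \<in> irr_characters G"
  shows "\<Phi> \<chi> \<one>\<^bsub>H\<^esub> = \<chi> \<one>"
proof -
  obtain z where z: "corr \<one> z" using corr_left_total by blast
  note zc = corr_carrier(2)[OF z]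
  have "card (H.conj_class z) = 1" using card_corr_classes[OF z] by simp
  hence z_class: "H.conj_class z = {z}"
    using H.conj_class_self[OF zc] by (metis card_1_singletonE singletonD)
  have z_conj: "H.conj_by k z = z" if "k \<in> carrier H" for k
    using z_class that by (auto simp: H.conj_class_def)
  have \<chi>': "\<Phi> \<chi> \<in> irr_characters H" using \<chi> bij_chars by (auto simp: bij_betw_def)
  define \<eta> where "\<eta> = (\<lambda>y. \<Phi> \<chi> y / \<Phi> \<chi> \<one>\<^bsub>H\<^esub>)"
  have \<eta>: "H.spherical \<eta>" using H.irr_character_spherical[OF \<chi>'] by (simp add: \<eta>_def)
  have mult: "\<eta> (g \<otimes>\<^bsub>H\<^esub> z) = \<eta> g * \<eta> z" if "g \<in> carrier H" for g
  proof -
    have "of_nat (Coset.order H) * (\<eta> g * \<eta> z) = of_nat (Coset.order H) * \<eta> (g \<otimes>\<^bsub>H\<^esub> z)"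
      using H.spherical_eq[OF \<eta> that zc] by (simp add: z_conj Coset.order_def)
    thus ?thesis by simp
  qed
  have "\<eta> (z [^]\<^bsub>H\<^esub> k) = \<eta> z ^ k" for k :: nat
    by (induction k) (simp_all add: H.spherical_one[OF \<eta>] mult zc)
  hence root: "\<eta> z ^ Coset.order H = 1"
    using H.pow_order_eq_1[OF zc] H.spherical_one[OF \<eta>] by metis
  have norm1: "cmod (\<eta> z) = 1" using power_eq_1_iff[OF root] H.order_neq_0 by simp
  obtain m n where mn: "\<chi> \<one> = of_nat m" "\<Phi> \<chi> \<one>\<^bsub>H\<^esub> = of_nat n" "n > 0"
    using \<chi> \<chi>' by (metis G.irr_character_cases H.irr_character_cases)
  have "of_nat m = of_nat n * \<eta> z" using corr_value[OF \<chi> z] mn by (simp add: \<eta>_def)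
  hence "cmod (of_nat m) = cmod (of_nat n) * cmod (\<eta> z)" by (metis norm_mult)
  hence "m = n" using norm1 by simp
  thus ?thesis using mn by simp
qed

lemma corr_spherical:
  assumes \<eta>: "H.spherical \<eta>"
  obtains \<theta> where "G.spherical \<theta>" "\<And>g g'. corr g g' \<Longrightarrow> \<eta> g' = \<theta> g"
proof -
  obtain \<chi>' where \<chi>': "\<chi>' \<in> irr_characters H" "\<And>y. y \<in> carrier H \<Longrightarrow> \<chi>' y = \<chi>' \<one>\<^bsub>H\<^esub> * \<eta> y"
    using H.spherical_imp_irr_character[OF \<eta>] by blast
  obtain \<chi> where \<chi>: "\<chi> \<in> irr_characters G" "\<chi>' = \<Phi> \<chi>" using \<chi>'(1) bij_chars by (auto simp: bij_betw_def)
  have "\<eta> g' = \<chi> g / \<chi> \<one>" if c: "corr g g'" for g g'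
    using corr_value[OF \<chi>(1) c] \<chi>'(2)[of g'] corr_carrier[OF c] degree[OF \<chi>(1)] \<chi>(2)
      G.irr_character_degree_neq_0[OF \<chi>(1)] by simp
  thus ?thesis using that G.irr_character_spherical[OF \<chi>(1)] by blast
qed

text \<open>The linear extension of the matching of class sums, given by copying the coefficients along \<open>corr\<close>. For class
  functions the choice of \<open>x\<close> does not matter.\<close>

definition transport :: "('a \<Rightarrow> int) \<Rightarrow> 'b \<Rightarrow> int" where
  "transport f y = (if y \<in> carrier H then f (SOME x. corr x y) else 0)"

lemma transport_eq:
  assumes f: "G.class_function f" and c: "corr x y"
  shows "transport f y = f x"
proof -
  define x' where "x' = (SOME x. corr x y)"
  have c': "corr x' y" unfolding x'_def using c by (rule someI)
  have "G.conj_class x' = G.conj_class x"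
    by (rule inj_onD[OF bij_betw_imp_inj_on[OF bij_cls]])
      (use c c' in \<open>auto simp: corr_def G.conjugacy_classes_eq\<close>)
  hence "x' \<in> G.conj_class x" using G.conj_class_self corr_carrier(1)[OF c'] by blast
  hence "f x' = f x" using G.class_function_on_class[OF f] corr_carrier(1)[OF c] by blast
  thus ?thesis using corr_carrier(2)[OF c] by (simp add: transport_def x'_def)
qed

lemma transport_closed:
  assumes f: "f \<in> G.center" shows "transport f \<in> H.center"
proof (rule H.centerI)
  show "H.class_function (transport f)"
    unfolding H.class_function_def
  proof (intro ballI)
    fix y k assume yk: "y \<in> carrier H" "k \<in> carrier H"
    obtain x where x: "corr x y" using corr_right_total yk(1) by blast
    have "corr x (H.conj_by k y)" using x yk(2) by (simp add: corr_def)
    thus "transport f (H.conj_by k y) = transport f y"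
      using transport_eq[OF G.center_class_function[OF f]] x by metis
  qed
qed (simp add: transport_def)

lemma bij_transport: "bij_betw transport G.center H.center"
proof (rule bij_betw_imageI)
  show "inj_on transport G.center"
  proof (intro inj_onI G.center_eqI)
    fix f h x assume fh: "f \<in> G.center" "h \<in> G.center" "transport f = transport h" and "x \<in> carrier G"
    then obtain y where "corr x y" using corr_left_total by blast
    thus "f x = h x" using transport_eq G.center_class_function fh by metis
  qed
  show "transport ` G.center = H.center"
  proof (intro equalityI subsetI)
    fix h assume h: "h \<in> H.center"
    define f where "f x = (if x \<in> carrier G then h (SOME y. corr x y) else 0)" for x
    have f_eq: "f x = h y" if c: "corr x y" for x y
    proof -
      define y' where "y' = (SOME y. corr x y)"
      have "corr x y'" unfolding y'_def using c by (rule someI)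
      hence "y' \<in> H.conj_class y" using c H.conj_class_self by (auto simp: corr_def)
      hence "h y' = h y"
        using H.class_function_on_class[OF H.center_class_function[OF h]] corr_carrier(2)[OF c] by blast
      thus ?thesis using corr_carrier(1)[OF c] by (simp add: f_def y'_def)
    qed
    have f: "f \<in> G.center"
    proof (rule G.centerI)
      show "G.class_function f"
        unfolding G.class_function_def
      proof (intro ballI)
        fix x k assume xk: "x \<in> carrier G" "k \<in> carrier G"
        obtain y where y: "corr x y" using corr_left_total xk(1) by blast
        have "corr (G.conj_by k x) y" using y xk(2) by (simp add: corr_def)
        thus "f (G.conj_by k x) = f x" using f_eq y by metis
      qed
    qed (simp add: f_def)
    have "transport f = h"
    proof (rule H.center_eqI[OF transport_closed[OF f] h])
      fix y assume "y \<in> carrier H"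
      then obtain x where "corr x y" using corr_right_total by blast
      thus "transport f y = h y" using transport_eq[OF G.center_class_function[OF f]] f_eq by metis
    qed
    thus "h \<in> transport ` G.center" using f by blast
  qed (auto intro: transport_closed)
qed

lemma pairing_transport:
  assumes f: "f \<in> G.center" and m: "\<And>g g'. corr g g' \<Longrightarrow> \<eta> g' = \<theta> g"
  shows "H.pairing (\<lambda>y. of_int (transport f y)) \<eta> = G.pairing (\<lambda>x. of_int (f x)) \<theta>"
  unfolding G.pairing_def H.pairing_def
  using corr_of_classes m transport_eq[OF G.center_class_function[OF f]] by (intro sum_matching) metis

text \<open>Both sides of each multiplicative identity have the same pairing with every spherical function of
  \<open>H\<close>, and these pairings separate class functions.\<close>

lemma center_iso_transport: "center_iso G H transport"
proof (unfold_locales, goal_cases)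
  case 1
  show ?case by (rule bij_transport)
next
  case (2 f h)
  show ?case by (simp add: transport_def fun_eq_iff)
next
  case (3 f h)
  show ?case
  proof (rule H.center_eqI)
    show "transport (G.center_mult f h) \<in> H.center" using 3 by (intro transport_closed G.center_mult_closed)
    show "H.center_mult (transport f) (transport h) \<in> H.center"
      using 3 by (intro transport_closed H.center_mult_closed)
    fix y assume y: "y \<in> carrier H"
    have "complex_of_int (transport (G.center_mult f h) y) =
        of_int (H.center_mult (transport f) (transport h) y)"
    proof (rule H.class_function_eqI[OF _ _ y])
      fix \<eta> assume \<eta>: "H.spherical \<eta>"
      obtain \<theta> where \<theta>: "G.spherical \<theta>" "\<And>g g'. corr g g' \<Longrightarrow> \<eta> g' = \<theta> g"
        using corr_spherical[OF \<eta>] by blast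
      note pair = pairing_transport[of _ \<eta> \<theta>, OF _ \<theta>(2)]
      show "H.pairing (\<lambda>y. of_int (transport (G.center_mult f h) y)) \<eta> =
          H.pairing (\<lambda>y. of_int (H.center_mult (transport f) (transport h) y)) \<eta>"
        using 3 by (simp add: pair G.center_mult_closed G.pairing_center_mult[OF \<theta>(1)]
            H.pairing_center_mult[OF \<eta>] transport_closed)
    qed (use 3 in \<open>auto intro!: H.of_int_class_function transport_closed\<close>)
    thus "transport (G.center_mult f h) y = H.center_mult (transport f) (transport h) y" by simp
  qed
next
  case 4
  show ?case
  proof (rule H.center_eqI)
    fix y assume y: "y \<in> carrier H"
    have "complex_of_int (transport (G.class_sum \<one>) y) = of_int (H.class_sum \<one>\<^bsub>H\<^esub> y)"
    proof (rule H.class_function_eqI[OF _ _ y])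
      fix \<eta> assume \<eta>: "H.spherical \<eta>"
      obtain \<theta> where \<theta>: "G.spherical \<theta>" "\<And>g g'. corr g g' \<Longrightarrow> \<eta> g' = \<theta> g"
        using corr_spherical[OF \<eta>] by blast
      show "H.pairing (\<lambda>y. of_int (transport (G.class_sum \<one>) y)) \<eta> =
          H.pairing (\<lambda>y. of_int (H.class_sum \<one>\<^bsub>H\<^esub> y)) \<eta>"
        using G.pairing_class_sum[OF G.one_closed G.spherical_class_function[OF \<theta>(1)]] G.spherical_one[OF \<theta>(1)]
          H.pairing_class_sum[OF H.one_closed H.spherical_class_function[OF \<eta>]] H.spherical_one[OF \<eta>]
        by (simp add: pairing_transport[of _ \<eta> \<theta>, OF _ \<theta>(2)])
    qed (auto intro!: H.of_int_class_function H.class_function_class_sum transport_closed)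
    thus "transport (G.class_sum \<one>) y = H.class_sum \<one>\<^bsub>H\<^esub> y" by simp
  qed (auto intro!: transport_closed)
qed

end

text \<open>The ring isomorphisms in the statement are exactly the maps treated above.\<close>

lemma ring_center_iso_iff:
  fixes G :: "('a, 'c) monoid_scheme" and H :: "('b, 'd) monoid_scheme"
  assumes "finite_grp G" "finite_grp H"
  shows "ring_center (integral_group_ring G) \<simeq> ring_center (integral_group_ring H) \<longleftrightarrow>
    (\<exists>\<phi>. center_iso G H \<phi>)"
proof -
  interpret G: finite_grp G by fact
  interpret H: finite_grp H by fact
  have "\<phi> \<in> ring_iso (ring_center (integral_group_ring G)) (ring_center (integral_group_ring H)) \<longleftrightarrow>
      center_iso G H \<phi>" for \<phi>
  proof
    assume "\<phi> \<in> ring_iso (ring_center (integral_group_ring G)) (ring_center (integral_group_ring H))"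
    thus "center_iso G H \<phi>"
      by unfold_locales (auto simp: ring_iso_def Ring.ring_hom_def G.carrier_ring_center H.carrier_ring_center
          G.ring_center_simps H.ring_center_simps Pi_iff)
  next
    assume "center_iso G H \<phi>"
    then interpret center_iso G H \<phi> .
    show "\<phi> \<in> ring_iso (ring_center (integral_group_ring G)) (ring_center (integral_group_ring H))"
      using bij by (auto simp: ring_iso_def Ring.ring_hom_def G.carrier_ring_center H.carrier_ring_center
          G.ring_center_simps H.ring_center_simps add mult one)
  qed
  thus ?thesis by (auto simp: is_ring_iso_def)
qed

theorem corollary12:
  fixes G :: "('a, 'c) monoid_scheme" and G' :: "('b, 'd) monoid_scheme"
  assumes "nilpotent_group G" and "finite (carrier G)"
    and "nilpotent_group G'" and "finite (carrier G')"
  shows "identical_character_tables G G' \<longleftrightarrow>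
         ring_center (integral_group_ring G) \<simeq> ring_center (integral_group_ring G')"
proof -
  have fG: "finite_grp G" and fG': "finite_grp G'"
    using assms by (auto simp: finite_grp_def finite_grp_axioms_def nilpotent_group_def)
  interpret G: finite_grp G by (rule fG)
  interpret G': finite_grp G' by (rule fG')
  have to_iso: "\<exists>\<phi>. center_iso G G' \<phi>" if tables: "identical_character_tables G G'"
  proof -
    have "\<exists>\<Phi> \<Psi>. identical_tables G G' \<Phi> \<Psi>"
      using tables fG fG'
      unfolding identical_character_tables_def identical_tables_def identical_tables_axioms_def by blast
    thus ?thesis using identical_tables.center_iso_transport by blast
  qed
  have "identical_character_tables G G'" if "center_iso G G' \<phi>" for \<phi>
  proof -
    interpret center_iso G G' \<phi> by (rule that)
    obtain \<phi>' where "normalized_center_iso G G' \<phi>'" using exists_normalized by blast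
    then interpret N: normalized_center_iso G G' \<phi>' .
    obtain m n where mn: "lower_central G m = {\<one>\<^bsub>G\<^esub>}" "lower_central G' n = {\<one>\<^bsub>G'\<^esub>}"
      using assms by (auto simp: nilpotent_group_def)
    define k where "k = max m n"
    have "G.upper_central k = carrier G" "G'.upper_central k = carrier G'"
      using G.upper_central_eq_carrier[OF mn(1)] G'.upper_central_eq_carrier[OF mn(2)] by (auto simp: k_def)
    hence "class_sum_iso G G' \<phi>'"
      using N.class_sums_correspond[of k] by unfold_locales auto
    thus ?thesis by (rule class_sum_iso.identical_character_tables)
  qed
  thus ?thesis
    unfolding ring_center_iso_iff[OF fG fG'] using to_iso by blast
qed

end
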